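(* Let $\Bbbk$ be a field, let $L$ be a (two-sided) ladder with $v$ lower-outside corners, let $\mathbf{t}=(t_1,\ldots,t_v)\in\mathbb{Z}_{>0}^v$, and assume that $L$ is non-degenerate with respect to $\mathbf t$. Let $I_{\mathbf t}(L)\subseteq\Bbbk[L]$ be the corresponding mixed ladder determinantal ideal. Then $\mathcal{R}^s(I_{\mathbf t}(L))=\bigoplus_{n\ge0}I_{\mathbf t}(L)^{(n)}T^n\subseteq \Bbbk[L][T]$ and $\mathrm{gr}^s(I_{\mathbf t}(L))=\bigoplus_{n\ge0}I_{\mathbf t}(L)^{(n)}/I_{\mathbf t}(L)^{(n+1)}$ are Noetherian rings.
   Context: Ladders. Let $X=(x_{i,j})$ be a $k\times\ell$ matrix of distinct indeterminates. A subset $L\subseteq X$ is a (two-sided) ladder if whenever $x_{i,j},x_{i',j'}\in L$ with $i\le i'$ and $j\ge j'$, then $x_{u,w}\in L$ for all $i\le u\le i'$, $j'\le w\le j$. (An entry with indices out of range is regarded as not in $L$.) The upper-outside corners of $L$ are the elements $x_{b_1,a_1},\ldots,x_{b_u,a_u}\in L$, with $1=b_1<\cdots<b_u$ and $a_1<\cdots<a_u=\ell$, defined by $x_{b_h-1,a_h}\notin L$ and $x_{b_h,a_h+1}\notin L$. The lower-outside corners $x_{d_1,c_1},\ldots,x_{d_v,c_v}\in L$, with $d_1\le\cdots\le d_v=k$ and $1=c_1\le\cdots\le c_v$, are part of the data of the ladder: they include all $x_{i,j}\in L$ with $x_{i+1,j}\notin L$ and $x_{i,j-1}\notin L$, and each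 of them satisfies $x_{d_h+1,c_h}\notin L$ or $x_{d_h,c_h-1}\notin L$. All corners are assumed distinct. For $j=1,\ldots,v$ set $L_j=\{x_{b,a}\in L\mid 1\le b\le d_j,\ c_j\le a\le \ell\}$. Ideals. $\Bbbk[L]$ is the polynomial ring over $\Bbbk$ in the entries of $L$. For a positive integer $t$ and a subladder $L'\subseteq L$, $I_t(L')$ is the ideal of $\Bbbk[L]$ generated by the $t$-minors of $X$ all of whose entries lie in $L'$. The mixed ladder determinantal ideal is $I_{\mathbf t}(L)=I_{t_1}(L_1)+\cdots+I_{t_v}(L_v)$; it is prime. Non-degenerate: $L$ is non-degenerate with respect to $\mathbf t$ if (1) every entry of $L$ is involved in some of the generating minors of $I_{\mathbf t}(L)$; (2) no two consecutive corners coincide, and no two upper-outside corners belong to the same row or the same column; (3) $I_{t_i}(L_i)\not\subseteq I_{t_j}(L_j)$ for all $i\ne j$; (4) no proper submatrix of $X$ contains $L$. $I^{(n)}$ denotes the $n$-th symbolic power of $I$, with $I^{(0)}$ the whole ring; $T$ is a variable. *)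

theory Defs
  imports
    "HOL-Library.Poly_Mapping"
    "HOL-Algebra.Algebra"
    "Jordan_Normal_Form.Determinant"
begin

section \<open>Symbolic powers and symbolic blowup algebras\<close>

definition associated_primes :: "('a, 'b) ring_scheme \<Rightarrow> 'a set \<Rightarrow> 'a set set" where
  "associated_primes R I =
     {P. primeideal P R \<and> (\<exists>a\<in>carrier R. P = {r \<in> carrier R. r \<otimes>\<^bsub>R\<^esub> a \<in> I})}"

text \<open>
  The \<open>n\<close>-th symbolic power is the intersection of the contractions of \<open>I\<^sup>n R\<^sub>P\<close> to \<open>R\<close> over the
  associated primes \<open>P\<close> of \<open>R/I\<close>; the contraction is written out elementwise. If \<open>I\<close> is prime, the
  only such \<open>P\<close> is \<open>I\<close> itself. Powers of ideals are taken in the semiring of ideals, whose unit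
  is \<open>R\<close>, so \<open>symbolic_power R I 0 = carrier R\<close>.
\<close>

definition symbolic_power :: "('a, 'b) ring_scheme \<Rightarrow> 'a set \<Rightarrow> nat \<Rightarrow> 'a set" where
  "symbolic_power R I n =
     {f \<in> carrier R. \<forall>P\<in>associated_primes R I.
        \<exists>s\<in>carrier R - P. s \<otimes>\<^bsub>R\<^esub> f \<in> I [^]\<^bsub>ideals_set R\<^esub> n}"

definition rees_ring :: "('a, 'b) ring_scheme \<Rightarrow> (nat \<Rightarrow> 'a set) \<Rightarrow> ('a, nat \<Rightarrow> 'a) up_ring" where
  "rees_ring R F =
     (UP R)\<lparr>carrier := {p \<in> carrier (UP R). \<forall>n. up_ring.coeff (UP R) p n \<in> F n}\<rparr>"

text \<open>
  An element of the direct sum of the \<open>F n / F (n + 1)\<close> is the sequence of its homogeneous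
  components, which are cosets of \<open>F (n + 1)\<close>. The product of the classes of \<open>x \<in> F i\<close> and
  \<open>y \<in> F j\<close> is the class of \<open>x y\<close> modulo \<open>F (i + j + 1)\<close>.
\<close>

definition assoc_graded_ring ::
    "('a, 'b) ring_scheme \<Rightarrow> (nat \<Rightarrow> 'a set) \<Rightarrow> (nat \<Rightarrow> 'a set) ring" where
  "assoc_graded_ring R F =
     \<lparr>carrier = {f. (\<forall>n. \<exists>x\<in>F n. f n = F (Suc n) +>\<^bsub>R\<^esub> x) \<and> finite {n. f n \<noteq> F (Suc n)}},
      monoid.mult = (\<lambda>f g n. \<Oplus>\<^bsub>R Quot F (Suc n)\<^esub>i\<in>{..n}. rcoset_mult R (F (Suc n)) (f i) (g (n - i))),
      monoid.one = (\<lambda>n. if n = 0 then F 1 +>\<^bsub>R\<^esub> \<one>\<^bsub>R\<^esub> else F (Suc n)),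
      ring.zero = (\<lambda>n. F (Suc n)),
      ring.add = (\<lambda>f g n. f n <+>\<^bsub>R\<^esub> g n)\<rparr>"

definition symbolic_rees :: "('a, 'b) ring_scheme \<Rightarrow> 'a set \<Rightarrow> ('a, nat \<Rightarrow> 'a) up_ring" where
  "symbolic_rees R I = rees_ring R (symbolic_power R I)"

definition symbolic_gr :: "('a, 'b) ring_scheme \<Rightarrow> 'a set \<Rightarrow> (nat \<Rightarrow> 'a set) ring" where
  "symbolic_gr R I = assoc_graded_ring R (symbolic_power R I)"


section \<open>Ladders\<close>

text \<open>
  The entry \<open>x\<^sub>i\<^sub>j\<close> is represented by its index pair \<open>(i, j)\<close>, rows and columns counted from 1.
  Truncated subtraction is harmless below: index 0 never occurs in a ladder.
\<close>

definition ladder :: "nat \<Rightarrow> nat \<Rightarrow> (nat \<times> nat) set \<Rightarrow> bool" where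
  "ladder k l L \<longleftrightarrow>
     L \<subseteq> {1..k} \<times> {1..l} \<and>
     (\<forall>i j i' j'. (i, j) \<in> L \<longrightarrow> (i', j') \<in> L \<longrightarrow> i \<le> i' \<longrightarrow> j' \<le> j \<longrightarrow>
        {i..i'} \<times> {j'..j} \<subseteq> L)"

definition upper_outside_corners ::
    "nat \<Rightarrow> (nat \<times> nat) set \<Rightarrow> nat \<Rightarrow> (nat \<Rightarrow> nat) \<Rightarrow> (nat \<Rightarrow> nat) \<Rightarrow> bool" where
  "upper_outside_corners l L u b a \<longleftrightarrow>
     1 \<le> u \<and> b 1 = 1 \<and> a u = l \<and>
     strict_mono_on {1..u} b \<and> strict_mono_on {1..u} a \<and>
     {(b h, a h) | h. h \<in> {1..u}} = {(i, j) \<in> L. (i - 1, j) \<notin> L \<and> (i, j + 1) \<notin> L}"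

definition lower_outside_corners ::
    "nat \<Rightarrow> (nat \<times> nat) set \<Rightarrow> nat \<Rightarrow> (nat \<Rightarrow> nat) \<Rightarrow> (nat \<Rightarrow> nat) \<Rightarrow> bool" where
  "lower_outside_corners k L v d c \<longleftrightarrow>
     1 \<le> v \<and> d v = k \<and> c 1 = 1 \<and>
     mono_on {1..v} d \<and> mono_on {1..v} c \<and>
     (\<forall>h\<in>{1..v}. (d h, c h) \<in> L) \<and>
     {(i, j) \<in> L. (i + 1, j) \<notin> L \<and> (i, j - 1) \<notin> L} \<subseteq> {(d h, c h) | h. h \<in> {1..v}} \<and>
     (\<forall>h\<in>{1..v}. (d h + 1, c h) \<notin> L \<or> (d h, c h - 1) \<notin> L)"

text \<open>All \<open>u + v\<close> corners are pairwise distinct as elements of the ladder.\<close>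

definition corners_distinct ::
    "nat \<Rightarrow> (nat \<Rightarrow> nat) \<Rightarrow> (nat \<Rightarrow> nat) \<Rightarrow> nat \<Rightarrow> (nat \<Rightarrow> nat) \<Rightarrow> (nat \<Rightarrow> nat) \<Rightarrow> bool" where
  "corners_distinct u b a v d c \<longleftrightarrow>
     inj_on (\<lambda>h. (b h, a h)) {1..u} \<and> inj_on (\<lambda>h. (d h, c h)) {1..v} \<and>
     (\<lambda>h. (b h, a h)) ` {1..u} \<inter> (\<lambda>h. (d h, c h)) ` {1..v} = {}"

definition subladder ::
    "nat \<Rightarrow> (nat \<times> nat) set \<Rightarrow> (nat \<Rightarrow> nat) \<Rightarrow> (nat \<Rightarrow> nat) \<Rightarrow> nat \<Rightarrow> (nat \<times> nat) set" where
  "subladder l L d c j = {(p, q) \<in> L. 1 \<le> p \<and> p \<le> d j \<and> c j \<le> q \<and> q \<le> l}"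


section \<open>Mixed ladder determinantal ideals\<close>

text \<open>Polynomials in the \<open>x\<^sub>i\<^sub>j\<close>, as finitely supported functions on monomials (exponent maps).\<close>

type_synonym 'k mpoly = "((nat \<times> nat) \<Rightarrow>\<^sub>0 nat) \<Rightarrow>\<^sub>0 'k"

definition Var :: "nat \<times> nat \<Rightarrow> 'k::field mpoly" where
  "Var x = Poly_Mapping.single (Poly_Mapping.single x 1) 1"

definition ladder_ring :: "(nat \<times> nat) set \<Rightarrow> 'k::field mpoly ring" where
  "ladder_ring L =
     \<lparr>carrier = {f. \<forall>m\<in>Poly_Mapping.keys f. Poly_Mapping.keys m \<subseteq> L},
      monoid.mult = (*), monoid.one = 1, ring.zero = 0, ring.add = (+)\<rparr>"

definition rows_cols_in :: "nat \<Rightarrow> (nat \<times> nat) set \<Rightarrow> nat set \<Rightarrow> nat set \<Rightarrow> bool" where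
  "rows_cols_in t L' A B \<longleftrightarrow>
     finite A \<and> finite B \<and> card A = t \<and> card B = t \<and> A \<times> B \<subseteq> L'"

definition minor :: "nat set \<Rightarrow> nat set \<Rightarrow> 'k::field mpoly" where
  "minor A B = det (mat (card A) (card B)
     (\<lambda>(p, q). Var (sorted_list_of_set A ! p, sorted_list_of_set B ! q)))"

definition minors_ideal :: "(nat \<times> nat) set \<Rightarrow> nat \<Rightarrow> (nat \<times> nat) set \<Rightarrow> 'k::field mpoly set" where
  "minors_ideal L t L' = genideal (ladder_ring L) {minor A B | A B. rows_cols_in t L' A B}"

text \<open>Addition in the semiring of ideals is the sum of ideals.\<close>

definition mixed_ladder_ideal ::
    "nat \<Rightarrow> (nat \<times> nat) set \<Rightarrow> nat \<Rightarrow> (nat \<Rightarrow> nat) \<Rightarrow> (nat \<Rightarrow> nat) \<Rightarrow> (nat \<Rightarrow> nat)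
      \<Rightarrow> 'k::field mpoly set" where
  "mixed_ladder_ideal l L v d c t =
     (\<Oplus>\<^bsub>ideals_set (ladder_ring L)\<^esub>j\<in>{1..v}. minors_ideal L (t j) (subladder l L d c j))"

text \<open>The type argument is the coefficient field of the ideals.\<close>

definition nondegenerate ::
    "'k::field itself \<Rightarrow> nat \<Rightarrow> nat \<Rightarrow> (nat \<times> nat) set \<Rightarrow> nat \<Rightarrow> (nat \<Rightarrow> nat) \<Rightarrow> (nat \<Rightarrow> nat)
      \<Rightarrow> nat \<Rightarrow> (nat \<Rightarrow> nat) \<Rightarrow> (nat \<Rightarrow> nat) \<Rightarrow> (nat \<Rightarrow> nat) \<Rightarrow> bool" where
  "nondegenerate (_ :: 'k itself) k l L u b a v d c t \<longleftrightarrow>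
     (\<forall>(i, j)\<in>L. \<exists>h\<in>{1..v}. \<exists>A B.
        rows_cols_in (t h) (subladder l L d c h) A B \<and> i \<in> A \<and> j \<in> B) \<and>
     ((\<forall>h\<in>{1..<u}. (b h, a h) \<noteq> (b (h + 1), a (h + 1))) \<and>
      (\<forall>h\<in>{1..<v}. (d h, c h) \<noteq> (d (h + 1), c (h + 1))) \<and>
      (\<forall>g\<in>{1..u}. \<forall>h\<in>{1..u}. g \<noteq> h \<longrightarrow> b g \<noteq> b h \<and> a g \<noteq> a h)) \<and>
     (\<forall>i\<in>{1..v}. \<forall>j\<in>{1..v}. i \<noteq> j \<longrightarrow>
        \<not> (minors_ideal L (t i) (subladder l L d c i) :: 'k mpoly set)
          \<subseteq> minors_ideal L (t j) (subladder l L d c j)) \<and>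
     (\<forall>A B. A \<subseteq> {1..k} \<longrightarrow> B \<subseteq> {1..l} \<longrightarrow> L \<subseteq> A \<times> B \<longrightarrow> A = {1..k} \<and> B = {1..l})"

end

theory Submission
  imports Defs "HOL-Library.Product_Lexorder"
begin

text \<open>
  Let \<open>cap (i, j) + 1\<close> be the least \<open>t\<^sub>h\<close> with \<open>x\<^sub>i\<^sub>j \<in> L\<^sub>h\<close>. Substituting
  \<open>(\<Sum>s = 1..cap (i, j). a\<^sub>s\<^sub>i b\<^sub>s\<^sub>j) + y\<^sub>i\<^sub>j\<close> for \<open>x\<^sub>i\<^sub>j\<close> pulls the order in the variables \<open>y\<close> back to
  a valuation on the ladder ring. The generating minors have positive order, since without the \<open>y\<^sub>i\<^sub>j\<close> the
  matrix has rank less than \<open>t\<^sub>h\<close> on \<open>L\<^sub>h\<close>; hence the \<open>n\<close>-th symbolic power is contained in the set \<open>V n\<close>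
  of elements of order at least \<open>n\<close>.

  Order the monomials by a weight that favours antidiagonals. Let \<open>G \<subseteq> L\<close> carry a labelling
  \<open>1 \<le> s \<le> cap\<close> that increases strictly along the chains running from north-east to south-west. There are
  weights on the parameters for which the top form of the substitution is \<open>a\<^sub>s\<^sub>i b\<^sub>s\<^sub>j\<close> (with \<open>s = s (i, j)\<close>) on
  \<open>G\<close> and \<open>y\<^sub>i\<^sub>j\<close> off \<open>G\<close>, so the leading monomial of an element of \<open>V n\<close> has degree at least \<open>n\<close> in the
  variables outside \<open>G\<close>. Conversely, by a duality of Greene--Kleitman type, a monomial with this property
  for all \<open>G\<close> is the leading monomial of a product of minors that lies in the \<open>n\<close>-th symbolic power; for a
  single minor this is seen from a Schur complement. Reduction then shows that \<open>V n\<close> is the \<open>n\<close>-th symbolic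
  power.

  Thus the leading exponents of the symbolic Rees algebra are the lattice points of a cone given by finitely
  many inequalities. By Dickson's lemma divisibility among them is a well-quasi-order, and division yields
  finite generation of ideals. The associated graded ring is a quotient of the Rees algebra.
\<close>

section \<open>Matchings and chains\<close>

text \<open>The symbolic powers come without generators, and primality of the ideal is proved rather
  than assumed, so both must be drawn from one comparison. The filtration \<open>V\<close> is made
  for this: it is the order of vanishing in a polynomial ring over a field, hence \<open>V 1\<close>
  is prime and factors outside \<open>V 1\<close> can be cancelled, while the generating minors lie
  in \<open>V 1\<close> for reasons of rank. That \<open>V n\<close> contains nothing else is
  checked on leading monomials only, where two bounds meet by integral linear programming duality.
  To restrict \<open>V n\<close>, the generic matrix \<open>gen0\<close> is read as a sum of
  rank-one matrices: a weight of the form \<open>A i + B j\<close> can touch the weight of the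
  variables exactly along a staircase, so each label selects one staircase. To realise a monomial,
  the dual solution of an assignment problem provides such labelled staircases, and the primal
  solution provides the chains that become minors. The top monomials compared have coefficient one
  and are pairwise different, so the characteristic of the field does not matter.\<close>

definition matching :: "('a \<times> 'b) set \<Rightarrow> 'a set \<Rightarrow> 'b set \<Rightarrow> bool" where
  "matching M U Y \<longleftrightarrow> M \<subseteq> U \<times> Y \<and> inj_on fst M \<and> inj_on snd M"

abbreviation weight :: "('a \<Rightarrow> 'b \<Rightarrow> nat) \<Rightarrow> ('a \<times> 'b) set \<Rightarrow> nat" where
  "weight W M \<equiv> (\<Sum>e\<in>M. W (fst e) (snd e))"

lemma matching_subset: "matching M U Y \<Longrightarrow> N \<subseteq> M \<Longrightarrow> matching N U Y"
  unfolding matching_def by (meson inj_on_subset order_trans)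

lemma matching_finite: "matching M U Y \<Longrightarrow> finite U \<Longrightarrow> finite Y \<Longrightarrow> finite M"
  unfolding matching_def by (meson finite_SigmaI finite_subset)

lemma matchingI:
  assumes "M \<subseteq> U \<times> Y"
    and "\<And>x y y'. (x, y) \<in> M \<Longrightarrow> (x, y') \<in> M \<Longrightarrow> y = y'"
    and "\<And>x x' y. (x, y) \<in> M \<Longrightarrow> (x', y) \<in> M \<Longrightarrow> x = x'"
  shows "matching M U Y"
  using assms unfolding matching_def inj_on_def by (auto; metis)

lemma matching_fstD: "matching M U Y \<Longrightarrow> (x, y) \<in> M \<Longrightarrow> (x, y') \<in> M \<Longrightarrow> y = y'"
  unfolding matching_def inj_on_def by fastforce

lemma matching_sndD: "matching M U Y \<Longrightarrow> (x, y) \<in> M \<Longrightarrow> (x', y) \<in> M \<Longrightarrow> x = x'"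
  unfolding matching_def inj_on_def by fastforce

text \<open>If \<open>M1\<close> missed \<open>x\<^sub>0\<close> and \<open>M2\<close> missed
  \<open>y\<^sub>0\<close>, exchanging them along the alternating walk that starts in
  \<open>x\<^sub>0\<close> would give two matchings of the same total weight, one of which leaves
  both ends of the edge free and can be enlarged by it.\<close>

lemma ex_vertex_in_all_optimal_matchings:
  fixes W :: "'a \<Rightarrow> 'b \<Rightarrow> nat"
  assumes fin: "finite U" "finite Y"
    and bound: "\<And>M. matching M U Y \<Longrightarrow> weight W M \<le> B"
    and edge: "x\<^sub>0 \<in> U" "y\<^sub>0 \<in> Y" "W x\<^sub>0 y\<^sub>0 > 0"
    and M1: "matching M1 U Y" "weight W M1 = B"
    and M2: "matching M2 U Y" "weight W M2 = B"
  shows "x\<^sub>0 \<in> fst ` M1 \<or> y\<^sub>0 \<in> snd ` M2"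
proof (rule ccontr)
  assume neg: "\<not> ?thesis"
  \<comment> \<open>\<open>K\<close> is reached from \<open>x\<^sub>0\<close> by an edge of
    \<open>M2\<close> followed backwards by an edge of \<open>M1\<close>. As \<open>M1\<close>
    misses \<open>x\<^sub>0\<close>, every \<open>M1\<close> edge at \<open>K\<close> is entered
    through an \<open>M2\<close> edge at \<open>K\<close>; this is \<open>pred\<close>.\<close>
  define r where "r = {(l, l'). \<exists>y. (l, y) \<in> M2 \<and> (l', y) \<in> M1}"
  define K where "K = {l. (x\<^sub>0, l) \<in> r\<^sup>*}"
  define N1 where "N1 = {e\<in>M1. fst e \<notin> K} \<union> {e\<in>M2. fst e \<in> K}"
  define N2 where "N2 = {e\<in>M2. fst e \<notin> K} \<union> {e\<in>M1. fst e \<in> K}"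
  have x0K: "x\<^sub>0 \<in> K" by (simp add: K_def)
  have step: "l' \<in> K" if "l \<in> K" "(l, y) \<in> M2" "(l', y) \<in> M1" for l l' y
    using that by (auto simp: K_def r_def intro: rtrancl_into_rtrancl)
  have pred: "\<exists>l\<in>K. (l, y) \<in> M2" if l': "l' \<in> K" "(l', y) \<in> M1" for l' y
  proof -
    have "l' \<noteq> x\<^sub>0" using l' neg by force
    moreover have "(x\<^sub>0, l') \<in> r\<^sup>*" using l' by (simp add: K_def)
    ultimately obtain l where "(x\<^sub>0, l) \<in> r\<^sup>*" "(l, l') \<in> r"
      by (auto elim: rtranclE)
    then obtain y' where "l \<in> K" "(l, y') \<in> M2" "(l', y') \<in> M1"
      unfolding K_def r_def by auto
    then show ?thesis using matching_fstD[OF M1(1) l'(2)] by blast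
  qed
  have sub: "M1 \<subseteq> U \<times> Y" "M2 \<subseteq> U \<times> Y" using M1 M2 by (auto simp: matching_def)
  have m1: "matching N1 U Y"
    by (rule matchingI)
      (use sub step matching_fstD[OF M1(1)] matching_sndD[OF M1(1)] matching_fstD[OF M2(1)]
        matching_sndD[OF M2(1)] in \<open>auto simp: N1_def\<close>)
  have m2: "matching (insert (x\<^sub>0, y\<^sub>0) N2) U Y"
  proof (rule matchingI)
    show "insert (x\<^sub>0, y\<^sub>0) N2 \<subseteq> U \<times> Y" using sub edge by (auto simp: N2_def)
    have x0: "(x\<^sub>0, y) \<notin> N2" for y using neg x0K by (force simp: N2_def)
    have y0: "(x, y\<^sub>0) \<notin> N2" for x using neg pred by (force simp: N2_def)
    show "y = y'" if "(x, y) \<in> insert (x\<^sub>0, y\<^sub>0) N2" "(x, y') \<in> insert (x\<^sub>0, y\<^sub>0) N2" for x y y'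
      using that x0 matching_fstD[OF M1(1)] matching_fstD[OF M2(1)] by (auto simp: N2_def)
    show "x = x'" if "(x, y) \<in> insert (x\<^sub>0, y\<^sub>0) N2" "(x', y) \<in> insert (x\<^sub>0, y\<^sub>0) N2" for x x' y
      using that y0 matching_sndD[OF M1(1)] matching_sndD[OF M2(1)] pred
      by (auto simp: N2_def) blast+
  qed
  have f: "finite M1" "finite M2" using matching_finite fin M1 M2 by auto
  have "weight W M1 = weight W {e\<in>M1. fst e \<notin> K} + weight W {e\<in>M1. fst e \<in> K}"
    using f by (subst sum.union_disjoint[symmetric]) (auto intro!: sum.cong)
  moreover have "weight W M2 = weight W {e\<in>M2. fst e \<notin> K} + weight W {e\<in>M2. fst e \<in> K}"
    using f by (subst sum.union_disjoint[symmetric]) (auto intro!: sum.cong)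
  moreover have "weight W N1 = weight W {e\<in>M1. fst e \<notin> K} + weight W {e\<in>M2. fst e \<in> K}"
    using f unfolding N1_def by (subst sum.union_disjoint) auto
  moreover have "weight W N2 = weight W {e\<in>M2. fst e \<notin> K} + weight W {e\<in>M1. fst e \<in> K}"
    using f unfolding N2_def by (subst sum.union_disjoint) auto
  moreover have "weight W N1 \<le> B" using bound m1 by blast
  moreover have "weight W (insert (x\<^sub>0, y\<^sub>0) N2) \<le> B" using bound m2 by blast
  moreover have "(x\<^sub>0, y\<^sub>0) \<notin> N2" using neg x0K by (force simp: N2_def)
  then have "weight W (insert (x\<^sub>0, y\<^sub>0) N2) = W x\<^sub>0 y\<^sub>0 + weight W N2"
    using f by (simp add: N2_def)
  ultimately show False using M1 M2 edge by linarith
qed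

text \<open>Primal-dual induction on the total weight: lowering all weights at a vertex that every
  optimal matching covers lowers the optimum, and is paid for by raising the potential of that
  vertex. \<open>B\<close> is any upper bound, so \<open>B - 1\<close> serves for the next instance
  without computing its optimum.\<close>

lemma egervary_bound:
  fixes W :: "'a \<Rightarrow> 'b \<Rightarrow> nat"
  assumes fin: "finite U" "finite Y"
    and "\<And>M. matching M U Y \<Longrightarrow> weight W M \<le> B"
  shows "\<exists>(p::'a \<Rightarrow> nat) q. (\<forall>x\<in>U. \<forall>y\<in>Y. W x y \<le> p x + q y) \<and> sum p U + sum q Y \<le> B"
  using assms(3)
proof (induction "\<Sum>x\<in>U. \<Sum>y\<in>Y. W x y" arbitrary: W B rule: less_induct)
  case less
  show ?case
  proof (cases "\<forall>x\<in>U. \<forall>y\<in>Y. W x y = 0")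
    case True
    then show ?thesis by (intro exI[of _ "\<lambda>_. 0"]) auto
  next
    case False
    then obtain x0 y0 where e: "x0 \<in> U" "y0 \<in> Y" "W x0 y0 > 0" by auto
    \<comment> \<open>\<open>Z\<close> will be the row or the column of the chosen vertex. Truncated
      subtraction does not lower edges of weight zero, so the hit is required for optimal matchings
      without such edges.\<close>
    have red: "\<exists>(p::'a \<Rightarrow> nat) q. (\<forall>x\<in>U. \<forall>y\<in>Y. W x y - (if (x, y) \<in> Z then 1 else 0) \<le> p x + q y) \<and>
        sum p U + sum q Y \<le> B - 1 \<and> B > 0"
      if Z: "(x0, y0) \<in> Z"
        "\<And>M. matching M U Y \<Longrightarrow> weight W M = B \<Longrightarrow> \<forall>e\<in>M. W (fst e) (snd e) > 0 \<Longrightarrow> M \<inter> Z \<noteq> {}" for Z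
    proof -
      let ?W = "\<lambda>x y. W x y - (if (x, y) \<in> Z then 1 else 0)"
      have lt: "weight ?W M < B" if M: "matching M U Y" for M
      proof -
        have fM: "finite M" using matching_finite[OF M fin] .
        have le: "weight ?W M \<le> weight W M" by (rule sum_mono) simp
        show ?thesis
        proof (cases "weight W M = B")
          case True
          let ?M = "{e\<in>M. W (fst e) (snd e) > 0}"
          have "weight W ?M = weight W M"
            using fM by (intro sum.mono_neutral_left) auto
          moreover have "matching ?M U Y" by (rule matching_subset[OF M]) auto
          ultimately have "?M \<inter> Z \<noteq> {}" by (intro Z(2)) (use True in simp_all)
          then obtain e where e: "e \<in> ?M" "e \<in> Z" by blast
          have "weight ?W M < weight W M"
            by (rule sum_strict_mono_ex1[OF fM]) (use e in \<open>auto intro!: bexI[of _ e]\<close>)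
          then show ?thesis using True by simp
        qed (use less.prems[OF M] le in linarith)
      qed
      have "weight ?W {} < B" by (rule lt) (simp add: matching_def)
      then have B: "B > 0" by simp
      have "(\<Sum>x\<in>U. \<Sum>y\<in>Y. ?W x y) < (\<Sum>x\<in>U. \<Sum>y\<in>Y. W x y)"
      proof (rule sum_strict_mono_ex1[OF fin(1)])
        show "\<forall>x\<in>U. (\<Sum>y\<in>Y. ?W x y) \<le> (\<Sum>y\<in>Y. W x y)" by (auto intro: sum_mono)
        have "(\<Sum>y\<in>Y. ?W x0 y) < (\<Sum>y\<in>Y. W x0 y)"
          by (rule sum_strict_mono_ex1[OF fin(2)]) (use e Z in \<open>auto intro!: bexI[of _ y0]\<close>)
        then show "\<exists>x\<in>U. (\<Sum>y\<in>Y. ?W x y) < (\<Sum>y\<in>Y. W x y)" using e by blast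
      qed
      from less.hyps[OF this, of "B - 1"] lt B show ?thesis by fastforce
    qed
    have "(\<forall>M. matching M U Y \<longrightarrow> weight W M = B \<longrightarrow> x0 \<in> fst ` M) \<or>
          (\<forall>M. matching M U Y \<longrightarrow> weight W M = B \<longrightarrow> y0 \<in> snd ` M)"
      using ex_vertex_in_all_optimal_matchings[OF fin less.prems e] by blast
    then show ?thesis
    proof
      assume A: "\<forall>M. matching M U Y \<longrightarrow> weight W M = B \<longrightarrow> x0 \<in> fst ` M"
      have Z: "M \<inter> ({x0} \<times> UNIV) \<noteq> {}" if "matching M U Y" "weight W M = B" for M
      proof -
        have "x0 \<in> fst ` M" using A that by blast
        then obtain e where "e \<in> M" "fst e = x0" by blast
        then show ?thesis by (cases e) auto
      qed
      have "(x0, y0) \<in> {x0} \<times> UNIV" by simp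
      from red[OF this Z] obtain p :: "'a \<Rightarrow> nat" and q where pq:
        "\<forall>x\<in>U. \<forall>y\<in>Y. W x y - (if (x, y) \<in> {x0} \<times> UNIV then 1 else 0) \<le> p x + q y"
        "sum p U + sum q Y \<le> B - 1" "B > 0"
        by blast
      have "sum (p(x0 := p x0 + 1)) U = sum p U + 1"
        using e fin by (simp add: sum.remove[of U x0])
      then show ?thesis
        using pq by (intro exI[of _ "p(x0 := p x0 + 1)"] exI[of _ q]) fastforce
    next
      assume A: "\<forall>M. matching M U Y \<longrightarrow> weight W M = B \<longrightarrow> y0 \<in> snd ` M"
      have Z: "M \<inter> (UNIV \<times> {y0}) \<noteq> {}" if "matching M U Y" "weight W M = B" for M
      proof -
        have "y0 \<in> snd ` M" using A that by blast
        then obtain e where "e \<in> M" "snd e = y0" by blast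
        then show ?thesis by (cases e) auto
      qed
      have "(x0, y0) \<in> UNIV \<times> {y0}" by simp
      from red[OF this Z] obtain p :: "'a \<Rightarrow> nat" and q where pq:
        "\<forall>x\<in>U. \<forall>y\<in>Y. W x y - (if (x, y) \<in> UNIV \<times> {y0} then 1 else 0) \<le> p x + q y"
        "sum p U + sum q Y \<le> B - 1" "B > 0"
        by blast
      have "sum (q(y0 := q y0 + 1)) Y = sum q Y + 1"
        using e fin by (simp add: sum.remove[of Y y0])
      then show ?thesis
        using pq by (intro exI[of _ p] exI[of _ "q(y0 := q y0 + 1)"]) fastforce
    qed
  qed
qed

theorem egervary:
  fixes W :: "'a \<Rightarrow> 'b \<Rightarrow> nat"
  assumes "finite U" "finite Y"
  obtains M and p :: "'a \<Rightarrow> nat" and q where "matching M U Y"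
    and "\<And>x y. (x, y) \<in> M \<Longrightarrow> W x y > 0"
    and "\<And>x y. x \<in> U \<Longrightarrow> y \<in> Y \<Longrightarrow> W x y \<le> p x + q y"
    and "sum p U + sum q Y \<le> weight W M"
proof -
  let ?S = "{M. matching M U Y}"
  have fin: "finite ?S"
    by (rule finite_subset[of _ "Pow (U \<times> Y)"]) (use assms in \<open>auto simp: matching_def\<close>)
  have "{} \<in> ?S" by (simp add: matching_def)
  then have "Max (weight W ` ?S) \<in> weight W ` ?S" using fin by (intro Max_in) auto
  then obtain M where M0: "matching M U Y" "Max (weight W ` ?S) = weight W M" by auto
  have M: "matching M U Y" "\<And>N. matching N U Y \<Longrightarrow> weight W N \<le> weight W M"
    using fin by (auto simp: M0(1) simp flip: M0(2) intro!: Max_ge)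
  \<comment> \<open>In the application positivity certifies that a matched pair is a relation or a
    loop, so edges of weight zero are dropped.\<close>
  let ?M = "{e\<in>M. W (fst e) (snd e) > 0}"
  have fM: "finite M" using matching_finite[OF M(1) assms] .
  have w: "weight W ?M = weight W M"
    using fM by (intro sum.mono_neutral_left) auto
  from egervary_bound[OF assms, of W "weight W M"] M(2) obtain p :: "'a \<Rightarrow> nat" and q
    where pq: "\<forall>x\<in>U. \<forall>y\<in>Y. W x y \<le> p x + q y" "sum p U + sum q Y \<le> weight W M" by blast
  show ?thesis
  proof (rule that)
    show "matching ?M U Y" by (rule matching_subset[OF M(1)]) blast
    show "sum p U + sum q Y \<le> weight W ?M" using pq(2) w by simp
  qed (use pq(1) in auto)
qed

text \<open>The lists are the paths of the graph of the partial injection \<open>M\<close>.\<close>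

lemma chain_decomposition:
  fixes R :: "'a \<Rightarrow> 'a \<Rightarrow> bool"
  assumes "finite P" and irr: "\<And>x. \<not> R x x"
    and tr: "\<And>x y z. R x y \<Longrightarrow> R y z \<Longrightarrow> R x z"
    and "matching M P P" and "\<And>x y. (x, y) \<in> M \<Longrightarrow> R x y"
  shows "\<exists>Cs. distinct (concat Cs) \<and> set (concat Cs) = P \<and> [] \<notin> set Cs \<and>
    (\<forall>C\<in>set Cs. sorted_wrt R C) \<and> last ` set Cs = P - fst ` M \<and> hd ` set Cs = P - snd ` M"
  using assms(1,4,5)
proof (induction "card P" arbitrary: P M)
  case 0
  then show ?case by (intro exI[of _ "[]"]) (auto simp: matching_def)
next
  case (Suc n)
  have "P \<noteq> {}" using Suc by auto
  moreover have "transp_on P R" using tr by (rule transp_onI)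
  moreover have "asymp_on P R" using tr irr by (metis asymp_onI)
  ultimately obtain x where x: "x \<in> P" "\<And>y. y \<in> P \<Longrightarrow> \<not> R y x"
    using Finite_Set.bex_min_element[OF Suc.prems(1)] irr by metis
  \<comment> \<open>A minimal element is no second component of \<open>M\<close>: it either forms a
    chain of its own or goes in front of the chain of its partner.\<close>
  let ?P = "P - {x}" and ?M = "{e\<in>M. fst e \<noteq> x}"
  have sub: "M \<subseteq> P \<times> P" using Suc.prems by (auto simp: matching_def)
  have nox: "(y, x) \<notin> M" for y using Suc.prems(3) sub x by blast
  have "matching ?M ?P ?P"
    using matching_subset[OF Suc.prems(2), of ?M] nox by (auto simp: matching_def)
  moreover have n: "n = card ?P" using Suc.hyps(2) Suc.prems(1) x(1) by simp
  ultimately obtain Cs where Cs: "distinct (concat Cs)" "set (concat Cs) = ?P" "[] \<notin> set Cs"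
      "\<And>C. C \<in> set Cs \<Longrightarrow> sorted_wrt R C" "last ` set Cs = ?P - fst ` ?M" "hd ` set Cs = ?P - snd ` ?M"
    using Suc.hyps(1)[of ?P ?M] n Suc.prems(1,3) by auto
  show ?case
  proof (cases "x \<in> fst ` M")
    case False
    then have "?M = M" by auto
    moreover have "x \<notin> snd ` M" using nox by auto
    ultimately show ?thesis using Cs x False
      by (intro exI[of _ "[x] # Cs"]) auto
  next
    case True
    then obtain y where xy: "(x, y) \<in> M" by auto
    have yx: "y \<noteq> x" using Suc.prems(3)[OF xy] irr by blast
    have fstM: "fst ` M = insert x (fst ` ?M)" using xy by force
    have "M = insert (x, y) ?M"
    proof
      show "M \<subseteq> insert (x, y) ?M"
      proof
        fix e assume "e \<in> M"
        then show "e \<in> insert (x, y) ?M"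
          using matching_fstD[OF Suc.prems(2) xy, of "snd e"] by (cases e) auto
      qed
    qed (use xy in blast)
    from arg_cong[OF this, of "image snd"] have sndM: "snd ` M = insert y (snd ` ?M)" by simp
    have "y \<notin> snd ` ?M"
    proof
      assume "y \<in> snd ` ?M"
      then obtain x' where "(x', y) \<in> M" "x' \<noteq> x" by auto
      then show False using matching_sndD[OF Suc.prems(2) xy] by blast
    qed
    moreover have "y \<in> P" using sub xy by auto
    \<comment> \<open>Here the clause on heads is used: no pair of the smaller matching ends in
      \<open>y\<close>, so \<open>y\<close> begins its chain and \<open>x\<close> can be
      prepended.\<close>
    ultimately have "y \<in> hd ` set Cs" unfolding Cs(6) using yx by blast
    then obtain C where C: "C \<in> set Cs" "hd C = y" by auto
    then have "C \<noteq> []" using Cs(3) by auto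
    then obtain C' where C': "C = y # C'" using C(2) by (metis list.collapse)
    obtain As Bs where AB: "Cs = As @ C # Bs" using C(1) by (meson split_list)
    let ?Cs = "(x # C) # As @ Bs"
    have dist: "distinct (concat ?Cs)" and set: "set (concat ?Cs) = P"
      using Cs(1,2) x(1) unfolding AB by auto
    have yl: "\<forall>z\<in>set C. z = y \<or> R y z" using Cs(4)[OF C(1)] C' by auto
    have sort: "\<forall>C\<in>set ?Cs. sorted_wrt R C"
    proof -
      have "R x z" if "z \<in> set C" for z using yl that Suc.prems(3)[OF xy] tr[of x y z] by auto
      then show ?thesis using Cs(4) unfolding AB by simp
    qed
    have last: "last ` set ?Cs = P - fst ` M"
    proof -
      have "last ` set ?Cs = last ` set Cs" unfolding AB using C' by auto
      then show ?thesis using Cs(5) fstM by auto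
    qed
    have ys: "y \<notin> hd ` set (As @ Bs)"
    proof
      assume "y \<in> hd ` set (As @ Bs)"
      then obtain D where "D \<in> set (As @ Bs)" "hd D = y" by auto
      moreover from this have "D \<noteq> []" using Cs(3) AB by auto
      ultimately have "y \<in> set (concat (As @ Bs))" by (metis UN_I hd_in_set set_concat)
      then show False using Cs(1) C' unfolding AB by auto
    qed
    have hd: "hd ` set ?Cs = P - snd ` M"
    proof -
      have "hd ` set Cs = insert y (hd ` set (As @ Bs))" unfolding AB using C(2) by auto
      then have "hd ` set (As @ Bs) = ?P - snd ` M" using ys Cs(6) sndM by auto
      moreover have "x \<notin> snd ` M" using nox by auto
      ultimately show ?thesis using x(1) by auto
    qed
    show ?thesis using dist set sort last hd Cs(3) unfolding AB by (intro exI[of _ ?Cs]) auto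
  qed
qed

text \<open>
  A variant of the Greene--Kleitman theorem in which the bound on the length of chains in \<open>G\<close>
  depends on their last element. The set \<open>G\<close> is read off an optimal dual solution \<open>p, q\<close> of the
  assignment problem whose edge weights are \<open>\<kappa> x\<close> for \<open>x < y\<close> and \<open>\<kappa> x - 1\<close> for \<open>x = y\<close>; the
  elements matched to themselves are those left uncovered by the chains.
\<close>

theorem greene_kleitman_capped:
  fixes R :: "'a \<Rightarrow> 'a \<Rightarrow> bool" and \<kappa> :: "'a \<Rightarrow> nat"
  assumes fin: "finite P" and irr: "\<And>x. \<not> R x x"
    and tr: "\<And>x y z. R x y \<Longrightarrow> R y z \<Longrightarrow> R x z"
  obtains G and s :: "'a \<Rightarrow> nat" and Cs
  where "G \<subseteq> P" "\<And>x. x \<in> G \<Longrightarrow> 1 \<le> s x \<and> s x \<le> \<kappa> x"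
    and "\<And>x y. x \<in> G \<Longrightarrow> y \<in> G \<Longrightarrow> R x y \<Longrightarrow> s x < s y"
    and "distinct (concat Cs)" "set (concat Cs) \<subseteq> P" "[] \<notin> set Cs"
    and "\<And>C. C \<in> set Cs \<Longrightarrow> sorted_wrt R C"
    and "int (card P) - int (card G) \<le> (\<Sum>C\<leftarrow>Cs. int (length C) - int (\<kappa> (last C)))"
proof -
  define W where "W x y = (if R x y then \<kappa> x else if x = y then \<kappa> x - 1 else 0)" for x y
  obtain M and p :: "'a \<Rightarrow> nat" and q where M: "matching M P P"
    and pos: "\<And>x y. (x, y) \<in> M \<Longrightarrow> W x y > 0"
    and cov: "\<And>x y. x \<in> P \<Longrightarrow> y \<in> P \<Longrightarrow> W x y \<le> p x + q y"
    and sum: "sum p P + sum q P \<le> weight W M"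
    by (rule egervary[OF fin fin, of W]) (rule that, assumption+)
  define G where "G = {x\<in>P. p x + q x < \<kappa> x}"
  define s where "s x = \<kappa> x - p x" for x
  have G1: "1 \<le> s x \<and> s x \<le> \<kappa> x" if "x \<in> G" for x using that by (auto simp: G_def s_def)
  \<comment> \<open>The constraint at the edge gives \<open>s x \<le> q y\<close>, and
    \<open>q y < s y\<close> is the membership of \<open>y\<close> in \<open>G\<close>.\<close>
  have G2: "s x < s y" if "x \<in> G" "y \<in> G" "R x y" for x y
  proof -
    have "\<kappa> x \<le> p x + q y" using cov[of x y] that by (auto simp: W_def G_def)
    then show ?thesis using that by (auto simp: G_def s_def)
  qed
  define S where "S = {x. (x, x) \<in> M}"
  define Lk where "Lk = {e\<in>M. fst e \<noteq> snd e}"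
  have sub: "M \<subseteq> P \<times> P" using M by (auto simp: matching_def)
  have fM: "finite M" using matching_finite[OF M fin fin] .
  have SP: "S \<subseteq> P" "finite S" using sub fin finite_subset[of S P] by (auto simp: S_def)
  have Lk: "R x y" if "(x, y) \<in> Lk" for x y
    using pos[of x y] that by (auto simp: Lk_def W_def split: if_splits)
  have "matching Lk P P" by (rule matching_subset[OF M]) (auto simp: Lk_def)
  then have "matching Lk (P - S) (P - S)"
    using matching_fstD[OF M] matching_sndD[OF M]
    by (auto simp: matching_def Lk_def S_def)
  with fin Lk have "\<exists>Cs. distinct (concat Cs) \<and> set (concat Cs) = P - S \<and> [] \<notin> set Cs \<and>
    (\<forall>C\<in>set Cs. sorted_wrt R C) \<and> last ` set Cs = P - S - fst ` Lk \<and> hd ` set Cs = P - S - snd ` Lk"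
    by (intro chain_decomposition irr) (auto intro: tr)
  then obtain Cs where Cs:
    "distinct (concat Cs)" "set (concat Cs) = P - S" "[] \<notin> set Cs"
    "\<And>C. C \<in> set Cs \<Longrightarrow> sorted_wrt R C" "last ` set Cs = (P - S) - fst ` Lk"
    by auto
  \<comment> \<open>\<open>D\<close> collects the elements followed by another one in their chain.
    Each link contributes the \<open>\<kappa>\<close> of its first element to the optimum, and the
    chains end exactly in \<open>P - S - D\<close>.\<close>
  define D where "D = fst ` Lk"
  have D: "D \<subseteq> P - S" "finite D"
    using \<open>matching Lk (P - S) (P - S)\<close> fM unfolding D_def by (auto simp: matching_def Lk_def)
  have dCs: "distinct Cs" using Cs(1,3) by (simp add: distinct_concat_iff removeAll_id)
  have "inj_on last (set Cs)"
  proof (rule inj_onI)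
    fix C C' assume A: "C \<in> set Cs" "C' \<in> set Cs" "last C = last C'"
    then have "C \<noteq> []" "C' \<noteq> []" using Cs(3) by auto
    then have "last C \<in> set C \<inter> set C'" using A(3) last_in_set by (metis IntI)
    then show "C = C'" using Cs(1) A(1,2) by (auto simp: distinct_concat_iff)
  qed
  then have "(\<Sum>C\<leftarrow>Cs. int (\<kappa> (last C))) = (\<Sum>x\<in>(P - S) - D. int (\<kappa> x))"
    using dCs by (simp add: sum_list_distinct_conv_sum_set D_def sum.reindex flip: Cs(5))
  moreover have "(\<Sum>C\<leftarrow>Cs. int (length C)) = int (card (P - S))"
  proof -
    have "(\<Sum>C\<leftarrow>Cs. int (length C)) = int (length (concat Cs))" by (induction Cs) auto
    then show ?thesis using Cs(2) distinct_card[OF Cs(1)] by simp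
  qed
  ultimately have prof: "(\<Sum>C\<leftarrow>Cs. int (length C) - int (\<kappa> (last C))) =
      int (card (P - S)) - (\<Sum>x\<in>(P - S) - D. int (\<kappa> x))"
    by (simp add: sum_list_subtractf)
  have "weight W M = weight W Lk + weight W (M - Lk)"
    using fM by (subst sum.union_disjoint[symmetric]) (auto simp: Lk_def intro!: sum.cong)
  moreover have "weight W Lk = (\<Sum>x\<in>D. \<kappa> x)"
    unfolding D_def using M Lk
    by (subst sum.reindex) (auto simp: matching_def Lk_def W_def inj_on_def intro!: sum.cong)
  moreover have "weight W (M - Lk) = (\<Sum>x\<in>S. \<kappa> x - 1)"
  proof -
    have "M - Lk = (\<lambda>x. (x, x)) ` S" by (auto simp: Lk_def S_def)
    then show ?thesis by (simp add: sum.reindex inj_on_def W_def irr)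
  qed
  moreover have "int (\<Sum>x\<in>S. \<kappa> x - 1) = (\<Sum>x\<in>S. int (\<kappa> x)) - int (card S)"
  proof -
    have "\<kappa> x \<ge> 1" if "x \<in> S" for x using pos[of x x] that irr by (auto simp: S_def W_def)
    then have "(\<Sum>x\<in>S. int (\<kappa> x - 1)) = (\<Sum>x\<in>S. int (\<kappa> x) - 1)" by (intro sum.cong) auto
    then show ?thesis by (simp add: sum_subtractf)
  qed
  ultimately have w: "int (weight W M) = (\<Sum>x\<in>D. int (\<kappa> x)) + (\<Sum>x\<in>S. int (\<kappa> x)) - int (card S)"
    by simp
  have "(\<Sum>x\<in>P. int (\<kappa> x)) = (\<Sum>x\<in>P - S. int (\<kappa> x)) + (\<Sum>x\<in>S. int (\<kappa> x))"
    using SP fin by (simp add: sum.subset_diff)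
  moreover have "(\<Sum>x\<in>P - S. int (\<kappa> x)) = (\<Sum>x\<in>P - S - D. int (\<kappa> x)) + (\<Sum>x\<in>D. int (\<kappa> x))"
    using D fin by (simp add: sum.subset_diff)
  moreover have "int (card (P - S)) = int (card P) - int (card S)"
    using SP fin by (simp add: card_Diff_subset card_mono of_nat_diff)
  \<comment> \<open>Duality becomes a lower bound for the size of \<open>G\<close>: the loop
    constraint keeps \<open>\<kappa> x - p x - q x\<close> at most one, and it is positive only on
    \<open>G\<close>.\<close>
  moreover have "(\<Sum>x\<in>P. int (\<kappa> x) - int (p x) - int (q x)) \<le> (\<Sum>x\<in>G. 1)"
  proof -
    have "(\<Sum>x\<in>P. int (\<kappa> x) - int (p x) - int (q x)) \<le> (\<Sum>x\<in>P. if p x + q x < \<kappa> x then 1 else 0)"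
    proof (rule sum_mono)
      fix x assume "x \<in> P"
      then have "\<kappa> x - 1 \<le> p x + q x" using cov[of x x] irr by (auto simp: W_def)
      then show "int (\<kappa> x) - int (p x) - int (q x) \<le> (if p x + q x < \<kappa> x then 1 else 0)" by auto
    qed
    also have "\<dots> = (\<Sum>x\<in>G. 1)"
      unfolding G_def by (rule sum.inter_filter[symmetric, OF fin])
    finally show ?thesis .
  qed
  moreover have "int (sum p P) + int (sum q P) \<le> int (weight W M)" using sum by linarith
  ultimately have "int (card P) - int (card G) \<le> (\<Sum>C\<leftarrow>Cs. int (length C) - int (\<kappa> (last C)))"
    unfolding prof using w by (simp add: sum_subtractf)
  then show ?thesis using that[of G s Cs] G1 G2 Cs by (auto simp: G_def)
qed


section \<open>Potentials\<close>

lemma monotone_set_max: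
  fixes G :: "(int \<times> int) set"
  assumes "finite G" "G \<noteq> {}" and "\<And>i j i' j'. (i, j) \<in> G \<Longrightarrow> (i', j') \<in> G \<Longrightarrow> i < i' \<Longrightarrow> j \<le> j'"
  obtains i j where "(i, j) \<in> G" "\<And>p q. (p, q) \<in> G \<Longrightarrow> p \<le> i \<and> q \<le> j"
proof -
  let ?s = "\<lambda>g::int \<times> int. fst g + snd g"
  have "Max (?s ` G) \<in> ?s ` G" using assms by (intro Max_in) auto
  then obtain i j where ij: "(i, j) \<in> G" "Max (?s ` G) = i + j" by auto
  have "p \<le> i \<and> q \<le> j" if "(p, q) \<in> G" for p q
  proof -
    have "?s (p, q) \<le> Max (?s ` G)" using assms(1) that by (intro Max_ge) blast+
    then have "p + q \<le> i + j" using ij(2) by simp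
    moreover have "i < p \<Longrightarrow> j \<le> q" "p < i \<Longrightarrow> q \<le> j" using assms(3) that ij(1) by blast+
    ultimately show ?thesis by linarith
  qed
  then show ?thesis using that ij(1) by blast
qed

text \<open>
  The function \<open>A\<close> is the trapezoidal approximation to the integral of \<open>2j\<close> along the staircase \<open>G\<close>
  and \<open>B\<close> its Legendre transform.
\<close>

lemma staircase_potentials:
  fixes G :: "(int \<times> int) set"
  assumes "finite G" and "\<And>i j i' j'. (i, j) \<in> G \<Longrightarrow> (i', j') \<in> G \<Longrightarrow> i < i' \<Longrightarrow> j \<le> j'"
  shows "\<exists>A B :: int \<Rightarrow> int. \<forall>i\<in>fst ` G. \<forall>j\<in>snd ` G.
    2 * i * j \<le> A i + B j \<and> (A i + B j = 2 * i * j \<longleftrightarrow> (i, j) \<in> G)"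
  using assms
proof (induction "card G" arbitrary: G)
  case 0
  then show ?case by auto
next
  case (Suc n)
  then have "G \<noteq> {}" by auto
  then obtain i j where ij: "(i, j) \<in> G" "\<And>p q. (p, q) \<in> G \<Longrightarrow> p \<le> i \<and> q \<le> j"
    using monotone_set_max[of G] Suc.prems by metis
  let ?G = "G - {(i, j)}"
  have "n = card ?G" using Suc.hyps(2) ij(1) Suc.prems(1) by simp
  moreover have mono: "\<And>i j i' j'. (i, j) \<in> ?G \<Longrightarrow> (i', j') \<in> ?G \<Longrightarrow> i < i' \<Longrightarrow> j \<le> j'"
    using Suc.prems(2) by blast
  ultimately obtain A B :: "int \<Rightarrow> int" where AB: "\<And>p q. p \<in> fst ` ?G \<Longrightarrow> q \<in> snd ` ?G \<Longrightarrow>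
      2 * p * q \<le> A p + B q \<and> (A p + B q = 2 * p * q \<longleftrightarrow> (p, q) \<in> ?G)"
    using Suc.hyps(1)[of ?G] Suc.prems(1) by (metis (no_types, lifting) finite_Diff)
  show ?case
  proof (cases "?G = {}")
    case True
    then have "G = {(i, j)}" using ij(1) by auto
    then show ?thesis by (intro exI[of _ "\<lambda>_. 0"] exI[of _ "\<lambda>_. 2 * i * j"]) auto
  next
    case False
    with Suc.prems(1) mono obtain k l where
      kl: "(k, l) \<in> ?G" "\<And>p q. (p, q) \<in> ?G \<Longrightarrow> p \<le> k \<and> q \<le> l"
      using monotone_set_max[OF finite_Diff, of G "{(i, j)}" thesis] by blast
    have rowG: "(p, q) \<in> ?G \<Longrightarrow> p \<in> fst ` ?G" and colG: "(p, q) \<in> ?G \<Longrightarrow> q \<in> snd ` ?G" for p q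
      by (metis fst_conv image_eqI, metis snd_conv image_eqI)
    have leG: "p \<in> fst ` ?G \<Longrightarrow> p \<le> k" "q \<in> snd ` ?G \<Longrightarrow> q \<le> l" for p q
      using kl(2) by (metis imageE prod.collapse)+
    have kl': "k \<le> i" "l \<le> j" using ij(2)[of k l] kl(1) by blast+
    have kl0: "A k + B l = 2 * k * l" using AB[of k l] kl(1) rowG colG by blast
    \<comment> \<open>The two increments add up to \<open>2 * i * j - 2 * k * l\<close>; they are
      doubled areas of the trapezoids over the segment from \<open>(k, l)\<close> to
      \<open>(i, j)\<close>, so everything stays integral. If \<open>i = k\<close> or
      \<open>j = l\<close>, the corresponding update changes nothing.\<close>
    define A' where "A' = A(i := A k + (i - k) * (j + l))"
    define B' where "B' = B(j := B l + (i + k) * (j - l))"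
    have G: "G = insert (i, j) ?G" using ij(1) by blast
    have rows: "fst ` G = insert i (fst ` ?G)" "snd ` G = insert j (snd ` ?G)"
      using arg_cong[OF G, of "image fst"] arg_cong[OF G, of "image snd"]
      unfolding image_insert fst_conv snd_conv by (-) (assumption+)
    have A'k: "A' p = A p" if "p \<in> fst ` ?G" for p
    proof (cases "p = i")
      case True
      then have "k = i" using leG(1)[OF that] kl'(1) by simp
      then show ?thesis using True by (simp add: A'_def)
    qed (simp add: A'_def)
    have B'l: "B' q = B q" if "q \<in> snd ` ?G" for q
    proof (cases "q = j")
      case True
      then have "l = j" using leG(2)[OF that] kl'(2) by simp
      then show ?thesis using True by (simp add: B'_def)
    qed (simp add: B'_def)
    have "2 * p * q \<le> A' p + B' q \<and> (A' p + B' q = 2 * p * q \<longleftrightarrow> (p, q) \<in> G)"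
      if p: "p \<in> fst ` G" and q: "q \<in> snd ` G" for p q
    proof -
      consider "p = i" "q = j" | "p = i" "q \<noteq> j" | "p \<noteq> i" "q = j" | "p \<noteq> i" "q \<noteq> j" by blast
      then show ?thesis
      proof cases
        case 1
        then have "A' p + B' q = A k + (i - k) * (j + l) + (B l + (i + k) * (j - l))"
          by (simp add: A'_def B'_def)
        also have "\<dots> = 2 * p * q" using kl0 1 by (simp add: algebra_simps)
        finally show ?thesis using 1 ij(1) by simp
      next
        case 2
        then have q': "q \<in> snd ` ?G" using q rows by auto
        show ?thesis
        proof (cases "k = i")
          case True
          then have "p \<in> fst ` ?G" using rowG[OF kl(1)] 2 by simp
          then show ?thesis using AB[of p q] A'k B'l q' 2 by simp
        next
          case False
          have "q \<le> l" using leG(2)[OF q'] .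
          \<comment> \<open>Off the staircase the inequality is strict because \<open>q\<close> lies
            below the mean of \<open>l\<close> and \<open>j\<close>.\<close>
          then have "2 * q < j + l" using kl' 2 by auto
          then have "(i - k) * (2 * q) < (i - k) * (j + l)" using False kl' by (intro mult_strict_left_mono) auto
          moreover have "2 * k * q \<le> A k + B q" using AB[of k q] rowG[OF kl(1)] q' by blast
          ultimately have "2 * p * q < A' p + B' q"
            using B'l[OF q'] 2 by (simp add: A'_def algebra_simps)
          moreover have "(p, q) \<notin> G" using leG(1)[OF rowG, of p q] 2 False kl' by auto
          ultimately show ?thesis by auto
        qed
      next
        case 3
        then have p': "p \<in> fst ` ?G" using p rows by auto
        show ?thesis
        proof (cases "l = j")
          case True
          then have "q \<in> snd ` ?G" using colG[OF kl(1)] 3 by simp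
          then show ?thesis using AB[of p q] A'k B'l p' 3 by simp
        next
          case False
          have "p \<le> k" using leG(1)[OF p'] .
          then have "2 * p < i + k" using kl' 3 by auto
          then have "(j - l) * (2 * p) < (j - l) * (i + k)" using False kl' by (intro mult_strict_left_mono) auto
          moreover have "2 * p * l \<le> A p + B l" using AB[of p l] colG[OF kl(1)] p' by blast
          ultimately have "2 * p * q < A' p + B' q"
            using A'k[OF p'] 3 by (simp add: B'_def algebra_simps)
          moreover have "(p, q) \<notin> G" using leG(2)[OF colG, of p q] 3 False kl' by auto
          ultimately show ?thesis by auto
        qed
      next
        case 4
        then have "p \<in> fst ` ?G" "q \<in> snd ` ?G" using p q rows by auto
        then show ?thesis using AB[of p q] A'k B'l 4 by simp
      qed
    qed
    then show ?thesis by blast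
  qed
qed


text \<open>Rows and columns that \<open>G\<close> does not meet receive a constant too large for
  equality. They matter because every entry of the ladder needs a weight for every label, not only
  the entries of the label class.\<close>

lemma staircase_potentials_on:
  fixes G :: "(int \<times> int) set"
  assumes "finite P" "finite Q" "G \<subseteq> P \<times> Q"
    and mono: "\<And>i j i' j'. (i, j) \<in> G \<Longrightarrow> (i', j') \<in> G \<Longrightarrow> i < i' \<Longrightarrow> j \<le> j'"
  shows "\<exists>A B :: int \<Rightarrow> int. \<forall>i\<in>P. \<forall>j\<in>Q.
    2 * i * j \<le> A i + B j \<and> (A i + B j = 2 * i * j \<longleftrightarrow> (i, j) \<in> G)"
proof -
  have "finite G" using assms(1-3) by (meson finite_SigmaI finite_subset)
  then have "\<exists>A B :: int \<Rightarrow> int. \<forall>i\<in>fst ` G. \<forall>j\<in>snd ` G.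
    2 * i * j \<le> A i + B j \<and> (A i + B j = 2 * i * j \<longleftrightarrow> (i, j) \<in> G)"
    using mono by (rule staircase_potentials)
  then obtain A B :: "int \<Rightarrow> int" where AB: "\<forall>i\<in>fst ` G. \<forall>j\<in>snd ` G.
    2 * i * j \<le> A i + B j \<and> (A i + B j = 2 * i * j \<longleftrightarrow> (i, j) \<in> G)"
    by (elim exE)
  let ?f = "\<lambda>i j. \<bar>2 * i * j\<bar> + \<bar>A i\<bar> + \<bar>B j\<bar>"
  define K where "K = 1 + (\<Sum>i\<in>P. \<Sum>j\<in>Q. ?f i j)"
  have K: "?f i j < K" if "i \<in> P" "j \<in> Q" for i j
  proof -
    have "?f i j \<le> (\<Sum>j\<in>Q. ?f i j)"
      using that assms(2) by (intro member_le_sum) auto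
    also have "\<dots> \<le> (\<Sum>i\<in>P. \<Sum>j\<in>Q. ?f i j)"
      using that(1) assms(1) by (intro member_le_sum[of i P "\<lambda>i. \<Sum>j\<in>Q. ?f i j"] sum_nonneg) auto
    finally show ?thesis by (simp add: K_def)
  qed
  let ?A = "\<lambda>i. if i \<in> fst ` G then A i else K" and ?B = "\<lambda>j. if j \<in> snd ` G then B j else K"
  have "2 * i * j \<le> ?A i + ?B j \<and> (?A i + ?B j = 2 * i * j \<longleftrightarrow> (i, j) \<in> G)"
    if ij: "i \<in> P" "j \<in> Q" for i j
  proof (cases "i \<in> fst ` G \<and> j \<in> snd ` G")
    case True
    then show ?thesis using AB[rule_format, of i j] by simp
  next
    case False
    then have "(i, j) \<notin> G" by (metis fst_conv image_eqI snd_conv)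
    moreover have "2 * i * j < A i + K" "2 * i * j < K + B j" "2 * i * j < K + K"
      using K[OF ij] by linarith+
    then have "2 * i * j < ?A i + ?B j" using False by auto
    ultimately show ?thesis by linarith
  qed
  then show ?thesis by (intro exI[of _ ?A] exI[of _ ?B] ballI)
qed


section \<open>Noetherian rings\<close>

lemma nat_seq_mono_subseq:
  fixes f :: "nat \<Rightarrow> nat"
  shows "\<exists>r :: nat \<Rightarrow> nat. strict_mono r \<and> mono (\<lambda>n. f (r n))"
proof -
  obtain r :: "nat \<Rightarrow> nat" where r: "strict_mono r" "monoseq (\<lambda>n. f (r n))"
    using seq_monosub[of f] by auto
  show ?thesis
  proof (cases "mono (\<lambda>n. f (r n))")
    case False
    then have dec: "f (r n) \<le> f (r m)" if "m \<le> n" for m n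
      using r(2) that by (auto simp: monoseq_def mono_def)
    obtain N where N: "\<And>n. f (r N) \<le> f (r n)"
      using ex_has_least_nat[of "\<lambda>_. True" 0 "\<lambda>n. f (r n)"] by auto
    have "f (r (N + n)) = f (r N)" for n using dec[of N "N + n"] N[of "N + n"] by simp
    then have "mono (\<lambda>n. f (r (N + n)))" by (auto simp: mono_def)
    moreover have "strict_mono (\<lambda>n. r (N + n))" using r(1) by (auto simp: strict_mono_def)
    ultimately show ?thesis by (intro exI[of _ "\<lambda>n. r (N + n)"]) simp
  qed (use r in blast)
qed

lemma dickson:
  fixes f :: "nat \<Rightarrow> 'i \<Rightarrow> nat"
  assumes "finite I"
  shows "\<exists>r :: nat \<Rightarrow> nat. strict_mono r \<and> (\<forall>i\<in>I. mono (\<lambda>n. f (r n) i))"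
  using assms
proof (induction I rule: finite_induct)
  case empty
  show ?case by (intro exI[of _ id]) (auto simp: strict_mono_def)
next
  case (insert x I)
  then obtain r :: "nat \<Rightarrow> nat" where r: "strict_mono r" "\<And>i. i \<in> I \<Longrightarrow> mono (\<lambda>n. f (r n) i)" by auto
  obtain r' :: "nat \<Rightarrow> nat" where r': "strict_mono r'" "mono (\<lambda>n. f (r (r' n)) x)"
    using nat_seq_mono_subseq[of "\<lambda>n. f (r n) x"] by blast
  have "strict_mono (r \<circ> r')" using r(1) r'(1) by (simp add: strict_mono_o)
  moreover have "mono (\<lambda>n. f ((r \<circ> r') n) i)" if "i \<in> insert x I" for i
    using that r(2) r' strict_mono_mono[OF r'(1)] by (auto simp: mono_def o_def)
  ultimately show ?case by blast
qed

text \<open>This is the existence of finite Groebner bases. The well-quasi-order condition concerns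
  sequences of nonzero ring elements rather than of exponents, because the good pair will be found
  from inequalities that hold for actual leading exponents.\<close>

lemma (in cring) noetherian_by_division:
  fixes ld :: "'a \<Rightarrow> 'e" and dv :: "'e \<Rightarrow> 'e \<Rightarrow> bool"
  assumes wf: "wf r"
    and wqo: "\<And>e::nat \<Rightarrow> 'a. (\<And>n. e n \<in> carrier R - {\<zero>}) \<Longrightarrow> \<exists>i j. i < j \<and> dv (ld (e i)) (ld (e j))"
    and div: "\<And>p q. p \<in> carrier R - {\<zero>} \<Longrightarrow> q \<in> carrier R - {\<zero>} \<Longrightarrow> dv (ld p) (ld q) \<Longrightarrow>
      \<exists>h\<in>carrier R. q \<ominus> h \<otimes> p = \<zero> \<or> (ld (q \<ominus> h \<otimes> p), ld q) \<in> r"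
  shows "noetherian_ring R"
proof (rule noetherian_ringI)
  fix J assume J: "ideal J R"
  interpret J: ideal J R by (rule J)
  have "\<exists>A \<subseteq> J - {\<zero>}. finite A \<and> (\<forall>q\<in>J - {\<zero>}. \<exists>p\<in>A. dv (ld p) (ld q))"
  proof (rule ccontr)
    assume neg: "\<not> ?thesis"
    \<comment> \<open>Without a finite basis one could go on choosing elements that no earlier one
      divides.\<close>
    have "\<exists>f::nat \<Rightarrow> 'a. \<forall>n. f n \<in> J - {\<zero>} \<and> (\<forall>y<n. \<not> dv (ld (f y)) (ld (f n)))"
    proof (rule dependent_wellorder_choice)
      fix n and f :: "nat \<Rightarrow> 'a"
      assume "\<And>y. y < n \<Longrightarrow> f y \<in> J - {\<zero>} \<and> (\<forall>z<y. \<not> dv (ld (f z)) (ld (f y)))"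
      then have "f ` {..<n} \<subseteq> J - {\<zero>}" by auto
      then obtain q where "q \<in> J - {\<zero>}" "\<forall>p\<in>f ` {..<n}. \<not> dv (ld p) (ld q)"
        using neg by (meson finite_imageI finite_lessThan)
      then show "\<exists>q. q \<in> J - {\<zero>} \<and> (\<forall>y<n. \<not> dv (ld (f y)) (ld q))" by auto
    qed auto
    then obtain f :: "nat \<Rightarrow> 'a" where f: "\<And>n. f n \<in> J - {\<zero>}" "\<And>n y. y < n \<Longrightarrow> \<not> dv (ld (f y)) (ld (f n))"
      by blast
    then show False using wqo[of f] J.a_subset by blast
  qed
  then obtain A where A: "A \<subseteq> J - {\<zero>}" "finite A" "\<And>q. q \<in> J - {\<zero>} \<Longrightarrow> \<exists>p\<in>A. dv (ld p) (ld q)"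
    by auto
  have AR: "A \<subseteq> carrier R" using A(1) J.a_subset by auto
  interpret GA: ideal "Idl A" R by (rule genideal_ideal[OF AR])
  have "q \<in> Idl A" if "q \<in> J" for q
    using that
  proof (induction "ld q" arbitrary: q rule: wf_induct_rule[OF wf])
    case (1 q)
    show ?case
    proof (cases "q = \<zero>")
      case False
      then obtain p where p: "p \<in> A" "dv (ld p) (ld q)" using A(3) 1 by blast
      then have pJ: "p \<in> J - {\<zero>}" using A(1) by auto
      have q: "q \<in> carrier R - {\<zero>}" using 1 False J.a_subset by auto
      obtain h where h: "h \<in> carrier R" "q \<ominus> h \<otimes> p = \<zero> \<or> (ld (q \<ominus> h \<otimes> p), ld q) \<in> r"
        using div[of p q] pJ q p(2) J.a_subset by auto
      have pG: "p \<in> Idl A" using genideal_self[OF AR] p(1) by auto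
      then have hp: "h \<otimes> p \<in> Idl A" using h(1) by (rule GA.I_l_closed)
      have "h \<otimes> p \<in> J" using pJ h(1) J.I_l_closed by auto
      then have "q \<ominus> h \<otimes> p \<in> J" using 1(2) by (simp add: a_minus_def)
      then have "q \<ominus> h \<otimes> p \<in> Idl A" using h(2) 1(1) GA.zero_closed by metis
      then have "(q \<ominus> h \<otimes> p) \<oplus> h \<otimes> p \<in> Idl A" using hp by simp
      moreover have "(q \<ominus> h \<otimes> p) \<oplus> h \<otimes> p = q"
        using q h(1) pJ J.a_subset by (simp add: a_minus_def a_assoc l_neg subset_iff)
      ultimately show ?thesis by simp
    qed simp
  qed
  moreover have "Idl A \<subseteq> J" using A(1) by (intro genideal_minimal J) auto
  ultimately have "J = Idl A" by auto
  then show "\<exists>A\<subseteq>carrier R. finite A \<and> J = Idl A" using A(2) AR by blast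
qed

text \<open>\<open>S\<close> is a bare structure here: its ring axioms are carried over together
  with the finiteness of ideals. For the associated graded ring this replaces a direct verification
  on sequences of cosets.\<close>

lemma noetherian_image:
  fixes h :: "'a \<Rightarrow> 'c" and S :: "('c, 'd) ring_scheme"
  assumes R: "noetherian_ring R"
    and surj: "h ` carrier R = carrier S"
    and add: "\<And>x y. x \<in> carrier R \<Longrightarrow> y \<in> carrier R \<Longrightarrow> h (x \<oplus>\<^bsub>R\<^esub> y) = h x \<oplus>\<^bsub>S\<^esub> h y"
    and mult: "\<And>x y. x \<in> carrier R \<Longrightarrow> y \<in> carrier R \<Longrightarrow> h (x \<otimes>\<^bsub>R\<^esub> y) = h x \<otimes>\<^bsub>S\<^esub> h y"
    and one: "h \<one>\<^bsub>R\<^esub> = \<one>\<^bsub>S\<^esub>" and zero: "h \<zero>\<^bsub>R\<^esub> = \<zero>\<^bsub>S\<^esub>"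
  shows "noetherian_ring S"
proof -
  interpret R: noetherian_ring R by (rule R)
  have ex: "\<exists>x\<in>carrier R. y = h x" if "y \<in> carrier S" for y using that surj by auto
  have hc [simp, intro]: "h x \<in> carrier S" if "x \<in> carrier R" for x using that surj by auto
  have ring: "ring S"
  proof (rule ringI)
    show "abelian_group S"
    proof (rule abelian_groupI)
      show "x \<oplus>\<^bsub>S\<^esub> y \<in> carrier S" if "x \<in> carrier S" "y \<in> carrier S" for x y
        using ex[OF that(1)] ex[OF that(2)] by (metis add hc R.add.m_closed)
      show "\<zero>\<^bsub>S\<^esub> \<in> carrier S" using zero hc by (metis R.zero_closed)
      show "x \<oplus>\<^bsub>S\<^esub> y \<oplus>\<^bsub>S\<^esub> z = x \<oplus>\<^bsub>S\<^esub> (y \<oplus>\<^bsub>S\<^esub> z)"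
        if "x \<in> carrier S" "y \<in> carrier S" "z \<in> carrier S" for x y z
        using ex[OF that(1)] ex[OF that(2)] ex[OF that(3)] by (auto simp: R.a_assoc simp flip: add)
      show "x \<oplus>\<^bsub>S\<^esub> y = y \<oplus>\<^bsub>S\<^esub> x" if "x \<in> carrier S" "y \<in> carrier S" for x y
        using ex[OF that(1)] ex[OF that(2)] by (auto simp: R.a_comm simp flip: add)
      show "\<zero>\<^bsub>S\<^esub> \<oplus>\<^bsub>S\<^esub> x = x" if "x \<in> carrier S" for x
        using ex[OF that(1)] by (auto simp flip: add zero)
      show "\<exists>y\<in>carrier S. y \<oplus>\<^bsub>S\<^esub> x = \<zero>\<^bsub>S\<^esub>" if "x \<in> carrier S" for x
        using ex[OF that(1)] by (metis add hc zero R.a_inv_closed R.l_neg)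
    qed
    show "monoid S"
    proof (rule monoidI)
      show "x \<otimes>\<^bsub>S\<^esub> y \<in> carrier S" if "x \<in> carrier S" "y \<in> carrier S" for x y
        using ex[OF that(1)] ex[OF that(2)] by (metis mult hc R.m_closed)
      show "\<one>\<^bsub>S\<^esub> \<in> carrier S" using one hc by (metis R.one_closed)
      show "x \<otimes>\<^bsub>S\<^esub> y \<otimes>\<^bsub>S\<^esub> z = x \<otimes>\<^bsub>S\<^esub> (y \<otimes>\<^bsub>S\<^esub> z)"
        if "x \<in> carrier S" "y \<in> carrier S" "z \<in> carrier S" for x y z
        using ex[OF that(1)] ex[OF that(2)] ex[OF that(3)] by (auto simp: R.m_assoc simp flip: mult)
      show "\<one>\<^bsub>S\<^esub> \<otimes>\<^bsub>S\<^esub> x = x" "x \<otimes>\<^bsub>S\<^esub> \<one>\<^bsub>S\<^esub> = x" if "x \<in> carrier S" for x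
        using ex[OF that(1)] by (auto simp flip: mult one)
    qed
    show "(x \<oplus>\<^bsub>S\<^esub> y) \<otimes>\<^bsub>S\<^esub> z = x \<otimes>\<^bsub>S\<^esub> z \<oplus>\<^bsub>S\<^esub> y \<otimes>\<^bsub>S\<^esub> z"
      "z \<otimes>\<^bsub>S\<^esub> (x \<oplus>\<^bsub>S\<^esub> y) = z \<otimes>\<^bsub>S\<^esub> x \<oplus>\<^bsub>S\<^esub> z \<otimes>\<^bsub>S\<^esub> y"
      if "x \<in> carrier S" "y \<in> carrier S" "z \<in> carrier S" for x y z
      using ex[OF that(1)] ex[OF that(2)] ex[OF that(3)]
      by (auto simp: R.l_distr R.r_distr simp flip: add mult)
  qed
  interpret S: ring S by (rule ring)
  interpret h: ring_hom_ring R S h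
    by (rule ring_hom_ringI2) (auto simp: Ring.ring_hom_def add mult one R.ring_axioms ring)
  show ?thesis
  proof (rule S.noetherian_ringI)
    fix J assume J: "ideal J S"
    interpret J: ideal J S by (rule J)
    let ?K = "{x \<in> carrier R. h x \<in> J}"
    have K: "ideal ?K R" by (rule h.ideal_vimage[OF J])
    obtain A where A: "A \<subseteq> carrier R" "finite A" "?K = genideal R A"
      using R.finetely_gen[OF K] by auto
    have AJ: "h ` A \<subseteq> J" using A(3) R.genideal_self[OF A(1)] by auto
    then have AS: "h ` A \<subseteq> carrier S" using J.a_subset by auto
    have gi: "ideal (genideal S (h ` A)) S" by (rule S.genideal_ideal[OF AS])
    have "J \<subseteq> genideal S (h ` A)"
    proof
      fix y assume y: "y \<in> J"
      then obtain x where x: "x \<in> carrier R" "y = h x" using ex J.a_subset by blast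
      have "A \<subseteq> {x \<in> carrier R. h x \<in> genideal S (h ` A)}"
        using A(1) S.genideal_self[OF AS] by auto
      then have "genideal R A \<subseteq> {x \<in> carrier R. h x \<in> genideal S (h ` A)}"
        by (rule R.genideal_minimal[OF h.ideal_vimage[OF gi]])
      then show "y \<in> genideal S (h ` A)" using x y A(3) by auto
    qed
    moreover have "genideal S (h ` A) \<subseteq> J" by (rule S.genideal_minimal[OF J AJ])
    ultimately show "\<exists>A\<subseteq>carrier S. finite A \<and> J = genideal S A"
      using AS A(2) by blast
  qed
qed


section \<open>Weights and substitutions of polynomials\<close>

abbreviation coef :: "('a \<Rightarrow>\<^sub>0 'b::zero) \<Rightarrow> 'a \<Rightarrow> 'b" where "coef \<equiv> Poly_Mapping.lookup"
abbreviation supp :: "('a \<Rightarrow>\<^sub>0 'b::zero) \<Rightarrow> 'a set" where "supp \<equiv> Poly_Mapping.keys"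
abbreviation sgl :: "'a \<Rightarrow> 'b \<Rightarrow> 'a \<Rightarrow>\<^sub>0 'b::zero" where "sgl \<equiv> Poly_Mapping.single"

type_synonym ('v, 'k) poly = "('v \<Rightarrow>\<^sub>0 nat) \<Rightarrow>\<^sub>0 'k"

text \<open>The codomain is general: natural weights order monomials and count variables, integral
  ones allow negative values for the potentials and for the order in \<open>y\<close>.\<close>

definition wt :: "('v \<Rightarrow> 'b::comm_semiring_1) \<Rightarrow> ('v \<Rightarrow>\<^sub>0 nat) \<Rightarrow> 'b" where
  "wt \<omega> m = (\<Sum>x\<in>supp m. of_nat (coef m x) * \<omega> x)"

lemma wt_superset: "finite A \<Longrightarrow> supp m \<subseteq> A \<Longrightarrow> wt \<omega> m = (\<Sum>x\<in>A. of_nat (coef m x) * \<omega> x)"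
  unfolding wt_def by (rule sum.mono_neutral_left) (auto simp: in_keys_iff)

lemma supp_add_nat: "supp (m + n :: 'v \<Rightarrow>\<^sub>0 nat) = supp m \<union> supp n"
  by (auto simp: in_keys_iff lookup_add)

lemma wt_add: "wt \<omega> (m + n) = wt \<omega> m + wt \<omega> n"
proof -
  have "wt \<omega> p = (\<Sum>x\<in>supp m \<union> supp n. of_nat (coef p x) * \<omega> x)"
    if "p = m \<or> p = n \<or> p = m + n" for p
    by (rule wt_superset) (use that in \<open>auto simp: supp_add_nat\<close>)
  then show ?thesis by (simp add: lookup_add algebra_simps sum.distrib)
qed

lemma wt_zero [simp]: "wt \<omega> 0 = 0"
  by (simp add: wt_def)

lemma wt_single [simp]: "wt \<omega> (sgl x n) = of_nat n * \<omega> x"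
  by (simp add: wt_def)

lemma wt_sum: "wt \<omega> (\<Sum>i\<in>I. f i) = (\<Sum>i\<in>I. wt \<omega> (f i))"
  by (induction I rule: infinite_finite_induct) (auto simp: wt_add)

lemma of_nat_wt: "of_nat (wt w m) = (wt (\<lambda>x. of_nat (w x)) m :: 'b::comm_semiring_1)"
  by (simp add: wt_def)

lemma poly_as_sum: "f = (\<Sum>m\<in>supp f. sgl m (coef f m))"
  by (rule poly_mapping_eqI) (auto simp: lookup_sum lookup_single when_def in_keys_iff)

section \<open>Evaluation of polynomials\<close>

definition pp :: "('v \<Rightarrow> 'r::comm_ring_1) \<Rightarrow> ('v \<Rightarrow>\<^sub>0 nat) \<Rightarrow> 'r" where
  "pp Y m = (\<Prod>x\<in>supp m. Y x ^ coef m x)"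

lemma pp_superset: "finite A \<Longrightarrow> supp m \<subseteq> A \<Longrightarrow> pp Y m = (\<Prod>x\<in>A. Y x ^ coef m x)"
  unfolding pp_def by (rule prod.mono_neutral_left) (auto simp: in_keys_iff)

lemma pp_add: "pp Y (m + n) = pp Y m * pp Y n"
proof -
  have "pp Y p = (\<Prod>x\<in>supp m \<union> supp n. Y x ^ coef p x)" if "p = m \<or> p = n \<or> p = m + n" for p
    by (rule pp_superset) (use that in \<open>auto simp: supp_add_nat\<close>)
  then show ?thesis by (simp add: lookup_add power_add prod.distrib)
qed

lemma pp_zero [simp]: "pp Y 0 = 1"
  by (simp add: pp_def)

lemma pp_single [simp]: "pp Y (sgl x n) = Y x ^ n"
  by (simp add: pp_def)

definition subst :: "('v \<Rightarrow> ('w, 'k::comm_ring_1) poly) \<Rightarrow> ('v, 'k) poly \<Rightarrow> ('w, 'k) poly" where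
  "subst Y f = (\<Sum>m\<in>supp f. sgl 0 (coef f m) * pp Y m)"

lemma subst_superset:
  "finite A \<Longrightarrow> supp f \<subseteq> A \<Longrightarrow> subst Y f = (\<Sum>m\<in>A. sgl 0 (coef f m) * pp Y m)"
  unfolding subst_def by (rule sum.mono_neutral_left) (auto simp: in_keys_iff)

lemma subst_add: "subst Y (f + g) = subst Y f + subst Y g"
proof -
  have "subst Y p = (\<Sum>m\<in>supp f \<union> supp g. sgl 0 (coef p m) * pp Y m)"
    if "p = f \<or> p = g \<or> p = f + g" for p
    by (rule subst_superset) (use that keys_add[of f g] in auto)
  then show ?thesis by (simp add: lookup_add single_add algebra_simps sum.distrib)
qed

lemma subst_zero [simp]: "subst Y 0 = 0"
  by (simp add: subst_def)

lemma subst_sum: "subst Y (\<Sum>i\<in>I. f i) = (\<Sum>i\<in>I. subst Y (f i))"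
  by (induction I rule: infinite_finite_induct) (auto simp: subst_add)

lemma subst_single: "subst Y (sgl m c) = sgl 0 c * pp Y m"
  by (simp add: subst_def)

lemma subst_mult: "subst Y (f * g) = subst Y f * subst Y g"
proof -
  have "f * g = (\<Sum>m\<in>supp f. \<Sum>n\<in>supp g. sgl (m + n) (coef f m * coef g n))"
    by (subst (1) poly_as_sum[of f], subst (1) poly_as_sum[of g])
      (simp add: sum_product mult_single)
  then show ?thesis
    by (simp add: subst_sum subst_single pp_add subst_def[of Y f] subst_def[of Y g] sum_product
        mult_single[of 0 _ 0, simplified, symmetric] mult_ac)
qed

lemma subst_one [simp]: "subst Y 1 = 1"
  by (metis pp_zero subst_single single_one mult_1)

lemma subst_hom: "comm_ring_hom (subst Y)"
  by unfold_locales (auto simp: subst_add subst_mult)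

lemma subst_Var: "subst Y (Var x) = Y x"
  by (simp add: Var_def subst_single)


subsection \<open>Leading forms\<close>

text \<open>\<open>H\<close> may be zero, and then all weights in \<open>F\<close> lie below
  \<open>N\<close>. So the notion is additive even when leading terms cancel.\<close>

definition lead :: "('v \<Rightarrow> 'b::linordered_idom) \<Rightarrow> 'b \<Rightarrow> ('v, 'k::comm_ring_1) poly \<Rightarrow> ('v, 'k) poly \<Rightarrow> bool" where
  "lead \<omega> N F H \<longleftrightarrow> (\<forall>\<mu>\<in>supp (F - H). wt \<omega> \<mu> < N) \<and> (\<forall>\<mu>\<in>supp H. wt \<omega> \<mu> = N)"

lemma lead_le: "lead \<omega> N F H \<Longrightarrow> \<mu> \<in> supp F \<Longrightarrow> wt \<omega> \<mu> \<le> N"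
  unfolding lead_def using keys_add[of "F - H" H] by force

lemma lead_coef: "lead \<omega> N F H \<Longrightarrow> wt \<omega> \<mu> = N \<Longrightarrow> coef F \<mu> = coef H \<mu>"
  unfolding lead_def by (force simp: in_keys_iff lookup_minus)

lemma supp_mult_wt:
  assumes "\<mu> \<in> supp (F * G :: ('v, 'k::comm_ring_1) poly)"
  obtains a b where "a \<in> supp F" "b \<in> supp G" "\<mu> = a + b"
  using assms keys_mult[of F G] by blast

lemma lead_mult:
  assumes "lead \<omega> N F H" "lead \<omega> N' F' H'"
  shows "lead \<omega> (N + N') (F * F') (H * H')"
  unfolding lead_def
proof safe
  fix \<mu> assume \<mu>: "\<mu> \<in> supp (F * F' - H * H')"
  have "F * F' - H * H' = (F - H) * F' + H * (F' - H')" by (simp add: algebra_simps)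
  then have "\<mu> \<in> supp ((F - H) * F') \<or> \<mu> \<in> supp (H * (F' - H'))"
    using \<mu> keys_add by fastforce
  then show "wt \<omega> \<mu> < N + N'"
  proof
    assume "\<mu> \<in> supp ((F - H) * F')"
    then obtain a b where "a \<in> supp (F - H)" "b \<in> supp F'" "\<mu> = a + b" by (rule supp_mult_wt)
    then show ?thesis using assms(1) lead_le[OF assms(2)]
      by (auto simp: lead_def wt_add intro: add_less_le_mono)
  next
    assume "\<mu> \<in> supp (H * (F' - H'))"
    then obtain a b where "a \<in> supp H" "b \<in> supp (F' - H')" "\<mu> = a + b" by (rule supp_mult_wt)
    then show ?thesis using assms by (auto simp: lead_def wt_add)
  qed
next
  fix \<mu> assume "\<mu> \<in> supp (H * H')"
  then obtain a b where "a \<in> supp H" "b \<in> supp H'" "\<mu> = a + b" by (rule supp_mult_wt)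
  then show "wt \<omega> \<mu> = N + N'" using assms by (auto simp: lead_def wt_add)
qed

lemma lead_one: "lead \<omega> 0 1 1"
  by (simp add: lead_def flip: single_one)

lemma lead_const: "lead \<omega> 0 (sgl 0 c) (sgl 0 c)"
  by (simp add: lead_def)

lemma lead_add: "lead \<omega> N F H \<Longrightarrow> lead \<omega> N F' H' \<Longrightarrow> lead \<omega> N (F + F') (H + H')"
  unfolding lead_def add_diff_add using keys_add[of "F - H" "F' - H'"] keys_add[of H H'] by blast

lemma lead_sum: "(\<And>i. i \<in> I \<Longrightarrow> lead \<omega> N (F i) (H i)) \<Longrightarrow> lead \<omega> N (\<Sum>i\<in>I. F i) (\<Sum>i\<in>I. H i)"
  by (induction I rule: infinite_finite_induct) (auto intro: lead_add simp: lead_def[of _ _ 0 0])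

lemma lead_power: "lead \<omega> N F H \<Longrightarrow> lead \<omega> (of_nat n * N) (F ^ n) (H ^ n)"
  by (induction n) (auto simp: lead_one algebra_simps intro: lead_mult)

lemma lead_prod: "(\<And>i. i \<in> I \<Longrightarrow> lead \<omega> (N i) (F i) (H i)) \<Longrightarrow>
    lead \<omega> (\<Sum>i\<in>I. N i) (\<Prod>i\<in>I. F i) (\<Prod>i\<in>I. H i)"
  by (induction I rule: infinite_finite_induct) (auto intro: lead_mult lead_one)

lemma lead_pp: "(\<And>x. x \<in> supp m \<Longrightarrow> lead \<omega> (w x) (Y x) (H x)) \<Longrightarrow> lead \<omega> (wt w m) (pp Y m) (pp H m)"
  unfolding wt_def pp_def by (intro lead_prod lead_power)

lemma lead_subst_zero:
  assumes "\<And>x. x \<in> \<Union> (supp ` supp f) \<Longrightarrow> lead \<omega> 0 (Y x) (H x)"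
  shows "lead \<omega> 0 (subst Y f) (subst H f)"
  unfolding subst_def
proof (rule lead_sum)
  fix m assume m: "m \<in> supp f"
  have "lead \<omega> (0 + wt (\<lambda>_. 0) m) (sgl 0 (coef f m) * pp Y m) (sgl 0 (coef f m) * pp H m)"
    by (intro lead_mult lead_const lead_pp assms) (use m in auto)
  then show "lead \<omega> 0 (sgl 0 (coef f m) * pp Y m) (sgl 0 (coef f m) * pp H m)"
    by (simp add: wt_def)
qed

lemma ex_lead:
  assumes "F \<noteq> 0"
  shows "\<exists>N H. lead \<omega> N F H \<and> H \<noteq> 0 \<and> N \<in> wt \<omega> ` supp F"
proof -
  let ?N = "Max (wt \<omega> ` supp F)"
  have ne: "supp F \<noteq> {}" using assms by simp
  then have N: "?N \<in> wt \<omega> ` supp F" by (intro Max_in) auto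
  define H where "H = (\<Sum>m\<in>{m\<in>supp F. wt \<omega> m = ?N}. sgl m (coef F m))"
  have H: "coef H m = (if wt \<omega> m = ?N then coef F m else 0)" for m
    by (auto simp: H_def lookup_sum lookup_single when_def in_keys_iff)
  have "lead \<omega> ?N F H"
    unfolding lead_def
  proof safe
    fix m assume "m \<in> supp (F - H)"
    then have "m \<in> supp F" "wt \<omega> m \<noteq> ?N" by (auto simp: in_keys_iff lookup_minus H split: if_splits)
    then show "wt \<omega> m < ?N" by (simp add: order_less_le)
  qed (auto simp: in_keys_iff H split: if_splits)
  moreover have "H \<noteq> 0" using N by (auto simp: H in_keys_iff poly_mapping_eq_iff fun_eq_iff)
  ultimately show ?thesis using N by blast
qed

definition mlin :: "('v \<Rightarrow> ('w \<Rightarrow>\<^sub>0 nat)) \<Rightarrow> ('v \<Rightarrow>\<^sub>0 nat) \<Rightarrow> ('w \<Rightarrow>\<^sub>0 nat)" where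
  "mlin h m = (\<Sum>x\<in>supp m. \<Sum>i<coef m x. h x)"

lemma pp_mlin: "pp (\<lambda>x. sgl (h x) (1::'k::comm_ring_1)) m = sgl (mlin h m) 1"
proof -
  have p: "sgl a (1::'k) ^ n = sgl (\<Sum>i<n. a) 1" for a :: "'w \<Rightarrow>\<^sub>0 nat" and n
    by (induction n) (auto simp: mult_single add_ac)
  have "(\<Prod>x\<in>A. sgl (g x) (1::'k)) = sgl (\<Sum>x\<in>A. g x) 1" for g :: "'v \<Rightarrow> ('w \<Rightarrow>\<^sub>0 nat)" and A
    by (induction A rule: infinite_finite_induct) (auto simp: mult_single)
  then show ?thesis by (simp add: pp_def mlin_def p)
qed

lemma coef_mlin: "coef (mlin h m) v = wt (\<lambda>x. coef (h x) v) m"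
  by (simp add: mlin_def wt_def lookup_sum)

lemma wt_mlin: "wt \<omega> (mlin h m) = wt (\<lambda>x. wt \<omega> (h x)) m"
  by (simp add: mlin_def wt_sum) (simp add: wt_def)


subsection \<open>Leading monomials\<close>

text \<open>Ties in weight are broken by the linear order on \<open>poly_mapping\<close>, which
  respects addition.\<close>

definition mkey :: "('v::linorder \<Rightarrow> nat) \<Rightarrow> ('v \<Rightarrow>\<^sub>0 nat) \<Rightarrow> nat \<times> ('v \<Rightarrow>\<^sub>0 nat)" where
  "mkey w m = (wt w m, m)"

definition lm :: "('v::linorder \<Rightarrow> nat) \<Rightarrow> ('v, 'k::comm_ring_1) poly \<Rightarrow> 'v \<Rightarrow>\<^sub>0 nat" where
  "lm w f = snd (Max (mkey w ` supp f))"

lemma mkey_add_le_less: "mkey w a \<le> mkey w m \<Longrightarrow> mkey w b < mkey w n \<Longrightarrow> mkey w (a + b) < mkey w (m + n)"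
  by (auto simp: mkey_def wt_add add_le_less_mono)

lemma mkey_add_less_le: "mkey w a < mkey w m \<Longrightarrow> mkey w b \<le> mkey w n \<Longrightarrow> mkey w (a + b) < mkey w (m + n)"
  by (auto simp: mkey_def wt_add add_less_le_mono)

lemma mkey_inj [simp]: "mkey w a = mkey w b \<longleftrightarrow> a = b"
  by (auto simp: mkey_def)

lemma lm_max:
  assumes "f \<noteq> 0"
  shows "lm w f \<in> supp f" "m \<in> supp f \<Longrightarrow> mkey w m \<le> mkey w (lm w f)"
proof -
  have "Max (mkey w ` supp f) \<in> mkey w ` supp f" using assms by (intro Max_in) auto
  then obtain m' where m': "m' \<in> supp f" "Max (mkey w ` supp f) = mkey w m'" by auto
  then have "lm w f = m'" by (simp add: lm_def mkey_def)
  then show "lm w f \<in> supp f" "m \<in> supp f \<Longrightarrow> mkey w m \<le> mkey w (lm w f)"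
    using m' by (auto simp flip: m'(2))
qed

lemma lm_eqI: "m \<in> supp f \<Longrightarrow> (\<And>m'. m' \<in> supp f \<Longrightarrow> mkey w m' \<le> mkey w m) \<Longrightarrow> lm w f = m"
  using lm_max[of f] by (metis antisym keys_zero empty_iff mkey_inj)

lemma lm_single [simp]: "c \<noteq> 0 \<Longrightarrow> lm w (sgl m c) = m"
  by (rule lm_eqI) auto

lemma lm_mult:
  fixes f g :: "('v::linorder, 'k::idom) poly"
  assumes "f \<noteq> 0" "g \<noteq> 0"
  shows "lm w (f * g) = lm w f + lm w g"
    and "coef (f * g) (lm w f + lm w g) = coef f (lm w f) * coef g (lm w g)"
proof -
  let ?m = "lm w f" and ?n = "lm w g"
  define f' where "f' = f - sgl ?m (coef f ?m)"
  define g' where "g' = g - sgl ?n (coef g ?n)"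
  have f': "a \<in> supp f' \<Longrightarrow> mkey w a < mkey w ?m" for a
    using lm_max(2)[OF assms(1), of a w]
    by (auto simp: f'_def in_keys_iff lookup_minus lookup_single when_def order_less_le split: if_splits)
  have g': "a \<in> supp g' \<Longrightarrow> mkey w a < mkey w ?n" for a
    using lm_max(2)[OF assms(2), of a w]
    by (auto simp: g'_def in_keys_iff lookup_minus lookup_single when_def order_less_le split: if_splits)
  define R where "R = f' * g + sgl ?m (coef f ?m) * g'"
  have eq: "f * g = sgl (?m + ?n) (coef f ?m * coef g ?n) + R"
    unfolding R_def f'_def g'_def by (simp add: algebra_simps flip: mult_single)
  have R: "mkey w a < mkey w (?m + ?n)" if "a \<in> supp R" for a
  proof -
    have "a \<in> supp (f' * g) \<or> a \<in> supp (sgl ?m (coef f ?m) * g')"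
      using that subsetD[OF keys_add, of a "f' * g" "sgl ?m (coef f ?m) * g'"] unfolding R_def by auto
    then show ?thesis
    proof
      assume "a \<in> supp (f' * g)"
      then obtain p q where pq: "p \<in> supp f'" "q \<in> supp g" "a = p + q" by (rule supp_mult_wt)
      then show ?thesis using mkey_add_less_le[OF f'[OF pq(1)] lm_max(2)[OF assms(2) pq(2)]] by simp
    next
      assume "a \<in> supp (sgl ?m (coef f ?m) * g')"
      then obtain p q where "p \<in> supp (sgl ?m (coef f ?m))" "q \<in> supp g'" "a = p + q"
        by (rule supp_mult_wt)
      then show ?thesis using mkey_add_le_less[OF _ g'] by (auto split: if_splits)
    qed
  qed
  then have "?m + ?n \<notin> supp R" by blast
  then show c: "coef (f * g) (?m + ?n) = coef f ?m * coef g ?n"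
    by (simp add: eq lookup_add in_keys_iff)
  have "coef f ?m \<noteq> 0" "coef g ?n \<noteq> 0" using lm_max(1) assms by (metis in_keys_iff)+
  then have "?m + ?n \<in> supp (f * g)" using c by (simp add: in_keys_iff)
  moreover have "mkey w a \<le> mkey w (?m + ?n)" if "a \<in> supp (f * g)" for a
  proof -
    have "a \<in> supp (sgl (?m + ?n) (coef f ?m * coef g ?n)) \<or> a \<in> supp R"
      using that subsetD[OF keys_add, of a "sgl (?m + ?n) (coef f ?m * coef g ?n)" R] unfolding eq by auto
    then show ?thesis using R by (fastforce split: if_splits)
  qed
  ultimately show "lm w (f * g) = ?m + ?n" by (rule lm_eqI)
qed

lemma coef_const_mult: "coef (sgl 0 c * f) m = c * coef f m" for f :: "('v, 'k::comm_ring_1) poly"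
  by (simp add: Poly_Mapping.map.rep_eq when_def flip: mult_map_scale_conv_mult)

lemma lm_cancel:
  fixes f g :: "('v::linorder, 'k::field) poly"
  assumes "f \<noteq> 0" "g \<noteq> 0" "lm w f = lm w g"
  defines "h \<equiv> f - sgl 0 (coef f (lm w f) / coef g (lm w g)) * g"
  shows "h = 0 \<or> mkey w (lm w h) < mkey w (lm w f)"
proof (cases "h = 0")
  case False
  let ?m = "lm w f" and ?c = "coef f (lm w f) / coef g (lm w g)"
  have g: "coef g ?m \<noteq> 0" using lm_max(1)[OF assms(2), of w] assms(3) by (simp add: in_keys_iff)
  have c: "coef (sgl 0 ?c * g) a = ?c * coef g a" for a
    by (rule coef_const_mult)
  have "lm w h \<noteq> ?m"
  proof
    assume "lm w h = ?m"
    then have "coef h ?m \<noteq> 0" using lm_max(1)[OF False, of w] by (simp add: in_keys_iff)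
    moreover have "coef h ?m = 0" unfolding h_def lookup_minus c using g assms(3) by simp
    ultimately show False by simp
  qed
  moreover have "mkey w (lm w h) \<le> mkey w ?m"
  proof -
    have "coef f (lm w h) \<noteq> 0 \<or> coef g (lm w h) \<noteq> 0"
      using lm_max(1)[OF False, of w] by (auto simp: h_def in_keys_iff lookup_minus c)
    then show ?thesis using lm_max(2)[OF assms(1), of _ w] lm_max(2)[OF assms(2), of _ w] assms(3)
      by (auto simp: in_keys_iff)
  qed
  ultimately show ?thesis by (simp add: order_less_le)
qed simp

text \<open>The variables may be infinite in number. Since only finitely many of them are light and
  none has weight zero, there are finitely many monomials of bounded weight, hence finitely many
  below a given one.\<close>

lemma wf_mkey:
  fixes w :: "'v::linorder \<Rightarrow> nat"
  assumes pos: "\<And>x. w x > 0" and fin: "\<And>n. finite {x. w x \<le> n}"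
  shows "wf {(m, m'). mkey w m < mkey w m'}"
proof -
  have finm: "finite {m. wt w m \<le> n}" for n
  proof -
    have le: "coef m x * w x \<le> wt w m" for m x
    proof (cases "x \<in> supp m")
      case True
      then show ?thesis unfolding wt_def using member_le_sum[of x "supp m" "\<lambda>x. coef m x * w x"] by simp
    qed (simp add: in_keys_iff)
    have "coef ` {m. wt w m \<le> n} \<subseteq>
        {f. \<forall>x. (x \<in> {x. w x \<le> n} \<longrightarrow> f x \<in> {..n}) \<and> (x \<notin> {x. w x \<le> n} \<longrightarrow> f x = 0)}"
    proof (clarsimp, intro conjI impI)
      fix m x assume m: "wt w m \<le> n"
      have "coef m x \<le> coef m x * w x" using pos[of x] by simp
      then show "coef m x \<le> n" using le[of m x] m by linarith
      assume "\<not> w x \<le> n"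
      then show "coef m x = 0" using le[of m x] m by (cases "coef m x") auto
    qed
    then have "finite (coef ` {m. wt w m \<le> n})"
      by (rule finite_subset) (rule finite_set_of_finite_funs[OF fin finite_atMost])
    then show ?thesis by (rule finite_imageD) (auto intro!: inj_onI poly_mapping_eqI)
  qed
  have fin': "finite {m'. mkey w m' < mkey w m}" for m
    by (rule finite_subset[OF _ finm[of "wt w m"]]) (auto simp: mkey_def)
  have "{(m, m'). mkey w m < mkey w m'} \<subseteq> measure (\<lambda>m. card {m'. mkey w m' < mkey w m})"
  proof clarsimp
    fix a b assume "mkey w a < mkey w b"
    then show "card {m'. mkey w m' < mkey w a} < card {m'. mkey w m' < mkey w b}"
      by (intro psubset_card_mono fin') (auto intro: order.strict_trans)
  qed
  then show ?thesis using wf_subset wf_measure by blast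
qed


section \<open>A generic point of the ladder\<close>

text \<open>Rows are counted downwards, so \<open>x\<close> lies strictly north-east of
  \<open>y\<close>; chains are the antidiagonals of submatrices.\<close>

definition ne :: "nat \<times> nat \<Rightarrow> nat \<times> nat \<Rightarrow> bool" where
  "ne x y \<longleftrightarrow> fst x < fst y \<and> snd y < snd x"

text \<open>
  The square makes the antidiagonal the leading term of every minor; the other summands make the sets
  of variables of bounded weight finite.
\<close>

definition awt :: "nat \<times> nat \<Rightarrow> nat" where
  "awt x = nat ((int (fst x) - int (snd x))\<^sup>2) + fst x + snd x + 1"

lemma int_awt: "int (awt (i, j)) = int i * int i + int i + 1 + (int j * int j + int j) - 2 * int i * int j"
proof -
  have "int (nat ((int i - int j)\<^sup>2)) = (int i - int j)\<^sup>2" by simp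
  then show ?thesis by (simp add: awt_def power2_eq_square algebra_simps)
qed

lemma awt_pos: "awt x > 0"
  by (simp add: awt_def)

lemma wf_awt: "wf {(m, m'). mkey awt m < mkey awt m'}"
proof (rule wf_mkey[OF awt_pos])
  fix n
  show "finite {x. awt x \<le> n}"
    by (rule finite_subset[of _ "{..n} \<times> {..n}"]) (auto simp: awt_def)
qed

type_synonym par = "nat \<times> nat \<times> nat"

text \<open>The parameters are \<open>a\<^sub>s\<^sub>i = (0, s, i)\<close>, \<open>b\<^sub>s\<^sub>j = (1, s, j)\<close> and \<open>y\<^sub>i\<^sub>j = (2, i, j)\<close>.\<close>

definition abm :: "nat \<Rightarrow> nat \<times> nat \<Rightarrow> par \<Rightarrow>\<^sub>0 nat" where
  "abm s x = sgl (0, s, fst x) 1 + sgl (1, s, snd x) 1"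

definition ym :: "nat \<times> nat \<Rightarrow> par \<Rightarrow>\<^sub>0 nat" where
  "ym x = sgl (2, fst x, snd x) 1"

definition ywt :: "par \<Rightarrow> nat" where
  "ywt p = (if fst p = 2 then 1 else 0)"

definition ladder_poly :: "(nat \<times> nat) set \<Rightarrow> 'k::field mpoly \<Rightarrow> bool" where
  "ladder_poly L f \<longleftrightarrow> (\<forall>m\<in>supp f. supp m \<subseteq> L)"

text \<open>\<open>fld\<close> names the coefficient field, which no other parameter mentions.
  \<open>covered\<close> ensures that \<open>cap\<close> takes its minimum over a nonempty
  set.\<close>

locale capped_ladder =
  fixes L :: "(nat \<times> nat) set" and v :: nat and d c t :: "nat \<Rightarrow> nat"
    and fld :: "'k::field itself"
  assumes finL: "finite L"
    and ladder: "\<And>i j i' j'. (i, j) \<in> L \<Longrightarrow> (i', j') \<in> L \<Longrightarrow> i \<le> i' \<Longrightarrow> j' \<le> j \<Longrightarrow> {i..i'} \<times> {j'..j} \<subseteq> L"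
    and mono_d: "mono_on {1..v} d" and mono_c: "mono_on {1..v} c"
    and t_pos: "\<And>h. h \<in> {1..v} \<Longrightarrow> 0 < t h"
    and covered: "\<And>x. x \<in> L \<Longrightarrow> \<exists>h\<in>{1..v}. fst x \<le> d h \<and> c h \<le> snd x"
begin

section \<open>The cap of an entry and its product structure\<close>

definition sub :: "nat \<Rightarrow> (nat \<times> nat) set" where
  "sub h = {x \<in> L. fst x \<le> d h \<and> c h \<le> snd x}"

definition cap :: "nat \<times> nat \<Rightarrow> nat" where
  "cap x = Min (t ` {h\<in>{1..v}. x \<in> sub h}) - 1"

lemma cap_less: "h \<in> {1..v} \<Longrightarrow> x \<in> sub h \<Longrightarrow> cap x < t h"
proof -
  assume h: "h \<in> {1..v}" "x \<in> sub h"
  then have "Min (t ` {h\<in>{1..v}. x \<in> sub h}) \<le> t h" by (intro Min_le) auto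
  then show ?thesis using t_pos[OF h(1)] by (simp add: cap_def)
qed

lemma cap_attained:
  assumes "x \<in> L"
  obtains h where "h \<in> {1..v}" "x \<in> sub h" "t h = Suc (cap x)"
proof -
  let ?T = "t ` {h\<in>{1..v}. x \<in> sub h}"
  have "?T \<noteq> {}" using covered[OF assms] assms by (auto simp: sub_def)
  then have "Min ?T \<in> ?T" by (intro Min_in) auto
  then obtain h where h: "h \<in> {1..v}" "x \<in> sub h" "t h = Min ?T" by auto
  then have "t h = Suc (cap x)" using t_pos[OF h(1)] by (simp add: cap_def)
  then show ?thesis using that h by blast
qed

definition rowok :: "nat \<Rightarrow> nat \<Rightarrow> nat \<Rightarrow> bool" where
  "rowok s j p \<longleftrightarrow> (\<forall>h\<in>{1..v}. h \<le> j \<longrightarrow> t h \<le> s \<longrightarrow> d h < p)"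

definition colok :: "nat \<Rightarrow> nat \<Rightarrow> nat \<Rightarrow> bool" where
  "colok s j q \<longleftrightarrow> (\<forall>h\<in>{1..v}. j \<le> h \<longrightarrow> t h \<le> s \<longrightarrow> q < c h)"

text \<open>
  Because of this product shape, the matrix \<open>gen0\<close> below has rank less than \<open>t j\<close> on every
  rectangle contained in \<open>L\<^sub>j\<close>.
\<close>

lemma cap_product:
  assumes j: "j \<in> {1..v}" and x: "(p, q) \<in> sub j"
  shows "s \<le> cap (p, q) \<longleftrightarrow> rowok s j p \<and> colok s j q"
proof -
  have xL: "(p, q) \<in> L" using x by (simp add: sub_def)
  have "s \<le> cap (p, q) \<longleftrightarrow> (\<forall>h\<in>{1..v}. t h \<le> s \<longrightarrow> (p, q) \<notin> sub h)"
  proof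
    assume "\<forall>h\<in>{1..v}. t h \<le> s \<longrightarrow> (p, q) \<notin> sub h"
    moreover obtain h where "h \<in> {1..v}" "(p, q) \<in> sub h" "t h = Suc (cap (p, q))"
      using cap_attained[OF xL] .
    ultimately show "s \<le> cap (p, q)" by fastforce
  qed (use cap_less in fastforce)
  also have "\<dots> \<longleftrightarrow> (\<forall>h\<in>{1..v}. t h \<le> s \<longrightarrow> d h < p \<or> q < c h)"
    using xL by (auto simp: sub_def)
  also have "\<dots> \<longleftrightarrow> rowok s j p \<and> colok s j q"
  proof
    assume *: "\<forall>h\<in>{1..v}. t h \<le> s \<longrightarrow> d h < p \<or> q < c h"
    \<comment> \<open>For \<open>h \<le> j\<close> the corners satisfy
      \<open>c h \<le> c j \<le> q\<close>, so only the row can exclude \<open>(p, q)\<close> from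
      \<open>sub h\<close>; for \<open>h \<ge> j\<close> only the column can.\<close>
    have "d h < p" if "h \<in> {1..v}" "h \<le> j" "t h \<le> s" for h
      using * that mono_onD[OF mono_c that(1) j that(2)] x by (force simp: sub_def)
    moreover have "q < c h" if "h \<in> {1..v}" "j \<le> h" "t h \<le> s" for h
      using * that mono_onD[OF mono_d j that(1) that(2)] x by (force simp: sub_def)
    ultimately show "rowok s j p \<and> colok s j q" by (auto simp: rowok_def colok_def)
  next
    assume "rowok s j p \<and> colok s j q"
    then show "\<forall>h\<in>{1..v}. t h \<le> s \<longrightarrow> d h < p \<or> q < c h"
      unfolding rowok_def colok_def using nat_le_linear by blast
  qed
  finally show ?thesis .
qed

definition gen0 :: "nat \<times> nat \<Rightarrow> (par, 'k) poly" where
  "gen0 x = (\<Sum>s\<in>{1..cap x}. sgl (abm s x) 1)"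

definition gen :: "nat \<times> nat \<Rightarrow> (par, 'k) poly" where
  "gen x = gen0 x + sgl (ym x) 1"

text \<open>The filtration by the order in the variables \<open>y\<close>, which is a valuation.\<close>

definition V :: "nat \<Rightarrow> 'k mpoly set" where
  "V n = {f. ladder_poly L f \<and> (\<forall>\<mu>\<in>supp (subst gen f). n \<le> wt ywt \<mu>)}"

section \<open>The valuation and its filtration\<close>

lemma ladder_poly_add: "ladder_poly L f \<Longrightarrow> ladder_poly L g \<Longrightarrow> ladder_poly L (f + g)"
  using keys_add[of f g] unfolding ladder_poly_def by blast

lemma ladder_poly_mult:
  assumes "ladder_poly L f" "ladder_poly L (g :: 'k mpoly)"
  shows "ladder_poly L (f * g)"
  unfolding ladder_poly_def
proof
  fix m assume "m \<in> supp (f * g)"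
  then obtain a b where "a \<in> supp f" "b \<in> supp g" "m = a + b" by (rule supp_mult_wt)
  then show "supp m \<subseteq> L" using assms by (auto simp: ladder_poly_def supp_add_nat)
qed

lemma ladder_poly_single: "supp m \<subseteq> L \<Longrightarrow> ladder_poly L (sgl m a)"
  by (auto simp: ladder_poly_def)

lemma ladder_poly_const [simp]: "ladder_poly L (sgl 0 a)"
  by (simp add: ladder_poly_single)

lemma ladder_poly_zero [simp]: "ladder_poly L 0" and ladder_poly_one [simp]: "ladder_poly L 1"
  by (auto simp: ladder_poly_def)

lemma ladder_poly_uminus [simp]: "ladder_poly L (- f) \<longleftrightarrow> ladder_poly L f"
  by (simp add: ladder_poly_def in_keys_iff)

lemma ladder_poly_lm: "ladder_poly L f \<Longrightarrow> f \<noteq> 0 \<Longrightarrow> supp (lm awt f) \<subseteq> L"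
  using lm_max(1) by (auto simp: ladder_poly_def)

lemma V_ladder_poly: "f \<in> V n \<Longrightarrow> ladder_poly L f"
  by (simp add: V_def)

lemma V_0: "V 0 = {f. ladder_poly L f}"
  by (simp add: V_def)

lemma zero_in_V [simp]: "0 \<in> V n"
  by (simp add: V_def)

lemma V_antimono: "m \<le> n \<Longrightarrow> V n \<subseteq> V m"
  by (auto simp: V_def)

lemma V_add: "f \<in> V n \<Longrightarrow> g \<in> V n \<Longrightarrow> f + g \<in> V n"
  using keys_add[of "subst gen f" "subst gen g"]
  by (auto simp: V_def subst_add ladder_poly_add)

lemma V_mult:
  assumes "f \<in> V m" "g \<in> V n"
  shows "f * g \<in> V (m + n)"
  unfolding V_def
proof safe
  show "ladder_poly L (f * g)" using assms by (simp add: V_def ladder_poly_mult)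
  fix \<mu> assume "\<mu> \<in> supp (subst gen (f * g))"
  then have "\<mu> \<in> supp (subst gen f * subst gen g)" by (simp add: subst_mult)
  then obtain a b where "a \<in> supp (subst gen f)" "b \<in> supp (subst gen g)" "\<mu> = a + b"
    by (rule supp_mult_wt)
  then show "m + n \<le> wt ywt \<mu>" using assms by (simp add: V_def wt_add add_mono)
qed

lemma V_mult_left: "ladder_poly L f \<Longrightarrow> g \<in> V n \<Longrightarrow> f * g \<in> V n"
  using V_mult[of f 0 g n] by (simp add: V_0)

lemma V_uminus: "f \<in> V n \<Longrightarrow> - f \<in> V n"
  using V_mult_left[of "sgl 0 (- 1)" f n] by (simp add: single_uminus)

lemma V_diff: "f \<in> V n \<Longrightarrow> g \<in> V n \<Longrightarrow> f - g \<in> V n"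
  using V_add[of f n "- g"] V_uminus by simp

text \<open>The parts of lowest order in \<open>y\<close> of two nonzero polynomials have a nonzero
  product, so orders add up. Weights are negated because \<open>lead\<close> selects the top. The
  lemma yields primality of \<open>V 1\<close>, its associated primes, and the inclusion of the
  symbolic powers in \<open>V n\<close>.\<close>

lemma V_cancel:
  assumes s: "ladder_poly L s" "s \<notin> V 1" and f: "ladder_poly L f" and sf: "s * f \<in> V n"
  shows "f \<in> V n"
proof (rule ccontr)
  assume "f \<notin> V n"
  let ?\<omega> = "\<lambda>p. - int (ywt p)"
  have w: "wt ?\<omega> \<mu> = - int (wt ywt \<mu>)" for \<mu>
    by (simp add: wt_def sum_negf)
  from s obtain \<mu> where \<mu>: "\<mu> \<in> supp (subst gen s)" "wt ywt \<mu> = 0" by (auto simp: V_def)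
  from f \<open>f \<notin> V n\<close> obtain \<nu> where \<nu>: "\<nu> \<in> supp (subst gen f)" "wt ywt \<nu> < n" by (auto simp: V_def)
  have "subst gen s \<noteq> 0" "subst gen f \<noteq> 0" using \<mu> \<nu> by auto
  then obtain N H M K where H: "lead ?\<omega> N (subst gen s) H" "H \<noteq> 0"
    and K: "lead ?\<omega> M (subst gen f) K" "K \<noteq> 0"
    using ex_lead by metis
  have "H * K \<noteq> 0" using H K by simp
  then obtain \<kappa> where \<kappa>: "\<kappa> \<in> supp (H * K)" by (meson all_not_in_conv keys_eq_empty)
  have HK: "lead ?\<omega> (N + M) (subst gen (s * f)) (H * K)"
    using lead_mult[OF H(1) K(1)] by (simp add: subst_mult)
  then have k: "wt ?\<omega> \<kappa> = N + M" using \<kappa> by (simp add: lead_def)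
  then have "\<kappa> \<in> supp (subst gen (s * f))" using lead_coef[OF HK] \<kappa> by (simp add: in_keys_iff)
  then have "int n \<le> int (wt ywt \<kappa>)" using sf by (auto simp: V_def)
  moreover have "0 \<le> N" using lead_le[OF H(1) \<mu>(1)] \<mu>(2) by (simp add: w)
  moreover have "- int n < M" using lead_le[OF K(1) \<nu>(1)] \<nu>(2) by (simp add: w)
  ultimately show False using k by (simp add: w)
qed

lemma one_notin_V1: "1 \<notin> V 1"
  by (simp add: V_def)

lemma V1_if_gen0_vanishes:
  assumes "ladder_poly L f" "subst gen0 f = 0"
  shows "f \<in> V 1"
proof -
  let ?\<omega> = "\<lambda>p. - int (ywt p)"
  have w: "wt ?\<omega> \<mu> = - int (wt ywt \<mu>)" for \<mu>
    by (simp add: wt_def sum_negf)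
  have "lead ?\<omega> 0 (gen x) (gen0 x)" for x
    unfolding lead_def gen_def gen0_def
  proof safe
    fix \<mu> assume "\<mu> \<in> supp ((\<Sum>s = 1..cap x. sgl (abm s x) 1) + sgl (ym x) 1 -
        (\<Sum>s = 1..cap x. sgl (abm s x) (1::'k)))"
    then show "wt ?\<omega> \<mu> < 0" by (simp add: ym_def ywt_def)
  next
    fix \<mu> assume "\<mu> \<in> supp (\<Sum>s = 1..cap x. sgl (abm s x) (1::'k))"
    then obtain s where "\<mu> = abm s x" using keys_sum by (force split: if_splits)
    then show "wt ?\<omega> \<mu> = 0" by (simp add: abm_def ywt_def wt_add)
  qed
  \<comment> \<open>\<open>gen0\<close> is the part of \<open>gen\<close> of order zero in
    \<open>y\<close>, and \<open>lead\<close> tolerates that this part vanishes after the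
    substitution.\<close>
  then have "lead ?\<omega> 0 (subst gen f) (subst gen0 f)" by (intro lead_subst_zero)
  then have "lead ?\<omega> 0 (subst gen f) 0" by (simp add: assms)
  then show ?thesis using assms(1) by (fastforce simp: V_def lead_def w)
qed


subsection \<open>Admissible sets\<close>

definition labelling :: "(nat \<times> nat) set \<Rightarrow> (nat \<times> nat \<Rightarrow> nat) \<Rightarrow> bool" where
  "labelling G s \<longleftrightarrow> G \<subseteq> L \<and> (\<forall>x\<in>G. 1 \<le> s x \<and> s x \<le> cap x) \<and>
    (\<forall>x\<in>G. \<forall>y\<in>G. ne x y \<longrightarrow> s x < s y)"

definition top_mon :: "(nat \<times> nat) set \<Rightarrow> (nat \<times> nat \<Rightarrow> nat) \<Rightarrow> nat \<times> nat \<Rightarrow> par \<Rightarrow>\<^sub>0 nat" where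
  "top_mon G s x = (if x \<in> G then abm (s x) x else ym x)"

text \<open>Entries with the same label contain no \<open>ne\<close> pair, so each label class is a
  staircase with potentials of its own.\<close>

lemma labelling_weight:
  assumes lab: "labelling G s"
  obtains \<omega> :: "par \<Rightarrow> int" where "\<And>x. x \<in> L \<Longrightarrow> lead \<omega> (int (awt x)) (gen x) (sgl (top_mon G s x) 1)"
proof -
  define Gs where "Gs r = (\<lambda>x. (int (fst x), int (snd x))) ` {x\<in>G. s x = r}" for r
  define P where "P = (\<lambda>x. int (fst x)) ` L"
  define Q where "Q = (\<lambda>x. int (snd x)) ` L"
  have "\<exists>A B :: int \<Rightarrow> int. \<forall>i\<in>P. \<forall>j\<in>Q. 2 * i * j \<le> A i + B j \<and> (A i + B j = 2 * i * j \<longleftrightarrow> (i, j) \<in> Gs r)" for r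
  proof (rule staircase_potentials_on)
    show "finite P" "finite Q" using finL by (auto simp: P_def Q_def)
    show "Gs r \<subseteq> P \<times> Q" using lab by (auto simp: Gs_def P_def Q_def labelling_def)
    fix i j i' j' assume "(i, j) \<in> Gs r" "(i', j') \<in> Gs r" "i < i'"
    then obtain x y where xy: "x \<in> G" "y \<in> G" "s x = r" "s y = r"
      "i = int (fst x)" "j = int (snd x)" "i' = int (fst y)" "j' = int (snd y)"
      by (auto simp: Gs_def)
    have "\<not> ne x y"
    proof
      assume "ne x y"
      then have "s x < s y" using lab xy(1,2) unfolding labelling_def by blast
      then show False using xy by simp
    qed
    then show "j \<le> j'" using xy \<open>i < i'\<close> by (auto simp: ne_def)
  qed
  then obtain A B :: "nat \<Rightarrow> int \<Rightarrow> int" where AB: "\<And>r i j. i \<in> P \<Longrightarrow> j \<in> Q \<Longrightarrow>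
      2 * i * j \<le> A r i + B r j \<and> (A r i + B r j = 2 * i * j \<longleftrightarrow> (i, j) \<in> Gs r)"
    by metis
  \<comment> \<open>The square terms of \<open>awt\<close> are split between row and column, so the
    weight of \<open>abm r (i, j)\<close> falls short of \<open>awt\<close> by
    \<open>A r i + B r j - 2 * i * j\<close>, which is zero exactly on the class of
    \<open>r\<close>. The weight of \<open>y\<close> is one too small on \<open>G\<close>, where the
    rank-one term has to win, and exact elsewhere.\<close>
  define \<omega> :: "par \<Rightarrow> int" where "\<omega> = (\<lambda>(k, r, i).
      if k = 0 then int i * int i + int i + 1 - A r (int i)
      else if k = 1 then int i * int i + int i - B r (int i)
      else int (awt (r, i)) - (if (r, i) \<in> G then 1 else 0))"
  have ab: "wt \<omega> (abm r x) \<le> int (awt x) \<and> (wt \<omega> (abm r x) = int (awt x) \<longleftrightarrow> x \<in> G \<and> s x = r)"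
    if "x \<in> L" for r x
  proof -
    obtain i j where x: "x = (i, j)" by (cases x)
    have "(int i, int j) \<in> Gs r \<longleftrightarrow> x \<in> G \<and> s x = r" by (force simp: Gs_def x)
    moreover have "int i \<in> P" "int j \<in> Q" using that by (force simp: P_def Q_def x)+
    ultimately have "2 * int i * int j \<le> A r (int i) + B r (int j)"
      "A r (int i) + B r (int j) = 2 * int i * int j \<longleftrightarrow> x \<in> G \<and> s x = r"
      using AB[of "int i" "int j" r] by auto
    then show ?thesis using int_awt[of i j] by (auto simp: x abm_def wt_add \<omega>_def)
  qed
  have y: "wt \<omega> (ym x) = int (awt x) - (if x \<in> G then 1 else 0)" for x
    by (simp add: ym_def \<omega>_def)
  have "lead \<omega> (int (awt x)) (gen x) (sgl (top_mon G s x) 1)" if x: "x \<in> L" for x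
  proof (cases "x \<in> G")
    case True
    then have s: "s x \<in> {1..cap x}" using lab by (auto simp: labelling_def)
    have "gen x - sgl (top_mon G s x) 1 = (\<Sum>r\<in>{1..cap x} - {s x}. sgl (abm r x) 1) + sgl (ym x) 1"
      using True sum.remove[OF finite_atLeastAtMost s, of "\<lambda>r. sgl (abm r x) (1::'k)"]
      by (simp add: gen_def gen0_def top_mon_def)
    moreover have "wt \<omega> \<mu> < int (awt x)"
      if \<mu>: "\<mu> \<in> supp ((\<Sum>r\<in>{1..cap x} - {s x}. sgl (abm r x) 1) + sgl (ym x) (1::'k))" for \<mu>
    proof -
      have "\<mu> \<in> supp (\<Sum>r\<in>{1..cap x} - {s x}. sgl (abm r x) (1::'k)) \<or> \<mu> \<in> supp (sgl (ym x) (1::'k))"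
        using subsetD[OF keys_add \<mu>] by auto
      then consider r where "r \<noteq> s x" "\<mu> = abm r x" | "\<mu> = ym x"
        using keys_sum[of "\<lambda>r. sgl (abm r x) (1::'k)" "{1..cap x} - {s x}"] by (auto split: if_splits)
      then show ?thesis
        by cases (use ab[OF x] y[of x] True in \<open>auto simp: order_less_le\<close>)
    qed
    ultimately show ?thesis using ab[OF x, of "s x"] True by (auto simp: lead_def top_mon_def)
  next
    case False
    then have "gen x - sgl (top_mon G s x) 1 = (\<Sum>r\<in>{1..cap x}. sgl (abm r x) 1)"
      by (simp add: gen_def gen0_def top_mon_def)
    moreover have "wt \<omega> \<mu> < int (awt x)" if \<mu>: "\<mu> \<in> supp (\<Sum>r\<in>{1..cap x}. sgl (abm r x) (1::'k))" for \<mu>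
    proof -
      obtain r where "\<mu> = abm r x"
        using subsetD[OF keys_sum \<mu>] by (auto split: if_splits)
      then show ?thesis using ab[OF x, of r] False by (auto simp: order_less_le)
    qed
    ultimately show ?thesis using y[of x] False by (auto simp: lead_def top_mon_def)
  qed
  then show ?thesis using that by blast
qed

text \<open>Off \<open>G\<close> an exponent is visible as that of its \<open>y\<close>. On a label
  class only row sums and column sums are visible, but these determine the exponents, because a
  staircase seen as a bipartite graph of rows and columns has no cycle.\<close>

lemma top_mon_inj:
  assumes lab: "labelling G s" and m: "supp m \<subseteq> L" and n: "supp n \<subseteq> L"
    and eq: "mlin (top_mon G s) m = mlin (top_mon G s) n"
  shows "m = n"
proof -
  let ?h = "top_mon G s"
  define D where "D x = int (coef m x) - int (coef n x)" for x
  have GL: "G \<subseteq> L" "finite G" using lab finL finite_subset[of G L] by (auto simp: labelling_def)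
  have D0: "(\<Sum>x\<in>L. D x * int (coef (?h x) p)) = 0" for p
  proof -
    have "(\<Sum>x\<in>L. coef m x * coef (?h x) p) = (\<Sum>x\<in>L. coef n x * coef (?h x) p)"
      using arg_cong[OF eq, of "\<lambda>\<mu>. coef \<mu> p"] wt_superset[OF finL m, of "\<lambda>x. coef (?h x) p"]
        wt_superset[OF finL n, of "\<lambda>x. coef (?h x) p"]
      by (simp add: coef_mlin)
    then have "int (\<Sum>x\<in>L. coef m x * coef (?h x) p) = int (\<Sum>x\<in>L. coef n x * coef (?h x) p)" by simp
    then show ?thesis by (simp add: D_def algebra_simps sum_subtractf)
  qed
  have y: "D x = 0" if "x \<in> L" "x \<notin> G" for x
  proof -
    have "D z * int (coef (?h z) (2, fst x, snd x)) = (if z = x then D x else 0)" for z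
      using that(2) by (cases "z = x") (auto simp: top_mon_def abm_def ym_def lookup_add lookup_single when_def simp flip: prod_eq_iff)
    then show ?thesis using D0[of "(2, fst x, snd x)"] that(1) finL by simp
  qed
  have row: "(\<Sum>x\<in>{x\<in>G. s x = r \<and> fst x = i}. D x) = 0" for r i
  proof -
    have "D z * int (coef (?h z) (0, r, i)) = (if z \<in> {x\<in>G. s x = r \<and> fst x = i} then D z else 0)" for z
      by (auto simp: top_mon_def abm_def ym_def lookup_add lookup_single when_def)
    then have "(\<Sum>z\<in>L. if z \<in> {x\<in>G. s x = r \<and> fst x = i} then D z else 0) = 0"
      using D0[of "(0, r, i)"] by simp
    then show ?thesis using finL GL(1)
      by (subst (asm) sum.inter_restrict[OF finL, symmetric]) (simp add: Int_absorb1 subset_iff inf_commute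
          Int_absorb2[of "{x\<in>G. s x = r \<and> fst x = i}" L])
  qed
  have col: "(\<Sum>x\<in>{x\<in>G. s x = r \<and> snd x = j}. D x) = 0" for r j
  proof -
    have "D z * int (coef (?h z) (1, r, j)) = (if z \<in> {x\<in>G. s x = r \<and> snd x = j} then D z else 0)" for z
      by (auto simp: top_mon_def abm_def ym_def lookup_add lookup_single when_def)
    then have "(\<Sum>z\<in>L. if z \<in> {x\<in>G. s x = r \<and> snd x = j} then D z else 0) = 0"
      using D0[of "(1, r, j)"] by simp
    then show ?thesis using finL GL(1)
      by (subst (asm) sum.inter_restrict[OF finL, symmetric]) (simp add: Int_absorb1 subset_iff inf_commute
          Int_absorb2[of "{x\<in>G. s x = r \<and> snd x = j}" L])
  qed
  have other: "\<exists>z\<in>S. z \<noteq> x \<and> D z \<noteq> 0" if "finite S" "x \<in> S" "D x \<noteq> 0" "(\<Sum>x\<in>S. D x) = 0" for S x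
  proof (rule ccontr)
    assume "\<not> ?thesis"
    then have "(\<Sum>z\<in>S. D z) = (\<Sum>z\<in>{x}. D z)"
      using that by (intro sum.mono_neutral_right) auto
    then show False using that by simp
  qed
  have "D x = 0" if "x \<in> G" for x
  proof (rule ccontr)
    assume Dx: "D x \<noteq> 0"
    define Z where "Z = {z\<in>G. s z = s x \<and> D z \<noteq> 0}"
    have Z: "finite Z" "x \<in> Z" using GL that Dx by (auto simp: Z_def)
    \<comment> \<open>To balance the sums, the lexicographically first point with nonzero difference
      needs a further one in its row and another in its column; these two form a \<open>ne\<close>
      pair with equal labels.\<close>
    define i where "i = (LEAST i. \<exists>j. (i, j) \<in> Z)"
    define j where "j = (LEAST j. (i, j) \<in> Z)"
    have "\<exists>j. (i, j) \<in> Z" unfolding i_def by (rule LeastI_ex) (use Z(2) in \<open>metis prod.collapse\<close>)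
    then have ij: "(i, j) \<in> Z" unfolding j_def by (rule LeastI_ex)
    have imin: "i \<le> fst z" if "z \<in> Z" for z
      unfolding i_def by (rule Least_le) (use that in \<open>metis prod.collapse\<close>)
    have jmin: "j \<le> q" if "(i, q) \<in> Z" for q
      unfolding j_def by (rule Least_le) (use that in simp)
    obtain z where z: "z \<in> {z\<in>G. s z = s x \<and> fst z = i}" "z \<noteq> (i, j)" "D z \<noteq> 0"
      using other[of "{z\<in>G. s z = s x \<and> fst z = i}" "(i, j)"] row[of "s x" i] ij GL(2) by (auto simp: Z_def)
    then have "z \<in> Z" "z = (i, snd z)" by (auto simp: Z_def prod_eq_iff)
    then have zj: "j < snd z" using jmin[of "snd z"] z(2) by (metis le_neq_implies_less)
    obtain u where u: "u \<in> {z\<in>G. s z = s x \<and> snd z = j}" "u \<noteq> (i, j)" "D u \<noteq> 0"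
      using other[of "{z\<in>G. s z = s x \<and> snd z = j}" "(i, j)"] col[of "s x" j] ij GL(2) by (auto simp: Z_def)
    then have "u \<in> Z" "snd u = j" by (auto simp: Z_def)
    then have "i < fst u" using imin[of u] u(2) by (metis le_neq_implies_less prod.collapse)
    then have "ne z u" using z u zj by (auto simp: ne_def)
    moreover have "z \<in> G" "u \<in> G" using z u by auto
    ultimately have "s z < s u" using lab unfolding labelling_def by blast
    then show False using z u by simp
  qed
  then have DL: "D x = 0" if "x \<in> L" for x using that y by blast
  show ?thesis
  proof (rule poly_mapping_eqI)
    fix x show "coef m x = coef n x"
    proof (cases "x \<in> L")
      case True
      then show ?thesis using DL[of x] by (simp add: D_def)
    next
      case False
      then have "x \<notin> supp m" "x \<notin> supp n" using m n by auto
      then show ?thesis by (simp add: in_keys_iff)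
    qed
  qed
qed

text \<open>The top image of the leading monomial cannot be cancelled: monomials of smaller weight
  stay below it, and those of equal weight have other top images by \<open>top_mon_inj\<close>. So
  it occurs in \<open>subst gen f\<close>, and its degree in \<open>y\<close> counts the variables
  off \<open>G\<close>.\<close>

lemma lm_V_bound:
  assumes lab: "labelling G s" and f: "f \<in> V n" "f \<noteq> 0"
  shows "n \<le> (\<Sum>x\<in>L - G. coef (lm awt f) x)"
proof -
  let ?h = "top_mon G s" and ?m = "lm awt f"
  obtain \<omega> :: "par \<Rightarrow> int" where \<omega>: "\<And>x. x \<in> L \<Longrightarrow> lead \<omega> (int (awt x)) (gen x) (sgl (?h x) 1)"
    using labelling_weight[OF lab] by blast
  have fL: "supp m' \<subseteq> L" if "m' \<in> supp f" for m' using f(1) that by (auto simp: V_def ladder_poly_def)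
  have m: "?m \<in> supp f" by (rule lm_max(1)[OF f(2)])
  have ld: "lead \<omega> (int (wt awt m')) (pp gen m') (sgl (mlin ?h m') 1)" if "m' \<in> supp f" for m'
  proof -
    have "lead \<omega> (wt (\<lambda>x. int (awt x)) m') (pp gen m') (pp (\<lambda>x. sgl (?h x) 1) m')"
      by (rule lead_pp) (use \<omega> fL[OF that] in blast)
    then show ?thesis by (simp add: pp_mlin of_nat_wt)
  qed
  let ?\<mu> = "mlin ?h ?m"
  have wt\<mu>: "wt \<omega> ?\<mu> = int (wt awt ?m)" using ld[OF m] by (simp add: lead_def)
  have c: "coef (pp gen m') ?\<mu> = (if m' = ?m then 1 else 0)" if m': "m' \<in> supp f" for m'
  proof -
    have "wt awt m' \<le> wt awt ?m" using lm_max(2)[OF f(2) m', of awt] by (auto simp: mkey_def)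
    then consider "wt awt m' < wt awt ?m" | "wt awt m' = wt awt ?m" by linarith
    then show ?thesis
    proof cases
      case 1
      then have "?\<mu> \<notin> supp (pp gen m')" using lead_le[OF ld[OF m'], of ?\<mu>] wt\<mu> by auto
      moreover have "m' \<noteq> ?m" using 1 by auto
      ultimately show ?thesis by (simp add: in_keys_iff)
    next
      case 2
      then have "coef (pp gen m') ?\<mu> = coef (sgl (mlin ?h m') 1) ?\<mu>"
        using lead_coef[OF ld[OF m'], of ?\<mu>] wt\<mu> by simp
      moreover have "mlin ?h m' = ?\<mu> \<Longrightarrow> m' = ?m"
        using top_mon_inj[OF lab fL[OF m'] fL[OF m]] by blast
      ultimately show ?thesis by (auto simp: lookup_single when_def)
    qed
  qed
  have "coef (subst gen f) ?\<mu> = (\<Sum>m'\<in>supp f. coef f m' * (if m' = ?m then 1 else 0))"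
    unfolding subst_def lookup_sum coef_const_mult by (rule sum.cong) (simp_all add: c)
  also have "\<dots> = (\<Sum>m'\<in>supp f. if m' = ?m then coef f m' else 0)" by (rule sum.cong) auto
  also have "\<dots> = coef f ?m" using m by (subst sum.delta) auto
  finally have "?\<mu> \<in> supp (subst gen f)" using m by (simp add: in_keys_iff)
  then have "n \<le> wt ywt ?\<mu>" using f(1) by (auto simp: V_def)
  also have "wt ywt ?\<mu> = (\<Sum>x\<in>L. coef ?m x * wt ywt (?h x))"
    using wt_superset[OF finL fL[OF m], of "\<lambda>x. wt ywt (?h x)"] by (simp add: wt_mlin)
  also have "\<dots> = (\<Sum>x\<in>L - G. coef ?m x)"
  proof -
    have "wt ywt (?h x) = (if x \<in> G then 0 else 1)" for x
      by (simp add: top_mon_def abm_def ym_def wt_add ywt_def)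
    then show ?thesis using finL
      by (intro sum.mono_neutral_cong_right) auto
  qed
  finally show ?thesis .
qed

end


section \<open>Minors\<close>

text \<open>Lists instead of sets allow increasing rows with decreasing columns, and prepending one
  row and one column to a pivot.\<close>

definition dmat :: "nat list \<Rightarrow> nat list \<Rightarrow> 'k::field mpoly mat" where
  "dmat rs cs = mat (length rs) (length rs) (\<lambda>(p, q). Var (rs ! p, cs ! q))"

definition dm :: "nat list \<Rightarrow> nat list \<Rightarrow> 'k::field mpoly" where
  "dm rs cs = det (dmat rs cs)"

lemma dmat_carrier [simp]: "dmat rs cs \<in> carrier_mat (length rs) (length rs)"
  by (simp add: dmat_def)

lemma reverse_permutes: "(\<lambda>i. if i < n then n - 1 - i else i) permutes {0..<n::nat}"
  by (rule bij_imp_permutes)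
    (auto intro!: bij_betw_byWitness[where f' = "\<lambda>i. n - 1 - i"])

text \<open>Reversing the columns turns the antidiagonal of a minor into the diagonal of \<open>dmat\<close>.\<close>

lemma minor_conv_dm:
  assumes "finite A" "finite B" "card A = card B"
  shows "\<exists>\<epsilon>\<in>{1, - 1}. minor A B = \<epsilon> * (dm (sorted_list_of_set A) (rev (sorted_list_of_set B)) :: 'k::field mpoly)"
proof -
  let ?n = "card A" and ?rs = "sorted_list_of_set A" and ?cs = "sorted_list_of_set B"
  define \<pi> where "\<pi> = (\<lambda>i. if i < ?n then ?n - 1 - i else i)"
  let ?D = "dmat ?rs (rev ?cs) :: 'k mpoly mat"
  let ?M = "mat ?n ?n (\<lambda>(p, q). Var (?rs ! p, ?cs ! q)) :: 'k mpoly mat"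
  have len: "length ?rs = ?n" "length ?cs = ?n" using assms by auto
  have T: "transpose_mat ?D \<in> carrier_mat ?n ?n" using len by (simp add: dmat_def)
  have "transpose_mat ?M = mat ?n ?n (\<lambda>(i, j). transpose_mat ?D $$ (\<pi> i, j))"
    using len by (auto simp: dmat_def \<pi>_def rev_nth intro!: eq_matI)
  then have "det (transpose_mat ?M) = signof \<pi> * det (transpose_mat ?D)"
    using det_permute_rows[OF T reverse_permutes[of ?n, folded \<pi>_def]] by simp
  moreover have "det (transpose_mat ?M) = minor A B"
    using assms(3) by (subst det_transpose[of _ ?n]) (auto simp: minor_def)
  moreover have "det (transpose_mat ?D) = dm ?rs (rev ?cs)"
    unfolding dm_def using len by (subst det_transpose[of _ ?n]) (auto simp: dmat_def)
  ultimately show ?thesis using signof_pm_one[of \<pi>] by metis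
qed

lemma dm_leibniz: "dm rs cs = (\<Sum>\<pi>\<in>{\<pi>. \<pi> permutes {0..<length rs}}.
    signof \<pi> * sgl (\<Sum>i<length rs. sgl (rs ! i, cs ! \<pi> i) 1) (1::'k::field))"
proof -
  have "(\<Prod>i = 0..<length rs. dmat rs cs $$ (i, \<pi> i)) =
      sgl (\<Sum>i<length rs. sgl (rs ! i, cs ! \<pi> i) 1) (1::'k)" if "\<pi> permutes {0..<length rs}" for \<pi>
  proof -
    have "(\<Prod>i = 0..<length rs. dmat rs cs $$ (i, \<pi> i)) = (\<Prod>i<length rs. sgl (sgl (rs ! i, cs ! \<pi> i) 1) (1::'k))"
    proof (rule prod.cong)
      fix i assume "i \<in> {..<length rs}"
      moreover from this have "\<pi> i < length rs" using permutes_in_image[OF that, of i] by simp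
      ultimately show "dmat rs cs $$ (i, \<pi> i) = sgl (sgl (rs ! i, cs ! \<pi> i) 1) (1::'k)"
        by (simp add: dmat_def Var_def)
    qed auto
    moreover have "(\<Prod>i\<in>I. sgl (g i) (1::'k)) = sgl (\<Sum>i\<in>I. g i) 1"
      for g :: "nat \<Rightarrow> (nat \<times> nat) \<Rightarrow>\<^sub>0 nat" and I
      by (induction I rule: infinite_finite_induct) (auto simp: mult_single)
    ultimately show ?thesis by simp
  qed
  then show ?thesis
    unfolding dm_def det_def'[OF dmat_carrier] by (intro sum.cong) auto
qed

lemma sorted_less_nth_iff:
  "sorted_wrt (<) (rs::nat list) \<Longrightarrow> p < length rs \<Longrightarrow> q < length rs \<Longrightarrow> rs ! p < rs ! q \<longleftrightarrow> p < q"
  by (metis linorder_neqE_nat order_less_irrefl order_less_trans sorted_wrt_nth_less)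

lemma sorted_greater_nth_iff:
  "sorted_wrt (>) (rs::nat list) \<Longrightarrow> p < length rs \<Longrightarrow> q < length rs \<Longrightarrow> rs ! p < rs ! q \<longleftrightarrow> q < p"
  by (metis linorder_neqE_nat order_less_irrefl order_less_trans sorted_wrt_nth_less)

text \<open>Row indices paired with negated column indices form a staircase along the diagonal. Its
  potentials bound every entry by \<open>\<alpha> p + \<beta> q\<close>, with equality only on the
  diagonal, and the bound summed over a permutation is the same for all permutations.\<close>

lemma diagonal_weight_max:
  assumes rs: "sorted_wrt (<) rs" and cs: "sorted_wrt (>) cs" and len: "length cs = length rs"
    and \<pi>: "\<pi> permutes {0..<length rs}" "\<pi> \<noteq> id"
  shows "(\<Sum>i<length rs. awt (rs ! i, cs ! \<pi> i)) < (\<Sum>i<length rs. awt (rs ! i, cs ! i))"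
proof -
  let ?n = "length rs"
  define G where "G = (\<lambda>i. (int (rs ! i), - int (cs ! i))) ` {..<?n}"
  have "\<exists>A B :: int \<Rightarrow> int. \<forall>i\<in>fst ` G. \<forall>j\<in>snd ` G.
      2 * i * j \<le> A i + B j \<and> (A i + B j = 2 * i * j \<longleftrightarrow> (i, j) \<in> G)"
  proof (rule staircase_potentials)
    fix i j i' j' assume "(i, j) \<in> G" "(i', j') \<in> G" "i < i'"
    then obtain p q where "p < ?n" "q < ?n" "i = int (rs ! p)" "j = - int (cs ! p)"
      "i' = int (rs ! q)" "j' = - int (cs ! q)" "rs ! p < rs ! q" by (auto simp: G_def)
    then show "j \<le> j'"
      using sorted_less_nth_iff[OF rs, of p q] sorted_greater_nth_iff[OF cs, of q p] len by auto
  qed (simp add: G_def)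
  then obtain A B :: "int \<Rightarrow> int" where AB: "\<And>i j. i \<in> fst ` G \<Longrightarrow> j \<in> snd ` G \<Longrightarrow>
      2 * i * j \<le> A i + B j \<and> (A i + B j = 2 * i * j \<longleftrightarrow> (i, j) \<in> G)" by blast
  define \<alpha> where "\<alpha> p = int (rs ! p) * int (rs ! p) + int (rs ! p) + 1 + A (int (rs ! p))" for p
  define \<beta> where "\<beta> q = int (cs ! q) * int (cs ! q) + int (cs ! q) + B (- int (cs ! q))" for q
  have w: "int (awt (rs ! p, cs ! q)) \<le> \<alpha> p + \<beta> q \<and> (int (awt (rs ! p, cs ! q)) = \<alpha> p + \<beta> q \<longleftrightarrow> p = q)"
    if pq: "p < ?n" "q < ?n" for p q
  proof -
    have "(int (rs ! p), - int (cs ! q)) \<in> G \<longleftrightarrow> p = q"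
    proof
      assume "(int (rs ! p), - int (cs ! q)) \<in> G"
      then obtain i where i: "i < ?n" "rs ! p = rs ! i" "cs ! q = cs ! i" by (auto simp: G_def)
      have "p = i" using sorted_less_nth_iff[OF rs, of p i] sorted_less_nth_iff[OF rs, of i p] i pq by auto
      moreover have "q = i" using sorted_greater_nth_iff[OF cs, of q i] sorted_greater_nth_iff[OF cs, of i q] i pq len by auto
      ultimately show "p = q" by simp
    qed (use pq in \<open>auto simp: G_def\<close>)
    moreover have "int (rs ! p) \<in> fst ` G" "- int (cs ! q) \<in> snd ` G"
      using pq by (auto simp: G_def image_image)
    ultimately have "2 * int (rs ! p) * - int (cs ! q) \<le> A (int (rs ! p)) + B (- int (cs ! q))"
      "A (int (rs ! p)) + B (- int (cs ! q)) = 2 * int (rs ! p) * - int (cs ! q) \<longleftrightarrow> p = q"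
      using AB[of "int (rs ! p)" "- int (cs ! q)"] by auto
    then show ?thesis unfolding int_awt \<alpha>_def \<beta>_def by auto
  qed
  have \<pi>n: "\<pi> i < ?n" if "i < ?n" for i using permutes_in_image[OF \<pi>(1), of i] that by simp
  obtain i where i: "\<pi> i \<noteq> i" "i < ?n"
    using \<pi> permutes_not_in[OF \<pi>(1)] by (metis atLeastLessThan_iff eq_id_iff zero_le)
  have "(\<Sum>i<?n. int (awt (rs ! i, cs ! \<pi> i))) < (\<Sum>i<?n. \<alpha> i + \<beta> (\<pi> i))"
  proof (rule sum_strict_mono_ex1)
    show "\<forall>i\<in>{..<?n}. int (awt (rs ! i, cs ! \<pi> i)) \<le> \<alpha> i + \<beta> (\<pi> i)" using w \<pi>n by auto
    have "int (awt (rs ! i, cs ! \<pi> i)) < \<alpha> i + \<beta> (\<pi> i)"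
      using w[OF i(2) \<pi>n[OF i(2)]] i(1) by auto
    then show "\<exists>i\<in>{..<?n}. int (awt (rs ! i, cs ! \<pi> i)) < \<alpha> i + \<beta> (\<pi> i)" using i(2) by blast
  qed simp
  also have "(\<Sum>i<?n. \<alpha> i + \<beta> (\<pi> i)) = (\<Sum>i<?n. \<alpha> i + \<beta> i)"
    using sum.permute[OF \<pi>(1), of \<beta>] by (simp add: sum.distrib o_def atLeast0LessThan)
  also have "\<dots> = (\<Sum>i<?n. int (awt (rs ! i, cs ! i)))" by (rule sum.cong) (use w[of i i for i] in auto)
  finally show ?thesis by (simp flip: of_nat_sum)
qed

definition list_mon :: "(nat \<times> nat) list \<Rightarrow> (nat \<times> nat) \<Rightarrow>\<^sub>0 nat" where
  "list_mon xs = (\<Sum>x\<leftarrow>xs. sgl x 1)"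

lemma list_mon_simps [simp]:
  "list_mon [] = 0" "list_mon (x # xs) = sgl x 1 + list_mon xs" "list_mon (xs @ ys) = list_mon xs + list_mon ys"
  by (simp_all add: list_mon_def)

lemma coef_list_mon: "coef (list_mon xs) x = count_list xs x"
  by (induction xs) (auto simp: lookup_add lookup_single when_def)

lemma lm_dm:
  assumes rs: "sorted_wrt (<) rs" and cs: "sorted_wrt (>) cs" and len: "length cs = length rs"
  shows "dm rs cs \<noteq> (0::'k::field mpoly)" "lm awt (dm rs cs :: 'k mpoly) = list_mon (zip rs cs)"
proof -
  let ?n = "length rs"
  define M where "M \<pi> = (\<Sum>i<?n. sgl (rs ! i, cs ! \<pi> i) (1::nat))" for \<pi>
  have wM: "wt awt (M \<pi>) = (\<Sum>i<?n. awt (rs ! i, cs ! \<pi> i))" for \<pi> by (simp add: M_def wt_sum)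
  have eq: "dm rs cs = (\<Sum>\<pi>\<in>{\<pi>. \<pi> permutes {0..<?n}}. signof \<pi> * sgl (M \<pi>) (1::'k))"
    unfolding dm_leibniz M_def ..
  have less: "wt awt (M \<pi>) < wt awt (M id)" if "\<pi> permutes {0..<?n}" "\<pi> \<noteq> id" for \<pi>
    unfolding wM using diagonal_weight_max[OF rs cs len that] by simp
  have neq: "M \<pi> \<noteq> M id" if "\<pi> permutes {0..<?n}" "\<pi> \<noteq> id" for \<pi>
    using less[OF that] by auto
  have sg: "signof \<pi> * sgl m (1::'k) = sgl m (signof \<pi>)" for \<pi> :: "nat \<Rightarrow> nat" and m :: "(nat \<times> nat) \<Rightarrow>\<^sub>0 nat"
    by (simp add: sign_def single_uminus)
  have "coef (dm rs cs) (M id) = (\<Sum>\<pi>\<in>{\<pi>. \<pi> permutes {0..<?n}}. if \<pi> = id then 1 else (0::'k))"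
    unfolding eq lookup_sum sg
    by (rule sum.cong) (use neq in \<open>auto simp: lookup_single when_def\<close>)
  also have "\<dots> = 1" by (subst sum.delta) (auto simp: finite_permutations permutes_id)
  finally have c: "coef (dm rs cs) (M id) = (1::'k)" .
  then show "dm rs cs \<noteq> (0::'k mpoly)" by auto
  have "lm awt (dm rs cs :: 'k mpoly) = M id"
  proof (rule lm_eqI)
    show "M id \<in> supp (dm rs cs :: 'k mpoly)" using c by (simp add: in_keys_iff)
    fix m assume "m \<in> supp (dm rs cs :: 'k mpoly)"
    then obtain \<pi> where "\<pi> permutes {0..<?n}" "m \<in> supp (sgl (M \<pi>) (signof \<pi> :: 'k))"
      unfolding eq sg using keys_sum by fastforce
    then have "m = M id \<or> wt awt m < wt awt (M id)" using less[of \<pi>] by (cases "\<pi> = id") (auto split: if_splits)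
    then show "mkey awt m \<le> mkey awt (M id)" by (auto simp: mkey_def)
  qed
  also have "M id = list_mon (zip rs cs)"
    using len by (simp add: M_def list_mon_def sum_list_sum_nth atLeast0LessThan)
  finally show "lm awt (dm rs cs :: 'k mpoly) = list_mon (zip rs cs)" .
qed


subsection \<open>Schur complements\<close>

text \<open>Left multiplication by a block triangular matrix clears the upper right block. The
  adjugate stands in for the inverse of \<open>D\<close>, at the price of powers of
  \<open>det D\<close>, since the entries will be polynomials.\<close>

lemma det_schur:
  fixes D :: "'a::idom mat"
  assumes A: "A \<in> carrier_mat e e" and B: "B \<in> carrier_mat e p"
    and C: "C \<in> carrier_mat p e" and D: "D \<in> carrier_mat p p"
  shows "det D ^ e * det (four_block_mat A B C D) = det (det D \<cdot>\<^sub>m A - B * adj_mat D * C) * det D"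
proof -
  let ?J = "adj_mat D" and ?\<delta> = "det D"
  have J: "?J \<in> carrier_mat p p" "?J * D = ?\<delta> \<cdot>\<^sub>m 1\<^sub>m p" using adj_mat[OF D] by auto
  have BJ: "B * ?J \<in> carrier_mat e p" using B J by simp
  let ?T = "four_block_mat (?\<delta> \<cdot>\<^sub>m 1\<^sub>m e) (- (B * ?J)) (0\<^sub>m p e) (1\<^sub>m p)"
  have e1: "(?\<delta> \<cdot>\<^sub>m 1\<^sub>m e) * A + - (B * ?J) * C = ?\<delta> \<cdot>\<^sub>m A - B * ?J * C"
  proof -
    have "(?\<delta> \<cdot>\<^sub>m 1\<^sub>m e) * A = ?\<delta> \<cdot>\<^sub>m A" using A by (simp add: mult_smult_assoc_mat[of _ e e _ e])
    moreover have "- (B * ?J) * C = - (B * ?J * C)"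
      by (rule uminus_mult_left_mat) (use J B C in auto)
    ultimately show ?thesis using A BJ C by (intro eq_matI) auto
  qed
  have e2: "(?\<delta> \<cdot>\<^sub>m 1\<^sub>m e) * B + - (B * ?J) * D = 0\<^sub>m e p"
  proof -
    have "(?\<delta> \<cdot>\<^sub>m 1\<^sub>m e) * B = ?\<delta> \<cdot>\<^sub>m B" using B by (simp add: mult_smult_assoc_mat[of _ e e _ p])
    moreover have "- (B * ?J) * D = - (B * (?J * D))" using B J(1) D by (simp add: assoc_mult_mat[of _ e p _ p _ p])
    moreover have "B * (?J * D) = ?\<delta> \<cdot>\<^sub>m B" using B unfolding J(2) by (simp add: mult_smult_distrib[of _ e p _ p])
    ultimately show ?thesis using B by (intro eq_matI) auto
  qed
  have prod: "?T * four_block_mat A B C D = four_block_mat (?\<delta> \<cdot>\<^sub>m A - B * ?J * C) (0\<^sub>m e p) C D"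
    by (subst mult_four_block_mat[of _ e e _ p _ p _ _ e _ p])
      (use A B C D BJ in \<open>auto simp: e1 e2\<close>)
  have TM: "?T \<in> carrier_mat (e + p) (e + p)" "four_block_mat A B C D \<in> carrier_mat (e + p) (e + p)"
    using A B C D BJ by (auto intro!: four_block_carrier_mat)
  have "det ?T = det (?\<delta> \<cdot>\<^sub>m 1\<^sub>m e) * det (1\<^sub>m p)"
    by (rule det_four_block_mat_lower_left_zero) (use BJ in auto)
  then have "det ?T = ?\<delta> ^ e" by simp
  then have "?\<delta> ^ e * det (four_block_mat A B C D) = det (?T * four_block_mat A B C D)"
    using det_mult[OF TM] by simp
  also have "\<dots> = det (?\<delta> \<cdot>\<^sub>m A - B * ?J * C) * det D"
    unfolding prod by (rule det_four_block_mat_upper_right_zero) (use A BJ C D in \<open>auto intro!: minus_carrier_mat\<close>)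
  finally show ?thesis .
qed

text \<open>A form of Sylvester's identity: the entries of the Schur complement are, up to the pivot
  \<open>\<delta>\<close>, the minors that border it by one row and one column, as the same formula
  shows for a block of size one. The factor \<open>\<delta>\<close> stays on both sides until it is
  known to be nonzero.\<close>

lemma dm_bordered:
  fixes rs cs :: "nat list"
  assumes len: "length cs = length rs" and e: "e \<le> length rs"
  defines "\<delta> \<equiv> (dm (drop e rs) (drop e cs) :: 'k::field mpoly)"
  shows "\<exists>E :: 'k mpoly mat. E \<in> carrier_mat e e \<and> \<delta> ^ e * dm rs cs = det E * \<delta> \<and>
    (\<forall>x<e. \<forall>y<e. \<delta> * dm (rs ! x # drop e rs) (cs ! y # drop e cs) = E $$ (x, y) * \<delta>)"
proof -
  define p where "p = length rs - e"
  define A :: "'k mpoly mat" where "A = mat e e (\<lambda>(i, j). Var (rs ! i, cs ! j))"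
  define B :: "'k mpoly mat" where "B = mat e p (\<lambda>(i, j). Var (rs ! i, cs ! (e + j)))"
  define C :: "'k mpoly mat" where "C = mat p e (\<lambda>(i, j). Var (rs ! (e + i), cs ! j))"
  define D :: "'k mpoly mat" where "D = dmat (drop e rs) (drop e cs)"
  have D: "D \<in> carrier_mat p p" by (simp add: D_def p_def dmat_def)
  have ABC: "A \<in> carrier_mat e e" "B \<in> carrier_mat e p" "C \<in> carrier_mat p e" by (auto simp: A_def B_def C_def)
  define E where "E = det D \<cdot>\<^sub>m A - B * adj_mat D * C"
  have \<delta>: "\<delta> = det D" by (simp add: \<delta>_def dm_def D_def)
  have "dmat rs cs = four_block_mat A B C D"
    using len e by (auto simp: dmat_def A_def B_def C_def D_def p_def intro!: eq_matI)
  then have "\<delta> ^ e * dm rs cs = det E * \<delta>"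
    using det_schur[OF ABC D] by (simp add: dm_def \<delta> E_def)
  moreover have "\<delta> * dm (rs ! x # drop e rs) (cs ! y # drop e cs) = E $$ (x, y) * \<delta>" if xy: "x < e" "y < e" for x y
  proof -
    define A' :: "'k mpoly mat" where "A' = mat 1 1 (\<lambda>(i, j). Var (rs ! x, cs ! y))"
    define B' :: "'k mpoly mat" where "B' = mat 1 p (\<lambda>(i, j). Var (rs ! x, cs ! (e + j)))"
    define C' :: "'k mpoly mat" where "C' = mat p 1 (\<lambda>(i, j). Var (rs ! (e + i), cs ! y))"
    have ABC': "A' \<in> carrier_mat 1 1" "B' \<in> carrier_mat 1 p" "C' \<in> carrier_mat p 1"
      by (auto simp: A'_def B'_def C'_def)
    have "dmat (rs ! x # drop e rs) (cs ! y # drop e cs) = four_block_mat A' B' C' D"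
      using len e by (auto simp: dmat_def A'_def B'_def C'_def D_def p_def nth_Cons' intro!: eq_matI)
    then have "\<delta> ^ 1 * dm (rs ! x # drop e rs) (cs ! y # drop e cs) =
        det (det D \<cdot>\<^sub>m A' - B' * adj_mat D * C') * \<delta>"
      using det_schur[OF ABC' D] by (simp add: dm_def \<delta>)
    moreover have "det (det D \<cdot>\<^sub>m A' - B' * adj_mat D * C') = E $$ (x, y)"
    proof -
      have J: "adj_mat D \<in> carrier_mat p p" using adj_mat[OF D] by simp
      have r: "row B x = row B' 0" using xy by (auto simp: B_def B'_def)
      have c: "col C y = col C' 0" using xy by (auto simp: C_def C'_def)
      have "row (B * adj_mat D) x = row (B' * adj_mat D) 0"
        using xy ABC ABC' J r by (intro eq_vecI) auto
      then have "(B * adj_mat D * C) $$ (x, y) = (B' * adj_mat D * C') $$ (0, 0)"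
        using xy ABC ABC' J c by (simp only: index_mult_mat carrier_matD)
      moreover have "det (det D \<cdot>\<^sub>m A' - B' * adj_mat D * C') = (det D \<cdot>\<^sub>m A' - B' * adj_mat D * C') $$ (0, 0)"
        using ABC' J by (intro det_single) auto
      ultimately show ?thesis using xy ABC ABC' J by (simp add: E_def A_def A'_def)
    qed
    ultimately show ?thesis by simp
  qed
  moreover have "E \<in> carrier_mat e e" using ABC D adj_mat(1)[OF D] by (simp add: E_def minus_carrier_mat)
  ultimately show ?thesis by blast
qed


context capped_ladder
begin

text \<open>The ladder condition fills the rectangle, and the bounds \<open>d h\<close> and
  \<open>c h\<close> need checking only at its south-west corner. This is why a chain is measured
  against the cap of its last element.\<close>

lemma sub_rectangle:
  assumes "x \<in> L" "y \<in> sub h" "fst x \<le> p" "p \<le> fst y" "snd y \<le> q" "q \<le> snd x"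
  shows "(p, q) \<in> sub h"
proof -
  have "{fst x..fst y} \<times> {snd y..snd x} \<subseteq> L"
    using ladder[of "fst x" "snd x" "fst y" "snd y"] assms by (auto simp: sub_def)
  then show ?thesis using assms by (auto simp: sub_def)
qed

lemma ladder_poly_sum: "(\<And>i. i \<in> I \<Longrightarrow> ladder_poly L (f i :: 'k mpoly)) \<Longrightarrow> ladder_poly L (\<Sum>i\<in>I. f i)"
  by (induction I rule: infinite_finite_induct) (auto intro: ladder_poly_add)

lemma ladder_poly_dm:
  assumes "length cs = length rs" "set rs \<times> set cs \<subseteq> L"
  shows "ladder_poly L (dm rs cs :: 'k mpoly)"
  unfolding dm_leibniz
proof (rule ladder_poly_sum)
  fix \<pi> assume "\<pi> \<in> {\<pi>. \<pi> permutes {0..<length rs}}"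
  then have \<pi>: "\<pi> i < length rs" if "i < length rs" for i
    using permutes_in_image[of \<pi> _ i] that by auto
  have "supp (\<Sum>i<length rs. sgl (rs ! i, cs ! \<pi> i) (1::nat)) \<subseteq> L"
    using keys_sum[of "\<lambda>i. sgl (rs ! i, cs ! \<pi> i) (1::nat)" "{..<length rs}"] assms \<pi> by fastforce
  then show "ladder_poly L (signof \<pi> * sgl (\<Sum>i<length rs. sgl (rs ! i, cs ! \<pi> i) 1) (1::'k))"
    using signof_pm_one[of \<pi>] by (auto simp: sign_def intro: ladder_poly_single)
qed

lemma det_zero_column:
  fixes A :: "'a::comm_ring_1 mat"
  assumes "A \<in> carrier_mat n n" "q < n" "\<And>p. p < n \<Longrightarrow> A $$ (p, q) = 0"
  shows "det A = 0"
  unfolding det_def'[OF assms(1)]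
proof (rule sum.neutral, rule ballI)
  fix \<pi> assume "\<pi> \<in> {\<pi>. \<pi> permutes {0..<n}}"
  then obtain p where "p \<in> {0..<n}" "\<pi> p = q" using permutes_image[of \<pi> "{0..<n}"] assms(2)
    by (metis atLeastLessThan_iff imageE mem_Collect_eq zero_le)
  then have "(\<Prod>i = 0..<n. A $$ (i, \<pi> i)) = 0"
    using assms(3)[of p] by (intro prod_zero) auto
  then show "signof \<pi> * (\<Prod>i = 0..<n. A $$ (i, \<pi> i)) = 0" by simp
qed

lemma dm_in_V1:
  assumes h: "h \<in> {1..v}" and len: "length rs = t h" "length cs = t h" and sub: "set rs \<times> set cs \<subseteq> sub h"
  shows "dm rs cs \<in> V 1"
proof (rule V1_if_gen0_vanishes)
  show "ladder_poly L (dm rs cs :: 'k mpoly)" using sub len by (intro ladder_poly_dm) (auto simp: sub_def)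
  let ?n = "t h"
  \<comment> \<open>The inner index runs from \<open>0\<close> to \<open>t h - 1\<close> while
    labels start at \<open>1\<close>: column \<open>0\<close> of \<open>A\<close> vanishes, and all
    labels fit because \<open>cap\<close> is less than \<open>t h\<close> on \<open>sub h\<close>.
    Thus the factorisation is square with determinant zero.\<close>
  define A where "A = mat ?n ?n (\<lambda>(p, s). if 1 \<le> s \<and> rowok s h (rs ! p) then sgl (sgl (0, s, rs ! p) 1) 1 :: (par, 'k) poly else 0)"
  define B where "B = mat ?n ?n (\<lambda>(s, q). if colok s h (cs ! q) then sgl (sgl (1, s, cs ! q) 1) 1 :: (par, 'k) poly else 0)"
  have c: "A \<in> carrier_mat ?n ?n" "B \<in> carrier_mat ?n ?n" by (auto simp: A_def B_def)
  have "map_mat (subst gen0) (dmat rs cs) = A * B"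
  proof (rule eq_matI)
    show "dim_row (map_mat (subst gen0) (dmat rs cs)) = dim_row (A * B)"
      "dim_col (map_mat (subst gen0) (dmat rs cs)) = dim_col (A * B)"
      using len by (auto simp: dmat_def A_def B_def)
    fix p q assume "p < dim_row (A * B)" "q < dim_col (A * B)"
    then have pq: "p < ?n" "q < ?n" using c by auto
    then have x: "(rs ! p, cs ! q) \<in> sub h" using sub len by (auto simp: subset_iff)
    have "(A * B) $$ (p, q) = (\<Sum>s<?n. A $$ (p, s) * B $$ (s, q))"
      using c pq by (simp add: scalar_prod_def atLeast0LessThan)
    also have "\<dots> = (\<Sum>s<?n. if s \<in> {1..cap (rs ! p, cs ! q)} then sgl (abm s (rs ! p, cs ! q)) 1 else 0)"
    proof (rule sum.cong)
      fix s assume "s \<in> {..<?n}"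
      then show "A $$ (p, s) * B $$ (s, q) = (if s \<in> {1..cap (rs ! p, cs ! q)} then sgl (abm s (rs ! p, cs ! q)) 1 else 0)"
        using cap_product[OF h x, of s] pq by (auto simp: A_def B_def abm_def mult_single)
    qed simp
    also have "\<dots> = (\<Sum>s\<in>{1..cap (rs ! p, cs ! q)}. sgl (abm s (rs ! p, cs ! q)) 1)"
      using cap_less[OF h x] by (subst sum.inter_restrict[symmetric]) (auto intro!: sum.cong)
    also have "\<dots> = map_mat (subst gen0) (dmat rs cs) $$ (p, q)"
      using pq len by (simp add: dmat_def subst_Var gen0_def)
    finally show "map_mat (subst gen0) (dmat rs cs) $$ (p, q) = (A * B) $$ (p, q)" ..
  qed
  moreover interpret comm_ring_hom "subst gen0" by (rule subst_hom)
  have "subst gen0 (dm rs cs) = det (map_mat (subst gen0) (dmat rs cs))" by (simp add: dm_def)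
  moreover have "det A = 0"
    by (rule det_zero_column[OF c(1), of 0]) (use t_pos[OF h] in \<open>auto simp: A_def\<close>)
  ultimately show "subst gen0 (dm rs cs) = 0" using det_mult[OF c] by simp
qed

end


section \<open>Symbolic powers\<close>

context capped_ladder
begin

lemma ne_irrefl: "\<not> ne x x" and ne_trans: "ne x y \<Longrightarrow> ne y z \<Longrightarrow> ne x z"
  by (auto simp: ne_def)

text \<open>This applies \<open>greene_kleitman_capped\<close> to the multiset of variables in
  \<open>m\<close>. Copies of one variable are incomparable, so no chain repeats a variable; what
  the chains leave over goes into \<open>r\<close>.\<close>

lemma chains_of_monomial:
  assumes m: "supp m \<subseteq> L"
    and bound: "\<And>G s. labelling G s \<Longrightarrow> n \<le> (\<Sum>x\<in>L - G. coef m x)"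
  obtains Cs r where "\<And>C. C \<in> set Cs \<Longrightarrow> C \<noteq> [] \<and> sorted_wrt ne C \<and> set C \<subseteq> L"
    and "supp r \<subseteq> L" "m = r + (\<Sum>C\<leftarrow>Cs. list_mon C)"
    and "n \<le> (\<Sum>C\<leftarrow>Cs. length C - cap (last C))"
proof -
  define P where "P = (SIGMA x:L. {..<coef m x})"
  have finP: "finite P" using finL by (simp add: P_def)
  obtain G' and s' :: "(nat \<times> nat) \<times> nat \<Rightarrow> nat" and Cs' where gk: "G' \<subseteq> P"
    "\<And>x. x \<in> G' \<Longrightarrow> 1 \<le> s' x \<and> s' x \<le> cap (fst x)"
    "\<And>x y. x \<in> G' \<Longrightarrow> y \<in> G' \<Longrightarrow> ne (fst x) (fst y) \<Longrightarrow> s' x < s' y"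
    "distinct (concat Cs')" "set (concat Cs') \<subseteq> P" "[] \<notin> set Cs'"
    "\<And>C. C \<in> set Cs' \<Longrightarrow> sorted_wrt (\<lambda>x y. ne (fst x) (fst y)) C"
    "int (card P) - int (card G') \<le> (\<Sum>C\<leftarrow>Cs'. int (length C) - int (cap (fst (last C))))"
    by (rule greene_kleitman_capped[OF finP, of "\<lambda>x y. ne (fst x) (fst y)" "\<lambda>x. cap (fst x)"])
      (auto intro: ne_trans simp: ne_irrefl)
  define G where "G = fst ` G'"
  \<comment> \<open>Copies of one variable may carry different labels. The least one is kept, and
    growth along \<open>ne\<close> survives because it holds for all pairs of copies.\<close>
  define T where "T x = s' ` {p\<in>G'. fst p = x}" for x
  have finG': "finite G'" using gk(1) finP finite_subset by blast
  have T: "finite (T x)" for x using finG' by (simp add: T_def)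
  have ex: "\<exists>p\<in>G'. fst p = x \<and> s' p = Min (T x)" if "x \<in> G" for x
  proof -
    have "T x \<noteq> {}" using that by (auto simp: G_def T_def)
    then have "Min (T x) \<in> T x" using T by (intro Min_in)
    then show ?thesis by (auto simp: T_def)
  qed
  have lab: "labelling G (\<lambda>x. Min (T x))"
    unfolding labelling_def
  proof (intro conjI ballI impI)
    show "G \<subseteq> L" using gk(1) by (auto simp: G_def P_def)
    show "1 \<le> Min (T x)" "Min (T x) \<le> cap x" if "x \<in> G" for x
      using ex[OF that] gk(2) by (metis)+
    fix x y assume xy: "x \<in> G" "y \<in> G" "ne x y"
    obtain p where p: "p \<in> G'" "fst p = x" "s' p = Min (T x)" using ex[OF xy(1)] by blast
    obtain q where q: "q \<in> G'" "fst q = y" "s' q = Min (T y)" using ex[OF xy(2)] by blast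
    show "Min (T x) < Min (T y)" using gk(3)[OF p(1) q(1)] p q xy(3) by simp
  qed
  have "card G' \<le> card (SIGMA x:G. {..<coef m x})"
  proof (rule card_mono)
    show "finite (SIGMA x:G. {..<coef m x})" using finG' by (simp add: G_def)
    show "G' \<subseteq> (SIGMA x:G. {..<coef m x})"
    proof
      fix p assume "p \<in> G'"
      then have "fst p \<in> G" "p \<in> P" using gk(1) by (auto simp: G_def)
      then show "p \<in> (SIGMA x:G. {..<coef m x})" by (auto simp: P_def)
    qed
  qed
  also have "\<dots> = (\<Sum>x\<in>G. coef m x)" using finG' by (simp add: G_def)
  finally have "card G' \<le> (\<Sum>x\<in>G. coef m x)" .
  moreover have "card P = (\<Sum>x\<in>L - G. coef m x) + (\<Sum>x\<in>G. coef m x)"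
    using finL lab by (simp add: P_def sum.subset_diff[of G L] labelling_def)
  ultimately have "int n \<le> int (card P) - int (card G')" using bound[OF lab] by linarith
  also have "\<dots> \<le> (\<Sum>C\<leftarrow>Cs'. int (length C) - int (cap (fst (last C))))" by (rule gk(8))
  \<comment> \<open>Truncation can only increase the terms; chains no longer than their cap count as
    zero.\<close>
  also have "\<dots> \<le> (\<Sum>C\<leftarrow>Cs'. int (length C - cap (fst (last C))))" by (rule sum_list_mono) auto
  also have "\<dots> = int (\<Sum>C\<leftarrow>Cs'. length C - cap (fst (last C)))" by (induction Cs') auto
  also have "(\<Sum>C\<leftarrow>Cs'. length C - cap (fst (last C))) = (\<Sum>C\<leftarrow>map (map fst) Cs'. length C - cap (last C))"
    using gk(6) by (induction Cs') (auto simp: last_map)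
  finally have n: "n \<le> (\<Sum>C\<leftarrow>map (map fst) Cs'. length C - cap (last C))" by simp
  define q where "q = (\<Sum>C\<leftarrow>map (map fst) Cs'. list_mon C)"
  have "q = (\<Sum>p\<leftarrow>concat Cs'. sgl (fst p) 1)"
    unfolding q_def by (induction Cs') (auto simp: list_mon_def o_def)
  then have q: "q = (\<Sum>p\<in>set (concat Cs'). sgl (fst p) 1)"
    using gk(4) by (simp only: sum_list_distinct_conv_sum_set)
  have le: "coef q x \<le> coef m x" for x
  proof -
    have "coef q x = (\<Sum>p\<in>set (concat Cs'). if fst p = x then 1 else 0)"
      unfolding q lookup_sum lookup_single when_def ..
    also have "\<dots> = card {p\<in>set (concat Cs'). fst p = x}"
      by (simp only: card_eq_sum sum.inter_filter[OF finite_set])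
    also have "\<dots> \<le> card ({x} \<times> {..<coef m x})"
      by (rule card_mono) (use gk(5) in \<open>auto simp: P_def\<close>)
    finally show ?thesis by simp
  qed
  have mq: "m = (m - q) + q"
    by (rule poly_mapping_eqI) (use le in \<open>simp add: lookup_add lookup_minus\<close>)
  have r: "supp (m - q) \<subseteq> L" using m by (auto simp: in_keys_iff lookup_minus)
  have "C \<noteq> [] \<and> sorted_wrt ne C \<and> set C \<subseteq> L" if CC: "C \<in> set (map (map fst) Cs')" for C
  proof -
    obtain C' where C': "C' \<in> set Cs'" "C = map fst C'" using CC by auto
    then have "C' \<noteq> []" using gk(6) by auto
    moreover have "set C' \<subseteq> P" using gk(5) C'(1) by auto
    ultimately show ?thesis using gk(7)[OF C'(1)] C'(2) by (auto simp: sorted_wrt_map P_def)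
  qed
  then show ?thesis using that[of "map (map fst) Cs'" "m - q"] r mq n by (auto simp: q_def)
qed

lemma chain_bounds:
  assumes "sorted_wrt ne C" "x \<in> set C"
  shows "fst (hd C) \<le> fst x" "snd x \<le> snd (hd C)" "fst x \<le> fst (last C)" "snd (last C) \<le> snd x"
proof -
  have "hd C = x \<or> ne (hd C) x" using assms by (cases C) auto
  then show "fst (hd C) \<le> fst x" "snd x \<le> snd (hd C)" by (auto simp: ne_def)
  have "x = last C \<or> ne x (last C)"
    using assms by (cases C rule: rev_cases) (auto simp: sorted_wrt_append)
  then show "fst x \<le> fst (last C)" "snd (last C) \<le> snd x" by (auto simp: ne_def)
qed

lemma chain_rectangle:
  assumes C: "sorted_wrt ne C" "set C \<subseteq> L" "C \<noteq> []" and last: "last C \<in> sub h"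
  shows "fst ` set C \<times> snd ` set C \<subseteq> sub h"
proof safe
  fix a b c d assume x: "(a, b) \<in> set C" and y: "(c, d) \<in> set C"
  show "(fst (a, b), snd (c, d)) \<in> sub h"
    by (rule sub_rectangle[of "hd C" "last C"])
      (use C last chain_bounds[OF C(1) x] chain_bounds[OF C(1) y] in auto)
qed

lemma chain_lists:
  assumes "sorted_wrt ne C"
  shows "sorted_wrt (<) (map fst C)" "sorted_wrt (>) (map snd C)"
  using assms by (auto simp: sorted_wrt_map ne_def elim!: sorted_wrt_mono_rel[rotated])

abbreviation chain_minor :: "(nat \<times> nat) list \<Rightarrow> 'k mpoly" where
  "chain_minor C \<equiv> dm (map fst C) (map snd C)"

lemma chain_minor_lm:
  assumes "sorted_wrt ne C"
  shows "chain_minor C \<noteq> 0" "lm awt (chain_minor C) = list_mon C"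
  using lm_dm[OF chain_lists[OF assms]] by (auto simp: zip_map_fst_snd)

lemma supp_list_mon: "supp (list_mon C) = set C"
  by (auto simp: in_keys_iff coef_list_mon count_list_0_iff)

lemma lm_monomial_mult: "f \<noteq> 0 \<Longrightarrow> lm awt (sgl m 1 * f :: 'k mpoly) = m + lm awt f" "f \<noteq> 0 \<Longrightarrow> sgl m 1 * f \<noteq> (0 :: 'k mpoly)"
proof -
  have "sgl m (1::'k) \<noteq> 0" by (metis lookup_single_eq lookup_zero one_neq_zero)
  then show "f \<noteq> 0 \<Longrightarrow> lm awt (sgl m 1 * f :: 'k mpoly) = m + lm awt f"
    "f \<noteq> 0 \<Longrightarrow> sgl m 1 * f \<noteq> (0 :: 'k mpoly)"
    by (simp_all add: lm_mult)
qed

text \<open>Subtracting a scalar multiple of a comparison element lowers the leading monomial in a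
  well-founded order. The comparison elements lie in \<open>V n\<close> besides \<open>J\<close>, so
  that the remainder stays in \<open>V n\<close>.\<close>

lemma V_reduction:
  assumes zero: "0 \<in> J" and add: "\<And>f g. f \<in> J \<Longrightarrow> g \<in> J \<Longrightarrow> f + g \<in> J"
    and scale: "\<And>a g. g \<in> J \<Longrightarrow> sgl 0 a * g \<in> J"
    and lead: "\<And>f. f \<in> V n \<Longrightarrow> f \<noteq> 0 \<Longrightarrow> \<exists>g\<in>J. g \<in> V n \<and> g \<noteq> 0 \<and> lm awt g = lm awt f"
  shows "V n \<subseteq> J"
proof
  fix f assume "f \<in> V n"
  then show "f \<in> J"
  proof (induction "lm awt f" arbitrary: f rule: wf_induct_rule[OF wf_awt])
    case (1 f)
    show ?case
    proof (cases "f = 0")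
      case False
      then obtain g where g: "g \<in> J" "g \<in> V n" "g \<noteq> 0" "lm awt g = lm awt f" using lead 1(2) by blast
      define a where "a = coef f (lm awt f) / coef g (lm awt g)"
      have "f - sgl 0 a * g = 0 \<or> mkey awt (lm awt (f - sgl 0 a * g)) < mkey awt (lm awt f)"
        unfolding a_def by (rule lm_cancel) (use False g in auto)
      moreover have "f - sgl 0 a * g \<in> V n"
        using 1(2) g by (intro V_diff V_mult_left) auto
      ultimately have "f - sgl 0 a * g \<in> J" using 1(1) zero by auto
      then have "(f - sgl 0 a * g) + sgl 0 a * g \<in> J" using add scale g(1) by blast
      then show ?thesis by simp
    qed (use zero in simp)
  qed
qed

end

text \<open>
  \<open>Pw n\<close> plays the role of the \<open>n\<close>-th power of the ideal and \<open>Q n\<close> that of its symbolic power; that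
  the ideal is the prime ideal \<open>V 1\<close> is a consequence (\<open>Pw_1\<close>).
\<close>

locale ladder_ideal_powers = capped_ladder L v d c t fld
  for L v d c t and fld :: "'k::field itself" +
  fixes Pw :: "nat \<Rightarrow> 'k mpoly set"
  assumes Pw_0: "Pw 0 = {f. ladder_poly L f}"
    and Pw_zero: "0 \<in> Pw n"
    and Pw_add: "f \<in> Pw n \<Longrightarrow> g \<in> Pw n \<Longrightarrow> f + g \<in> Pw n"
    and Pw_mult: "f \<in> Pw a \<Longrightarrow> g \<in> Pw b \<Longrightarrow> f * g \<in> Pw (a + b)"
    and Pw_Suc: "Pw (Suc n) \<subseteq> Pw n"
    and Pw_V: "Pw n \<subseteq> V n"
    and Pw_minors: "\<And>h rs cs. h \<in> {1..v} \<Longrightarrow> sorted_wrt (<) rs \<Longrightarrow> sorted_wrt (>) cs \<Longrightarrow>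
      length rs = t h \<Longrightarrow> length cs = t h \<Longrightarrow> set rs \<times> set cs \<subseteq> sub h \<Longrightarrow> dm rs cs \<in> Pw 1"
begin

section \<open>Powers of the ideal and their saturation at \<open>V 1\<close>\<close>

lemma Pw_scale: "ladder_poly L a \<Longrightarrow> f \<in> Pw n \<Longrightarrow> a * f \<in> Pw n"
  using Pw_mult[of a 0 f n] by (simp add: Pw_0)

lemma Pw_antimono: "m \<le> n \<Longrightarrow> Pw n \<subseteq> Pw m"
  using Pw_Suc lift_Suc_antimono_le by (metis (no_types))

text \<open>The leading monomial of an element of \<open>V 1\<close> contains a chain longer than
  the cap of its last element, and the beginning of this chain spans a generating minor. So
  multiples of generators realise all leading monomials of \<open>V 1\<close>.\<close>

lemma Pw_1: "Pw 1 = V 1"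
proof (rule subset_antisym[OF Pw_V])
  show "V 1 \<subseteq> Pw 1"
  proof (rule V_reduction)
    show "sgl 0 a * g \<in> Pw 1" if "g \<in> Pw 1" for a g using that by (intro Pw_scale) auto
    fix f :: "'k mpoly" assume f: "f \<in> V 1" "f \<noteq> 0"
    have lab: "labelling G s \<Longrightarrow> 1 \<le> (\<Sum>x\<in>L - G. coef (lm awt f) x)" for G s
      using lm_V_bound[OF _ f] by simp
    obtain Cs r where Cs: "\<And>C. C \<in> set Cs \<Longrightarrow> C \<noteq> [] \<and> sorted_wrt ne C \<and> set C \<subseteq> L"
      "supp r \<subseteq> L" "lm awt f = r + (\<Sum>C\<leftarrow>Cs. list_mon C)" "1 \<le> (\<Sum>C\<leftarrow>Cs. length C - cap (last C))"
      using chains_of_monomial[OF ladder_poly_lm[OF V_ladder_poly[OF f(1)] f(2)], of 1] lab by blast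
    have "\<exists>C\<in>set Cs. length C - cap (last C) \<noteq> 0"
    proof (rule ccontr)
      assume "\<not> ?thesis"
      then have "(\<Sum>C\<leftarrow>Cs. length C - cap (last C)) = 0" by (induction Cs) auto
      then show False using Cs(4) by linarith
    qed
    then obtain C where C: "C \<in> set Cs" "cap (last C) < length C" by auto
    then obtain As Bs where AB: "Cs = As @ C # Bs" by (meson split_list)
    have C': "C \<noteq> []" "sorted_wrt ne C" "set C \<subseteq> L" using Cs(1)[OF C(1)] by auto
    then have "last C \<in> L" by auto
    then obtain h where h: "h \<in> {1..v}" "last C \<in> sub h" "t h = Suc (cap (last C))" by (rule cap_attained)
    \<comment> \<open>The first \<open>t h\<close> elements will do: the rectangle of the whole
      chain lies in \<open>sub h\<close> because its last element does.\<close>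
    let ?D = "take (t h) C"
    have D: "sorted_wrt ne ?D" "length ?D = t h" using C' C(2) h(3) by (auto simp: sorted_wrt_take)
    have "set (map fst ?D) \<times> set (map snd ?D) \<subseteq> fst ` set C \<times> snd ` set C"
      using set_take_subset[of "t h" C] unfolding set_map by (intro Sigma_mono image_mono)
    also have "\<dots> \<subseteq> sub h" using C' h by (intro chain_rectangle)
    finally have sub: "set (map fst ?D) \<times> set (map snd ?D) \<subseteq> sub h" .
    have P: "chain_minor ?D \<in> Pw 1"
      by (rule Pw_minors[OF h(1) chain_lists[OF D(1)]]) (use D sub in auto)
    define r' where "r' = r + (\<Sum>C\<leftarrow>As @ Bs. list_mon C) + list_mon (drop (t h) C)"
    have "supp (\<Sum>C\<leftarrow>Ds. list_mon C) \<subseteq> L" if "set Ds \<subseteq> set Cs" for Ds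
      using that Cs(1) by (induction Ds) (auto simp: supp_add_nat supp_list_mon)
    from this[of "As @ Bs"] have r': "supp r' \<subseteq> L"
      unfolding r'_def using Cs(2) C'(3) set_drop_subset[of "t h" C] by (auto simp: supp_add_nat supp_list_mon AB)
    have eq: "lm awt f = r' + list_mon ?D"
    proof -
      have "list_mon C = list_mon ?D + list_mon (drop (t h) C)"
        by (metis append_take_drop_id list_mon_simps(3))
      then show ?thesis unfolding Cs(3) AB r'_def by (simp add: ac_simps)
    qed
    have "sgl r' 1 * chain_minor ?D \<in> Pw 1" using P ladder_poly_single[OF r'] by (intro Pw_scale)
    moreover from this have "sgl r' 1 * chain_minor ?D \<in> V 1" using Pw_V by blast
    ultimately show "\<exists>g\<in>Pw 1. g \<in> V 1 \<and> g \<noteq> 0 \<and> lm awt g = lm awt f"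
      using lm_monomial_mult[OF chain_minor_lm(1)[OF D(1)], of r'] chain_minor_lm(2)[OF D(1)] eq by metis
  qed (auto simp: Pw_zero Pw_add)
qed

definition Q :: "nat \<Rightarrow> 'k mpoly set" where
  "Q n = {f. ladder_poly L f \<and> (\<exists>s. ladder_poly L s \<and> s \<notin> V 1 \<and> s * f \<in> Pw n)}"

lemma Q_I: "ladder_poly L f \<Longrightarrow> ladder_poly L s \<Longrightarrow> s \<notin> V 1 \<Longrightarrow> s * f \<in> Pw n \<Longrightarrow> f \<in> Q n"
  by (auto simp: Q_def)

lemma Q_V: "Q n \<subseteq> V n"
  using V_cancel Pw_V unfolding Q_def by blast

lemma Pw_Q: "Pw n \<subseteq> Q n"
proof
  fix f assume f: "f \<in> Pw n"
  then have "ladder_poly L f" using Pw_V V_ladder_poly by blast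
  then show "f \<in> Q n" by (rule Q_I[where s = 1]) (use f one_notin_V1 in auto)
qed

lemma V1_prime: "ladder_poly L f \<Longrightarrow> ladder_poly L g \<Longrightarrow> f \<notin> V 1 \<Longrightarrow> g \<notin> V 1 \<Longrightarrow> f * g \<notin> V 1"
  using V_cancel by blast

lemma Q_add:
  assumes "f \<in> Q n" "g \<in> Q n"
  shows "f + g \<in> Q n"
proof -
  obtain s s' where s: "ladder_poly L s" "s \<notin> V 1" "s * f \<in> Pw n"
    "ladder_poly L s'" "s' \<notin> V 1" "s' * g \<in> Pw n" using assms by (auto simp: Q_def)
  have "s' * (s * f) + s * (s' * g) \<in> Pw n"
    by (rule Pw_add[OF Pw_scale[OF s(4,3)] Pw_scale[OF s(1,6)]])
  then have "(s * s') * (f + g) \<in> Pw n" by (simp add: algebra_simps)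
  then show ?thesis using assms s V1_prime[OF s(1,4,2,5)] ladder_poly_add[of f g] ladder_poly_mult[of s s']
    unfolding Q_def by blast
qed

lemma Q_mult:
  assumes "f \<in> Q m" "g \<in> Q n"
  shows "f * g \<in> Q (m + n)"
proof -
  obtain s s' where s: "ladder_poly L s" "s \<notin> V 1" "s * f \<in> Pw m"
    "ladder_poly L s'" "s' \<notin> V 1" "s' * g \<in> Pw n" using assms by (auto simp: Q_def)
  have "(s * f) * (s' * g) \<in> Pw (m + n)" using s by (intro Pw_mult)
  then have "(s * s') * (f * g) \<in> Pw (m + n)" by (simp add: algebra_simps)
  then show ?thesis using assms s V1_prime[OF s(1,4,2,5)] ladder_poly_mult[of f g] ladder_poly_mult[of s s']
    unfolding Q_def by blast
qed

lemma Q_0: "Q 0 = {f. ladder_poly L f}"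
  using Pw_Q[of 0] by (auto simp: Q_def Pw_0)

lemma Q_scale: "ladder_poly L a \<Longrightarrow> f \<in> Q n \<Longrightarrow> a * f \<in> Q n"
  using Q_mult[of a 0 f n] by (simp add: Q_0)

lemma Q_antimono: "m \<le> n \<Longrightarrow> Q n \<subseteq> Q m"
  using Pw_antimono unfolding Q_def by blast

lemma det_in_Pw:
  assumes "E \<in> carrier_mat e e" "\<And>x y. x < e \<Longrightarrow> y < e \<Longrightarrow> E $$ (x, y) \<in> Pw 1"
  shows "det E \<in> Pw e"
proof -
  have prod: "(\<Prod>i<k. g i) \<in> Pw k" if "\<And>i. i < k \<Longrightarrow> g i \<in> Pw 1" for g k
    using that
  proof (induction k)
    case (Suc k)
    then show ?case using Pw_mult[of "\<Prod>i<k. g i" k "g k" 1] by simp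
  qed (simp add: Pw_0)
  have sum: "(\<Sum>i\<in>I. g i) \<in> Pw e" if "\<And>i. i \<in> I \<Longrightarrow> g i \<in> Pw e" for g :: "(nat \<Rightarrow> nat) \<Rightarrow> 'k mpoly" and I
    using that by (induction I rule: infinite_finite_induct) (auto simp: Pw_zero intro: Pw_add)
  show ?thesis
    unfolding det_def'[OF assms(1)]
  proof (rule sum)
    fix \<pi> assume "\<pi> \<in> {\<pi>. \<pi> permutes {0..<e}}"
    then have "\<pi> i < e" if "i < e" for i using permutes_in_image[of \<pi> _ i] that by auto
    then have "(\<Prod>i = 0..<e. E $$ (i, \<pi> i)) \<in> Pw e"
      unfolding atLeast0LessThan using assms(2) by (intro prod) auto
    moreover have "ladder_poly L (signof \<pi> :: 'k mpoly)" by (simp add: sign_def)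
    ultimately show "signof \<pi> * (\<Prod>i = 0..<e. E $$ (i, \<pi> i)) \<in> Pw e" by (rule Pw_scale[rotated])
  qed
qed

text \<open>
  Cutting the chain at the position that maximises \<open>i - cap\<close> makes its last \<open>cap\<close> elements
  admissible, so that the corresponding minor can serve as pivot.
\<close>

lemma chain_in_Q:
  assumes C: "C \<noteq> []" "sorted_wrt ne C" "set C \<subseteq> L"
  shows "\<exists>f\<in>Q (length C - cap (last C)). f \<noteq> 0 \<and> lm awt f = list_mon C"
proof (cases "length C \<le> cap (last C)")
  case True
  have "sgl (list_mon C) 1 \<in> Q 0"
    using C(3) by (auto simp: Q_0 supp_list_mon intro!: ladder_poly_single)
  moreover have "sgl (list_mon C) (1::'k) \<noteq> 0" by (metis lookup_single_eq lookup_zero one_neq_zero)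
  ultimately show ?thesis using True by (intro bexI[of _ "sgl (list_mon C) 1"]) auto
next
  case False
  define K where "K i = int (Suc i) - int (cap (C ! i))" for i
  have "Max (K ` {..<length C}) \<in> K ` {..<length C}" using C(1) by (intro Max_in) auto
  then obtain i where i: "i < length C" "Max (K ` {..<length C}) = K i" by auto
  have Kmax: "K j \<le> K i" if "j < length C" for j
    using that by (simp flip: i(2))
  \<comment> \<open>The pivot keeps the last \<open>\<kappa>\<close> elements of the cut chain, so
    the bordered minors have size \<open>\<kappa> + 1\<close>, the size of the generators available
    at \<open>C ! i\<close>. The remaining \<open>e\<close> elements give the order to be
    reached.\<close>
  define \<kappa> where "\<kappa> = cap (C ! i)"
  define e where "e = Suc i - \<kappa>"
  have "int (length C) - int (cap (last C)) = K (length C - 1)"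
    using C(1) by (simp add: K_def last_conv_nth)
  also have "\<dots> \<le> K i" using C(1) by (intro Kmax) simp
  finally have Ki: "int (length C) - int (cap (last C)) \<le> K i" .
  then have \<kappa>: "\<kappa> < Suc i" and e: "length C - cap (last C) \<le> e" and e\<kappa>: "e + \<kappa> = Suc i"
    using False by (auto simp: K_def \<kappa>_def e_def)
  define B where "B = take (Suc i) C"
  define D where "D = drop e B"
  have lenB: "length B = Suc i" using i(1) by (simp add: B_def)
  have lenD: "length D = \<kappa>" using e\<kappa> lenB by (simp add: D_def)
  have B: "sorted_wrt ne B" "set B \<subseteq> L" "B \<noteq> []"
    using C sorted_wrt_take[OF C(2)] set_take_subset[of "Suc i" C] by (auto simp: B_def)
  have lastB: "last B = C ! i" using i(1) by (simp add: B_def take_Suc_conv_app_nth)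
  have D: "sorted_wrt ne D" "set D \<subseteq> set B"
    using B(1) by (auto simp: D_def sorted_wrt_drop dest: in_set_dropD)
  obtain h where h: "h \<in> {1..v}" "C ! i \<in> sub h" "t h = Suc \<kappa>"
    using cap_attained[of "C ! i"] C(3) i(1) \<kappa>_def by (metis nth_mem subsetD)
  have rect: "fst ` set B \<times> snd ` set B \<subseteq> sub h"
    using B h lastB by (intro chain_rectangle) auto
  define \<delta> where "\<delta> = chain_minor D"
  have lp: "ladder_poly L (chain_minor F)" if "set F \<subseteq> set B" for F
  proof (rule ladder_poly_dm)
    have "set (map fst F) \<times> set (map snd F) \<subseteq> fst ` set B \<times> snd ` set B"
      unfolding set_map using that by (intro Sigma_mono image_mono)
    also have "\<dots> \<subseteq> L" using rect by (auto simp: sub_def)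
    finally show "set (map fst F) \<times> set (map snd F) \<subseteq> L" .
  qed simp
  have \<delta>0: "\<delta> \<noteq> 0" using chain_minor_lm(1)[OF D(1)] by (simp add: \<delta>_def)
  \<comment> \<open>On a chain this label is the position counted from one; it stays within the cap
    because \<open>K\<close> is maximal at \<open>i\<close>.\<close>
  have "labelling (set D) (\<lambda>x. Suc (card {y\<in>set D. ne y x}))"
    unfolding labelling_def
  proof (intro conjI ballI impI)
    show "set D \<subseteq> L" using D(2) B(2) by blast
    fix x assume x: "x \<in> set D"
    then obtain j where j: "j < length D" "x = D ! j" by (metis in_set_conv_nth)
    have "{y\<in>set D. ne y x} \<subseteq> set (take j D)"
    proof
      fix y assume y: "y \<in> {y\<in>set D. ne y x}"
      then obtain k where k: "k < length D" "y = D ! k" by (metis (lifting) in_set_conv_nth mem_Collect_eq)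
      have "k < j"
      proof (rule ccontr)
        assume "\<not> k < j"
        then have "x = y \<or> ne x y" using sorted_wrt_nth_less[OF D(1), of j k] j k by (cases "j = k") auto
        then show False using y by (auto simp: ne_def)
      qed
      then show "y \<in> set (take j D)" using k j(1) by (auto simp: in_set_conv_nth intro!: exI[of _ k])
    qed
    then have "card {y\<in>set D. ne y x} \<le> card (set (take j D))" by (intro card_mono) auto
    also have "\<dots> \<le> j" using card_length[of "take j D"] by simp
    finally have "Suc (card {y\<in>set D. ne y x}) \<le> Suc j" by simp
    also have "Suc j \<le> cap x"
    proof -
      have "e + j < Suc i" using j(1) lenD e\<kappa> by simp
      then have "x = C ! (e + j)" "e + j < length C" using j i(1) lenB by (auto simp: D_def B_def)
      then have "int (Suc (e + j)) - int (cap x) \<le> int (Suc i) - int \<kappa>"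
        using Kmax[of "e + j"] by (simp add: K_def \<kappa>_def)
      then show ?thesis using e\<kappa> by linarith
    qed
    finally show "Suc (card {y\<in>set D. ne y x}) \<le> cap x" .
  next
    fix x y assume xy: "x \<in> set D" "y \<in> set D" "ne x y"
    have "{z\<in>set D. ne z x} \<subset> {z\<in>set D. ne z y}"
      using xy by (auto simp: ne_def)
    then have "card {z\<in>set D. ne z x} < card {z\<in>set D. ne z y}" by (intro psubset_card_mono) auto
    then show "Suc (card {z\<in>set D. ne z x}) < Suc (card {z\<in>set D. ne z y})" by simp
  qed simp
  \<comment> \<open>The leading monomial of \<open>\<delta>\<close> has no variable off
    \<open>set D\<close>, so positive order is impossible.\<close>
  from lm_V_bound[OF this, of \<delta> 1] have \<delta>V: "\<delta> \<notin> V 1"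
    using \<delta>0 chain_minor_lm(2)[OF D(1)]
    by (auto simp: \<delta>_def coef_list_mon count_list_0_iff)
  have \<delta>L: "ladder_poly L \<delta>" unfolding \<delta>_def by (rule lp[OF D(2)])
  have \<delta>': "\<delta> = dm (drop e (map fst B)) (drop e (map snd B))" by (simp add: \<delta>_def D_def drop_map)
  have "length (map snd B) = length (map fst B)" "e \<le> length (map fst B)" using e\<kappa> lenB by auto
  from dm_bordered[OF this, where 'k = 'k, folded \<delta>'] obtain E :: "'k mpoly mat"
    where E: "E \<in> carrier_mat e e" "\<delta> ^ e * chain_minor B = det E * \<delta>"
      "\<And>x y. x < e \<Longrightarrow> y < e \<Longrightarrow> \<delta> * dm (map fst B ! x # drop e (map fst B)) (map snd B ! y # drop e (map snd B)) = E $$ (x, y) * \<delta>"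
    by blast
  have "E $$ (x, y) \<in> Pw 1" if xy: "x < e" "y < e" for x y
  proof -
    have xyB: "x < length B" "y < length B" using xy e\<kappa> lenB by auto
    let ?rs = "map fst B ! x # drop e (map fst B)" and ?cs = "map snd B ! y # drop e (map snd B)"
    have EE: "E $$ (x, y) = dm ?rs ?cs" using E(3)[OF xy] \<delta>0 by (simp add: mult.commute)
    show ?thesis
      unfolding EE
    proof (rule Pw_minors[OF h(1)])
      have ne: "ne (B ! z) b" if "z < e" "b \<in> set (drop e B)" for z b
      proof -
        obtain j where "j < length B - e" "b = B ! (e + j)" using \<open>b \<in> set (drop e B)\<close>
          by (auto simp: in_set_conv_nth)
        then show ?thesis using sorted_wrt_nth_less[OF B(1), of z "e + j"] \<open>z < e\<close> by simp
      qed
      have "sorted_wrt (<) (map fst (B ! x # drop e B))" "sorted_wrt (>) (map snd (B ! y # drop e B))"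
        by (rule chain_lists; use ne xy B(1) in \<open>auto simp: sorted_wrt_drop\<close>)+
      then show "sorted_wrt (<) ?rs" "sorted_wrt (>) ?cs" using xyB by (simp_all add: drop_map)
      show "length ?rs = t h" "length ?cs = t h" using lenB e\<kappa> h(3) by auto
      have "set ?rs \<subseteq> fst ` set B" "set ?cs \<subseteq> snd ` set B"
        using xyB set_drop_subset[of e B] by (auto simp: drop_map)
      then show "set ?rs \<times> set ?cs \<subseteq> sub h" using rect by blast
    qed
  qed
  then have "det E \<in> Pw e" by (rule det_in_Pw[OF E(1)])
  \<comment> \<open>The power of \<open>\<delta>\<close> is a multiplier outside the prime
    \<open>V 1\<close>, just what \<open>Q\<close> asks for.\<close>
  then have "\<delta> ^ e * chain_minor B \<in> Pw e" unfolding E(2) mult.commute[of "det E"] by (rule Pw_scale[OF \<delta>L])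
  moreover have "ladder_poly L (\<delta> ^ j) \<and> \<delta> ^ j \<notin> V 1" for j
    by (induction j) (auto simp: one_notin_V1 ladder_poly_mult \<delta>L V1_prime \<delta>V simp del: One_nat_def)
  ultimately have "chain_minor B \<in> Q e" using lp[of B] by (intro Q_I[of _ "\<delta> ^ e"]) auto
  moreover have "ladder_poly L (sgl (list_mon (drop (Suc i) C)) (1::'k))"
    using C(3) set_drop_subset[of "Suc i" C] by (intro ladder_poly_single) (auto simp: supp_list_mon)
  ultimately have "sgl (list_mon (drop (Suc i) C)) 1 * chain_minor B \<in> Q e" by (rule Q_scale[rotated])
  moreover have "list_mon (drop (Suc i) C) + list_mon B = list_mon C"
    unfolding B_def by (metis append_take_drop_id list_mon_simps(3) add.commute)
  ultimately show ?thesis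
    using lm_monomial_mult[OF chain_minor_lm(1)[OF B(1)], of "list_mon (drop (Suc i) C)"]
      chain_minor_lm(2)[OF B(1)] Q_antimono[OF e]
    by (intro bexI[of _ "sgl (list_mon (drop (Suc i) C)) 1 * chain_minor B"]) auto
qed

text \<open>The converse of \<open>lm_V_bound\<close>: each chain of the monomial contributes a
  factor, and the orders of the factors add up to at least \<open>n\<close>.\<close>

lemma ex_Q_with_lm:
  assumes m: "supp m \<subseteq> L" and bound: "\<And>G s. labelling G s \<Longrightarrow> n \<le> (\<Sum>x\<in>L - G. coef m x)"
  shows "\<exists>f\<in>Q n. f \<noteq> 0 \<and> lm awt f = m"
proof -
  obtain Cs r where Cs: "\<And>C. C \<in> set Cs \<Longrightarrow> C \<noteq> [] \<and> sorted_wrt ne C \<and> set C \<subseteq> L"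
    "supp r \<subseteq> L" "m = r + (\<Sum>C\<leftarrow>Cs. list_mon C)" "n \<le> (\<Sum>C\<leftarrow>Cs. length C - cap (last C))"
    using chains_of_monomial[OF m, of n] bound by blast
  have "\<exists>f\<in>Q (\<Sum>C\<leftarrow>Cs. length C - cap (last C)). f \<noteq> 0 \<and> lm awt f = (\<Sum>C\<leftarrow>Cs. list_mon C)"
    using Cs(1)
  proof (induction Cs)
    case Nil
    have "(1::'k mpoly) = sgl 0 1" by simp
    then have "lm awt (1::'k mpoly) = 0" by (metis lm_single one_neq_zero)
    then show ?case by (intro bexI[of _ 1]) (auto simp: Q_0)
  next
    case (Cons C Cs)
    obtain f where f: "f \<in> Q (\<Sum>C\<leftarrow>Cs. length C - cap (last C))" "f \<noteq> 0" "lm awt f = (\<Sum>C\<leftarrow>Cs. list_mon C)"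
      using Cons by auto
    obtain g where g: "g \<in> Q (length C - cap (last C))" "g \<noteq> 0" "lm awt g = list_mon C"
      using chain_in_Q[of C] Cons.prems by auto
    show ?case using Q_mult[OF g(1) f(1)] lm_mult(1)[OF g(2) f(2), of awt] f g
      by (intro bexI[of _ "g * f"]) auto
  qed
  then obtain f where f: "f \<in> Q n" "f \<noteq> 0" "lm awt f = (\<Sum>C\<leftarrow>Cs. list_mon C)"
    using Q_antimono[OF Cs(4)] by blast
  then show ?thesis
    using lm_monomial_mult[OF f(2), of r] Q_scale[OF ladder_poly_single[OF Cs(2)] f(1), of 1] Cs(3)
    by (intro bexI[of _ "sgl r 1 * f"]) auto
qed

lemma Q_eq_V: "Q n = V n"
proof (rule subset_antisym[OF Q_V])
  show "V n \<subseteq> Q n"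
  proof (rule V_reduction)
    show "0 \<in> Q n" using Pw_Q Pw_zero by blast
    fix f :: "'k mpoly" assume f: "f \<in> V n" "f \<noteq> 0"
    have "\<exists>g\<in>Q n. g \<noteq> 0 \<and> lm awt g = lm awt f"
      by (rule ex_Q_with_lm[OF ladder_poly_lm[OF V_ladder_poly[OF f(1)] f(2)] lm_V_bound[OF _ f]])
    then show "\<exists>g\<in>Q n. g \<in> V n \<and> g \<noteq> 0 \<and> lm awt g = lm awt f" using Q_V by blast
  qed (auto intro: Q_add Q_scale)
qed

end


subsection \<open>The ideal of a mixed ladder\<close>

lemma ladder_ring_simps [simp]:
  "carrier (ladder_ring L) = {f :: 'k::field mpoly. ladder_poly L f}"
  "monoid.mult (ladder_ring L) = ((*) :: 'k mpoly \<Rightarrow> _)" "monoid.one (ladder_ring L) = (1 :: 'k mpoly)"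
  "ring.zero (ladder_ring L) = (0 :: 'k mpoly)" "ring.add (ladder_ring L) = ((+) :: 'k mpoly \<Rightarrow> _)"
  by (auto simp: ladder_ring_def ladder_poly_def)

text \<open>Ideals form a semiring without negatives, so the sum is handled through its universal
  property as the least ideal above the summands.\<close>

lemma (in cring) finsum_ideals:
  assumes "finite A" "\<And>a. a \<in> A \<Longrightarrow> ideal (F a) R"
  shows "ideal (finsum (ideals_set R) F A) R \<and> (\<forall>a\<in>A. F a \<subseteq> finsum (ideals_set R) F A) \<and>
    (\<forall>J. ideal J R \<longrightarrow> (\<forall>a\<in>A. F a \<subseteq> J) \<longrightarrow> finsum (ideals_set R) F A \<subseteq> J)"
  using assms
proof (induction A rule: finite_induct)
  interpret S: semiring "ideals_set R" by (rule ideals_set_is_semiring)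
  case empty
  have "\<zero> \<in> J" if "ideal J R" for J
    using that by (simp add: additive_subgroup.zero_closed ideal.axioms(1))
  then show ?case by (auto simp: zeroideal) (auto simp: ideals_set_def zeroideal)
next
  interpret S: semiring "ideals_set R" by (rule ideals_set_is_semiring)
  case (insert x A)
  let ?S = "finsum (ideals_set R) F A"
  have IH: "ideal ?S R" "\<And>a. a \<in> A \<Longrightarrow> F a \<subseteq> ?S"
    "\<And>J. ideal J R \<Longrightarrow> (\<And>a. a \<in> A \<Longrightarrow> F a \<subseteq> J) \<Longrightarrow> ?S \<subseteq> J"
    using insert by auto
  have x: "ideal (F x) R" using insert by auto
  have "finsum (ideals_set R) F (insert x A) = F x \<oplus>\<^bsub>ideals_set R\<^esub> ?S"
    by (rule S.finsum_insert) (use insert in \<open>auto simp: ideals_set_def\<close>)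
  then have eq: "finsum (ideals_set R) F (insert x A) = F x <+>\<^bsub>R\<^esub> ?S" by (simp add: ideals_set_def)
  have sub: "F x \<subseteq> F x <+>\<^bsub>R\<^esub> ?S" "?S \<subseteq> F x <+>\<^bsub>R\<^esub> ?S"
    using union_genideal[OF x IH(1)] genideal_self[of "F x \<union> ?S"]
      ideal.Icarr[OF x] ideal.Icarr[OF IH(1)] by blast+
  have "F x <+>\<^bsub>R\<^esub> ?S \<subseteq> J" if J: "ideal J R" "\<And>a. a \<in> insert x A \<Longrightarrow> F a \<subseteq> J" for J
    using genideal_minimal[OF J(1), of "F x \<union> ?S"] IH(3)[OF J(1)] J(2) union_genideal[OF x IH(1)] by auto
  then show ?case unfolding eq using add_ideals[OF x IH(1)] sub IH(2) by blast
qed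

context capped_ladder
begin

abbreviation R :: "'k mpoly ring" where "R \<equiv> ladder_ring L"

section \<open>The ladder ring, its ideals and the associated prime\<close>

lemma cring_R: "cring R"
proof (rule cringI)
  show "abelian_group R"
  proof (rule abelian_groupI)
    fix f assume "f \<in> carrier R"
    then show "\<exists>g\<in>carrier R. g \<oplus>\<^bsub>R\<^esub> f = \<zero>\<^bsub>R\<^esub>" by (intro bexI[of _ "- f"]) auto
  qed (auto simp: ladder_poly_add ac_simps)
  show "comm_monoid R"
    by (rule comm_monoidI) (auto simp: ladder_poly_mult ac_simps)
qed (auto simp: algebra_simps)

lemma idealD:
  assumes "ideal J R"
  shows "f \<in> J \<Longrightarrow> ladder_poly L f" "0 \<in> J" "f \<in> J \<Longrightarrow> g \<in> J \<Longrightarrow> f + g \<in> J"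
    "ladder_poly L a \<Longrightarrow> f \<in> J \<Longrightarrow> a * f \<in> J"
  using ideal.Icarr[OF assms, of f] additive_subgroup.zero_closed[OF ideal.axioms(1)[OF assms]]
    additive_subgroup.a_closed[OF ideal.axioms(1)[OF assms], of f g] ideal.I_l_closed[OF assms, of f a]
  by auto

lemma ideal_RI:
  assumes "\<And>f. f \<in> J \<Longrightarrow> ladder_poly L f" "0 \<in> J" "\<And>f g. f \<in> J \<Longrightarrow> g \<in> J \<Longrightarrow> f + g \<in> J"
    "\<And>a f. ladder_poly L a \<Longrightarrow> f \<in> J \<Longrightarrow> a * f \<in> J"
  shows "ideal J R"
proof (rule idealI)
  interpret cring R by (rule cring_R)
  show "ring R" by (rule ring_axioms)
  show "subgroup J (add_monoid R)"
  proof (rule add.subgroupI)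
    fix f assume f: "f \<in> J"
    have "- 1 * f \<in> J" using f by (intro assms(4)) auto
    moreover have "\<ominus>\<^bsub>R\<^esub> f = - f"
      using assms(1)[OF f] by (intro minus_equality) auto
    ultimately show "\<ominus>\<^bsub>R\<^esub> f \<in> J" by simp
  qed (use assms in auto)
  show "x \<otimes>\<^bsub>R\<^esub> a \<in> J" "a \<otimes>\<^bsub>R\<^esub> x \<in> J" if "a \<in> J" "x \<in> carrier R" for a x
    using assms(4)[of x a] that by (auto simp: mult.commute)
qed

lemma ideal_V: "ideal (V n) R"
  by (rule ideal_RI) (auto simp: V_ladder_poly V_add V_mult_left)

lemma V1_primeideal: "primeideal (V 1) R"
proof (rule primeidealI)
  show "ideal (V 1) R" by (rule ideal_V)
  show "cring R" by (rule cring_R)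
  have "1 \<in> carrier R" by simp
  then show "carrier R \<noteq> V 1" using one_notin_V1 by blast
  show "f \<in> V 1 \<or> g \<in> V 1" if "f \<in> carrier R" "g \<in> carrier R" "f \<otimes>\<^bsub>R\<^esub> g \<in> V 1" for f g
    using V_cancel[of f g 1] that unfolding ladder_ring_simps by blast
qed

text \<open>The quotient by a prime is a domain, where every nonzero element has annihilator
  zero.\<close>

lemma associated_primes_V1: "associated_primes R (V 1) = {V 1}"
proof
  show "associated_primes R (V 1) \<subseteq> {V 1}"
  proof
    fix P assume "P \<in> associated_primes R (V 1)"
    then obtain a where P: "primeideal P R" "ladder_poly L a" "P = {r. ladder_poly L r \<and> r * a \<in> V 1}"
      unfolding associated_primes_def ladder_ring_simps by blast
    have "a \<notin> V 1"
    proof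
      assume "a \<in> V 1"
      then have "P = carrier R" using P(3) V_mult_left unfolding ladder_ring_simps by blast
      then show False using primeideal.I_notcarr[OF P(1)] by simp
    qed
    then have "r * a \<in> V 1 \<longleftrightarrow> r \<in> V 1" if "ladder_poly L r" for r
      using V_cancel[of r a 1] P(2) that V_mult_left[of a r 1] by (auto simp: mult.commute simp del: One_nat_def)
    then show "P \<in> {V 1}" using P(3) V_ladder_poly by blast
  qed
  show "{V 1} \<subseteq> associated_primes R (V 1)"
  proof -
    have "V 1 = {r \<in> carrier R. r \<otimes>\<^bsub>R\<^esub> 1 \<in> V 1}" using V_ladder_poly by auto
    moreover have "1 \<in> carrier R" by simp
    ultimately show ?thesis using V1_primeideal unfolding associated_primes_def by blast
  qed
qed

lemma dm_conv_minor:
  assumes "sorted_wrt (<) rs" "sorted_wrt (>) cs" "length cs = length rs"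
  shows "\<exists>\<epsilon>\<in>{1, - 1}. (dm rs cs :: 'k mpoly) = \<epsilon> * minor (set rs) (set cs)"
proof -
  have d: "distinct rs" "distinct cs"
    using assms by (auto simp: strict_sorted_iff) (metis distinct_rev sorted_wrt_rev strict_sorted_iff)
  have rs: "sorted_list_of_set (set rs) = rs"
    using assms(1) by (intro sorted_list_of_set.idem_if_sorted_distinct) (auto simp: strict_sorted_iff)
  have "sorted_wrt (<) (rev cs)" using assms(2) by (simp add: sorted_wrt_rev)
  then have cs: "sorted_list_of_set (set cs) = rev cs"
    using sorted_list_of_set.idem_if_sorted_distinct[of "rev cs"] by (simp add: strict_sorted_iff)
  have "\<exists>\<epsilon>\<in>{1, - 1}. minor (set rs) (set cs) = \<epsilon> * (dm rs cs :: 'k mpoly)"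
    using minor_conv_dm[of "set rs" "set cs"] d assms(3) unfolding rs cs by (simp add: distinct_card)
  then obtain \<epsilon> where e: "\<epsilon> \<in> {1, - 1}" "minor (set rs) (set cs) = \<epsilon> * (dm rs cs :: 'k mpoly)"
    by blast
  then show ?thesis by (intro bexI[of _ \<epsilon>]) auto
qed

lemma minor_in_V1:
  assumes h: "h \<in> {1..v}" and AB: "rows_cols_in (t h) (sub h) A B"
  shows "minor A B \<in> V 1"
proof -
  have *: "finite A" "finite B" "card A = t h" "card B = t h" "A \<times> B \<subseteq> sub h"
    using AB by (auto simp: rows_cols_in_def)
  then obtain \<epsilon> where e: "\<epsilon> \<in> {1, - 1}"
    "minor A B = \<epsilon> * (dm (sorted_list_of_set A) (rev (sorted_list_of_set B)) :: 'k mpoly)"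
    using minor_conv_dm[of A B] by metis
  have "dm (sorted_list_of_set A) (rev (sorted_list_of_set B)) \<in> V 1"
    by (rule dm_in_V1[OF h]) (use * in auto)
  moreover have "ladder_poly L \<epsilon>" using e(1) by auto
  ultimately show ?thesis unfolding e(2) by (rule V_mult_left[rotated])
qed

lemma minors_in_R: "h \<in> {1..v} \<Longrightarrow> {minor A B | A B. rows_cols_in (t h) (sub h) A B} \<subseteq> carrier R"
  using minor_in_V1 V_ladder_poly unfolding ladder_ring_simps by blast

definition IL :: "'k mpoly set" where
  "IL = (\<Oplus>\<^bsub>ideals_set R\<^esub>h\<in>{1..v}. minors_ideal L (t h) (sub h))"

lemma ideal_IL: "ideal IL R" and IL_V1: "IL \<subseteq> V 1"
  and minor_in_IL: "h \<in> {1..v} \<Longrightarrow> rows_cols_in (t h) (sub h) A B \<Longrightarrow> minor A B \<in> IL"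
proof -
  interpret cring R by (rule cring_R)
  let ?G = "\<lambda>h. {minor A B | A B. rows_cols_in (t h) (sub h) A B} :: 'k mpoly set"
  have id: "ideal (minors_ideal L (t h) (sub h)) R" if "h \<in> {1..v}" for h
    unfolding minors_ideal_def by (rule genideal_ideal[OF minors_in_R[OF that]])
  have fs: "ideal IL R" "\<And>h. h \<in> {1..v} \<Longrightarrow> minors_ideal L (t h) (sub h) \<subseteq> IL"
    "\<And>J. ideal J R \<Longrightarrow> (\<And>h. h \<in> {1..v} \<Longrightarrow> minors_ideal L (t h) (sub h) \<subseteq> J) \<Longrightarrow> IL \<subseteq> J"
    using finsum_ideals[of "{1..v}" "\<lambda>h. minors_ideal L (t h) (sub h)", folded IL_def] id by auto
  have "minors_ideal L (t h) (sub h) \<subseteq> V 1" if "h \<in> {1..v}" for h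
    unfolding minors_ideal_def
  proof (rule genideal_minimal[OF ideal_V])
    show "{minor A B |A B. rows_cols_in (t h) (sub h) A B} \<subseteq> V 1"
      by (rule subsetI, elim CollectE exE conjE) (simp only: minor_in_V1[OF that])
  qed
  then show "ideal IL R" "IL \<subseteq> V 1" using fs(1) fs(3)[OF ideal_V] by auto
  assume h: "h \<in> {1..v}" "rows_cols_in (t h) (sub h) A B"
  have "(minor A B :: 'k mpoly) \<in> minors_ideal L (t h) (sub h)"
    unfolding minors_ideal_def
    by (rule subsetD[OF genideal_self[OF minors_in_R[OF h(1)]]]) (use h(2) in blast)
  then show "minor A B \<in> IL" using fs(2)[OF h(1)] by blast
qed

abbreviation IPow :: "nat \<Rightarrow> 'k mpoly set" where
  "IPow n \<equiv> IL [^]\<^bsub>ideals_set R\<^esub> n"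

lemma ladder_ideal_powers_IL: "ladder_ideal_powers L v d c t IPow"
proof -
  interpret cring R by (rule cring_R)
  interpret S: semiring "ideals_set R" by (rule ideals_set_is_semiring)
  have IS: "IL \<in> carrier (ideals_set R)" using ideal_IL by (simp add: ideals_set_def)
  have idp: "ideal (IPow n) R" for n
    using S.nat_pow_closed[OF IS, of n] by (simp add: ideals_set_def)
  have mult: "A \<otimes>\<^bsub>ideals_set R\<^esub> B = ideal_prod R A B" for A B by (simp add: ideals_set_def)
  have Suc: "IPow (Suc n) = ideal_prod R (IPow n) IL" for n by (simp add: mult)
  have one: "IPow 1 = IL" using S.nat_pow_eone[OF IS] by simp
  show ?thesis
  proof unfold_locales
    show "IPow 0 = {f. ladder_poly L f}" by (simp add: ideals_set_def)
    show "0 \<in> IPow n" for n by (rule idealD(2)[OF idp])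
    show "f \<in> IPow n \<Longrightarrow> g \<in> IPow n \<Longrightarrow> f + g \<in> IPow n" for f g n by (rule idealD(3)[OF idp])
    show "f * g \<in> IPow (m + n)" if "f \<in> IPow m" "g \<in> IPow n" for f g m n
      using ideal_prod.prod[OF that, of R] S.nat_pow_mult[OF IS, of m n] by (simp add: mult)
    show "IPow (Suc n) \<subseteq> IPow n" for n
      unfolding Suc using ideal_prod_inter[OF idp ideal_IL, of n] by blast
    show "IPow n \<subseteq> V n" for n
    proof (induction n)
      case 0
      then show ?case by (simp add: ideals_set_def V_0)
    next
      case (Suc n)
      show ?case
      proof
        fix f assume "f \<in> IPow (Suc n)"
        then have "f \<in> ideal_prod R (IPow n) IL" by (simp only: \<open>IPow (Suc n) = ideal_prod R (IPow n) IL\<close>)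
        then show "f \<in> V (Suc n)"
        proof (induction f rule: ideal_prod.induct)
          case (prod i j)
          then show ?case using V_mult[of i n j 1] Suc IL_V1 by auto
        next
          case (sum f g)
          then show ?case using V_add by auto
        qed
      qed
    qed
    show "dm rs cs \<in> IPow 1" if "h \<in> {1..v}" "sorted_wrt (<) rs" "sorted_wrt (>) cs"
      "length rs = t h" "length cs = t h" "set rs \<times> set cs \<subseteq> sub h" for h rs cs
    proof -
      have "length cs = length rs" using that by simp
      from dm_conv_minor[OF that(2,3) this] obtain \<epsilon>
        where e: "\<epsilon> \<in> {1, - 1}" "(dm rs cs :: 'k mpoly) = \<epsilon> * minor (set rs) (set cs)" by blast
      have "distinct rs" "distinct cs" using that(2,3)
        by (auto simp: strict_sorted_iff) (metis distinct_rev sorted_wrt_rev strict_sorted_iff)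
      then have "minor (set rs) (set cs) \<in> IL"
        using that by (intro minor_in_IL[OF that(1)]) (auto simp: rows_cols_in_def distinct_card)
      then show ?thesis unfolding one e(2) using e(1) by (intro idealD(4)[OF ideal_IL]) auto
    qed
  qed
qed

text \<open>\<open>Pw_1\<close> identifies the ideal with \<open>V 1\<close>; so the only
  localisation involved is the one at \<open>V 1\<close>, and the definition unfolds to
  \<open>Q\<close>.\<close>

theorem symbolic_power_IL: "symbolic_power R IL n = V n"
proof -
  interpret P: ladder_ideal_powers L v d c t fld IPow by (rule ladder_ideal_powers_IL)
  interpret cring R by (rule cring_R)
  interpret S: semiring "ideals_set R" by (rule ideals_set_is_semiring)
  have IS: "IL \<in> carrier (ideals_set R)" using ideal_IL by (simp add: ideals_set_def)
  have "IL = V 1" using P.Pw_1 S.nat_pow_eone[OF IS] by simp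
  then have "associated_primes R IL = {V 1}" using associated_primes_V1 by simp
  then have "symbolic_power R IL n = P.Q n"
    by (auto simp: symbolic_power_def P.Q_def)
  then show ?thesis by (simp add: P.Q_eq_V)
qed

lemma ex_V_with_lm:
  assumes "supp m \<subseteq> L" and "\<And>G s. labelling G s \<Longrightarrow> n \<le> (\<Sum>x\<in>L - G. coef m x)"
  shows "\<exists>f\<in>V n. f \<noteq> 0 \<and> lm awt f = m"
proof -
  interpret P: ladder_ideal_powers L v d c t fld IPow by (rule ladder_ideal_powers_IL)
  show ?thesis using P.ex_Q_with_lm[OF assms] P.Q_eq_V by simp
qed

end


section \<open>Symbolic blowup algebras\<close>

context capped_ladder
begin

abbreviation RV :: "('k mpoly, nat \<Rightarrow> 'k mpoly) up_ring" where "RV \<equiv> rees_ring R V"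

section \<open>Arithmetic of the symbolic Rees algebra\<close>

lemma finsum_R: "(\<And>a. a \<in> A \<Longrightarrow> ladder_poly L (f a)) \<Longrightarrow> finsum R f A = sum f A"
proof (induction A rule: infinite_finite_induct)
  interpret cring R by (rule cring_R)
  {
    case (infinite A)
    then show ?case by (simp add: finsum_infinite)
  next
    case empty
    show ?case by simp
  next
    case (insert x A)
    then have "finsum R f (insert x A) = f x \<oplus>\<^bsub>R\<^esub> finsum R f A" by (intro finsum_insert) auto
    then show ?case using insert by simp
  }
qed

lemma V_sum: "(\<And>i. i \<in> A \<Longrightarrow> f i \<in> V n) \<Longrightarrow> sum f A \<in> V n"
  by (induction A rule: infinite_finite_induct) (auto intro: V_add)

lemma up_R: "p \<in> up R \<longleftrightarrow> (\<forall>n. ladder_poly L (p n)) \<and> finite {n. p n \<noteq> 0}"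
proof
  assume p: "p \<in> up R"
  then obtain N where "bound 0 N p" by (auto simp: up_def)
  then have "{n. p n \<noteq> 0} \<subseteq> {..N}" by (auto simp: bound_def) (meson not_le)
  then show "(\<forall>n. ladder_poly L (p n)) \<and> finite {n. p n \<noteq> 0}"
    using p finite_subset by (auto simp: up_def)
next
  assume p: "(\<forall>n. ladder_poly L (p n)) \<and> finite {n. p n \<noteq> 0}"
  then obtain N where "\<forall>n\<in>{n. p n \<noteq> 0}. n \<le> N" by (meson finite_nat_set_iff_bounded_le)
  then have "bound 0 N p" by (force simp: bound_def)
  then show "p \<in> up R" using p by (auto simp: up_def)
qed

lemma RV_carrier: "p \<in> carrier RV \<longleftrightarrow> (\<forall>n. p n \<in> V n) \<and> finite {n. p n \<noteq> 0}"
proof -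
  have "p \<in> carrier RV \<longleftrightarrow> p \<in> up R \<and> (\<forall>n. p n \<in> V n)"
    by (auto simp: rees_ring_def UP_def)
  then show ?thesis using V_ladder_poly by (auto simp: up_R)
qed

lemma RV_up: "p \<in> carrier RV \<Longrightarrow> p \<in> up R"
  using V_ladder_poly by (auto simp: RV_carrier up_R)

lemma RV_simps:
  "\<zero>\<^bsub>RV\<^esub> = (\<lambda>n. 0)" "\<one>\<^bsub>RV\<^esub> = (\<lambda>n. if n = 0 then 1 else 0)"
  "p \<in> carrier RV \<Longrightarrow> q \<in> carrier RV \<Longrightarrow> p \<oplus>\<^bsub>RV\<^esub> q = (\<lambda>n. p n + q n)"
  "p \<in> carrier RV \<Longrightarrow> q \<in> carrier RV \<Longrightarrow> p \<otimes>\<^bsub>RV\<^esub> q = (\<lambda>n. \<Sum>i\<le>n. p i * q (n - i))"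
proof -
  show "\<zero>\<^bsub>RV\<^esub> = (\<lambda>n. 0)" "\<one>\<^bsub>RV\<^esub> = (\<lambda>n. if n = 0 then 1 else 0)"
    by (auto simp: rees_ring_def UP_def)
  assume p: "p \<in> carrier RV" and q: "q \<in> carrier RV"
  show "p \<oplus>\<^bsub>RV\<^esub> q = (\<lambda>n. p n + q n)"
    using RV_up[OF p] RV_up[OF q] by (simp add: rees_ring_def UP_def)
  have "finsum R (\<lambda>i. p i * q (n - i)) {..n} = (\<Sum>i\<le>n. p i * q (n - i))" for n
    using p q by (intro finsum_R ladder_poly_mult) (auto simp: RV_carrier intro: V_ladder_poly)
  then show "p \<otimes>\<^bsub>RV\<^esub> q = (\<lambda>n. \<Sum>i\<le>n. p i * q (n - i))"
    using RV_up[OF p] RV_up[OF q] by (simp add: rees_ring_def UP_def)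
qed

lemma cring_RV: "cring RV"
proof -
  interpret R: cring R by (rule cring_R)
  interpret UP: UP_cring R "UP R" by (unfold_locales; simp)
  have UPs: "\<zero>\<^bsub>UP R\<^esub> = \<zero>\<^bsub>RV\<^esub>" "\<one>\<^bsub>UP R\<^esub> = \<one>\<^bsub>RV\<^esub>" "p \<otimes>\<^bsub>UP R\<^esub> q = p \<otimes>\<^bsub>RV\<^esub> q" "p \<oplus>\<^bsub>UP R\<^esub> q = p \<oplus>\<^bsub>RV\<^esub> q" for p q
    by (simp_all add: rees_ring_def)
  have sub: "carrier RV \<subseteq> carrier (UP R)" by (auto simp: rees_ring_def)
  have "subring (carrier RV) (UP R)"
  proof (rule UP.P.subringI[OF sub])
    show "\<one>\<^bsub>UP R\<^esub> \<in> carrier RV" unfolding UPs RV_simps by (auto simp: RV_carrier V_0)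
    fix p assume p: "p \<in> carrier RV"
    have m: "(\<lambda>n. - p n) \<in> carrier RV" using p by (auto simp: RV_carrier V_uminus)
    have "(\<lambda>n. - p n) \<oplus>\<^bsub>UP R\<^esub> p = \<zero>\<^bsub>UP R\<^esub>" unfolding UPs RV_simps(1) RV_simps(3)[OF m p] by simp
    then have "\<ominus>\<^bsub>UP R\<^esub> p = (\<lambda>n. - p n)"
      by (rule UP.P.minus_equality[OF _ subsetD[OF sub p] subsetD[OF sub m]])
    then show "\<ominus>\<^bsub>UP R\<^esub> p \<in> carrier RV" using m by simp
  next
    fix p q assume pq: "p \<in> carrier RV" "q \<in> carrier RV"
    have "carrier (UP R) = up R" by (simp add: UP_def)
    \<comment> \<open>Membership in \<open>up R\<close> supplies the finite support; it remains to
      see that the coefficients lie in the right \<open>V n\<close>.\<close>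
    then have U: "p \<oplus>\<^bsub>UP R\<^esub> q \<in> up R" "p \<otimes>\<^bsub>UP R\<^esub> q \<in> up R"
      using UP.P.a_closed[OF subsetD[OF sub pq(1)] subsetD[OF sub pq(2)]]
        UP.P.m_closed[OF subsetD[OF sub pq(1)] subsetD[OF sub pq(2)]] by simp_all
    show "p \<otimes>\<^bsub>UP R\<^esub> q \<in> carrier RV"
    proof -
      have "(\<Sum>i\<le>n. p i * q (n - i)) \<in> V n" for n
      proof (rule V_sum)
        fix i assume "i \<in> {..n}"
        then show "p i * q (n - i) \<in> V n" using V_mult[of "p i" i "q (n - i)" "n - i"] pq by (auto simp: RV_carrier)
      qed
      then show ?thesis using U(2) unfolding UPs RV_simps(4)[OF pq] by (auto simp: RV_carrier up_R)
    qed
    show "p \<oplus>\<^bsub>UP R\<^esub> q \<in> carrier RV"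
      using U(1) pq unfolding UPs RV_simps(3)[OF pq] by (auto simp: RV_carrier up_R V_add)
  qed
  then have "subcring (carrier RV) (UP R)" by (rule UP.P.subcringI')
  then have "cring ((UP R)\<lparr>carrier := carrier RV\<rparr>)" using UP.P.subcring_iff[OF sub] by simp
  moreover have "(UP R)\<lparr>carrier := carrier RV\<rparr> = RV" by (simp add: rees_ring_def)
  ultimately show ?thesis by simp
qed

section \<open>Leading exponents and division\<close>

definition dg :: "(nat \<Rightarrow> 'k mpoly) \<Rightarrow> nat" where
  "dg p = Max {n. p n \<noteq> 0}"

definition ld :: "(nat \<Rightarrow> 'k mpoly) \<Rightarrow> nat \<times> ((nat \<times> nat) \<Rightarrow>\<^sub>0 nat)" where
  "ld p = (dg p, lm awt (p (dg p)))"

lemma dg_props: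
  assumes "p \<in> carrier RV" "p \<noteq> (\<lambda>n. 0)"
  shows "p (dg p) \<noteq> 0" "dg p < n \<Longrightarrow> p n = 0"
proof -
  have f: "finite {n. p n \<noteq> 0}" using assms(1) by (simp add: RV_carrier)
  have "{n. p n \<noteq> 0} \<noteq> {}" using assms(2) by (auto simp: fun_eq_iff)
  then have "dg p \<in> {n. p n \<noteq> 0}" unfolding dg_def using f by (intro Max_in)
  then show "p (dg p) \<noteq> 0" by simp
  show "p n = 0" if "dg p < n"
  proof (rule ccontr)
    assume "p n \<noteq> 0"
    then have "n \<le> dg p" unfolding dg_def using f by (intro Max_ge) auto
    then show False using that by simp
  qed
qed

text \<open>Divisibility in the monoid of the pairs \<open>(n, lm f)\<close> with \<open>f \<in> V n\<close>, with subtractions avoided.\<close>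

definition ldvd :: "nat \<times> ((nat \<times> nat) \<Rightarrow>\<^sub>0 nat) \<Rightarrow> nat \<times> ((nat \<times> nat) \<Rightarrow>\<^sub>0 nat) \<Rightarrow> bool" where
  "ldvd a b \<longleftrightarrow> fst a \<le> fst b \<and> (\<forall>x. coef (snd a) x \<le> coef (snd b) x) \<and>
    (\<forall>G s. labelling G s \<longrightarrow>
      (\<Sum>x\<in>L - G. coef (snd a) x) + fst b \<le> (\<Sum>x\<in>L - G. coef (snd b) x) + fst a)"

lemma ldvd_wqo:
  fixes e :: "nat \<Rightarrow> nat \<Rightarrow> 'k mpoly"
  assumes "\<And>n. e n \<in> carrier RV - {\<zero>\<^bsub>RV\<^esub>}"
  shows "\<exists>i j. i < j \<and> ldvd (ld (e i)) (ld (e j))"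
proof -
  \<comment> \<open>The coordinates for Dickson's lemma are the exponents, the degree in
    \<open>T\<close> and, for every \<open>G\<close>, the slack in \<open>lm_V_bound\<close>. For
    labelled \<open>G\<close> this slack is nonnegative, so the truncated subtraction is
    exact.\<close>
  define F where "F k i = (case i of Inl x \<Rightarrow> coef (snd (ld (e k))) x | Inr None \<Rightarrow> fst (ld (e k))
    | Inr (Some G) \<Rightarrow> (\<Sum>x\<in>L - G. coef (snd (ld (e k))) x) - fst (ld (e k)))" for k :: nat and i
  define I where "I = Inl ` L \<union> Inr ` (insert None (Some ` Pow L))"
  have "finite I" using finL by (simp add: I_def)
  from dickson[OF this, of F] obtain r :: "nat \<Rightarrow> nat"
    where r: "strict_mono r" "\<And>i. i \<in> I \<Longrightarrow> mono (\<lambda>n. F (r n) i)" by blast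
  have le: "F (r 0) i \<le> F (r 1) i" if "i \<in> I" for i
    using monoD[OF r(2)[OF that], of 0 1] by simp
  have ek: "e k (dg (e k)) \<in> V (dg (e k))" "e k (dg (e k)) \<noteq> 0" for k
  proof -
    have "e k \<in> carrier RV" "e k \<noteq> (\<lambda>n. 0)" using assms[of k] unfolding RV_simps by blast+
    then show "e k (dg (e k)) \<in> V (dg (e k))" "e k (dg (e k)) \<noteq> 0"
      using dg_props(1)[of "e k"] unfolding RV_carrier by blast+
  qed
  have "ldvd (ld (e (r 0))) (ld (e (r 1)))"
    unfolding ldvd_def
  proof (intro conjI allI impI)
    show "fst (ld (e (r 0))) \<le> fst (ld (e (r 1)))"
      using le[of "Inr None"] by (simp add: I_def F_def)
    show "coef (snd (ld (e (r 0)))) x \<le> coef (snd (ld (e (r 1)))) x" for x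
    proof (cases "x \<in> L")
      case True
      then show ?thesis using le[of "Inl x"] by (simp add: I_def F_def)
    next
      case False
      then have "x \<notin> supp (snd (ld (e (r 0))))"
        using ladder_poly_lm[OF V_ladder_poly[OF ek(1)] ek(2)] by (auto simp: ld_def)
      then show ?thesis by (simp add: in_keys_iff)
    qed
    fix G s assume lab: "labelling G s"
    then have "Inr (Some G) \<in> I" by (auto simp: I_def labelling_def)
    from le[OF this] lm_V_bound[OF lab ek, of "r 0"] lm_V_bound[OF lab ek, of "r 1"]
    show "(\<Sum>x\<in>L - G. coef (snd (ld (e (r 0)))) x) + fst (ld (e (r 1)))
      \<le> (\<Sum>x\<in>L - G. coef (snd (ld (e (r 1)))) x) + fst (ld (e (r 0)))"
      by (simp add: F_def ld_def)
  qed
  then show ?thesis using strict_monoD[OF r(1), of 0 1] by auto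
qed

definition lorder :: "((nat \<times> ((nat \<times> nat) \<Rightarrow>\<^sub>0 nat)) \<times> (nat \<times> ((nat \<times> nat) \<Rightarrow>\<^sub>0 nat))) set" where
  "lorder = less_than <*lex*> {(m, m'). mkey awt m < mkey awt m'}"

lemma ldvd_division:
  assumes p: "p \<in> carrier RV - {\<zero>\<^bsub>RV\<^esub>}" and q: "q \<in> carrier RV - {\<zero>\<^bsub>RV\<^esub>}" and dv: "ldvd (ld p) (ld q)"
  shows "\<exists>h\<in>carrier RV. q \<ominus>\<^bsub>RV\<^esub> h \<otimes>\<^bsub>RV\<^esub> p = \<zero>\<^bsub>RV\<^esub> \<or> (ld (q \<ominus>\<^bsub>RV\<^esub> h \<otimes>\<^bsub>RV\<^esub> p), ld q) \<in> lorder"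
proof -
  interpret RV: cring RV by (rule cring_RV)
  have p': "p \<in> carrier RV" "p \<noteq> (\<lambda>n. 0)" and q': "q \<in> carrier RV" "q \<noteq> (\<lambda>n. 0)"
    using p q by (auto simp: RV_simps)
  let ?m = "snd (ld q) - snd (ld p)" and ?n = "dg q - dg p"
  have pq: "dg p \<le> dg q" using dv by (simp add: ldvd_def ld_def)
  have cle: "coef (snd (ld p)) x \<le> coef (snd (ld q)) x" for x using dv unfolding ldvd_def by blast
  have qV: "q (dg q) \<in> V (dg q)" "q (dg q) \<noteq> 0" using q'(1) dg_props(1)[OF q'] unfolding RV_carrier by blast+
  have "supp ?m \<subseteq> supp (snd (ld q))" by (auto simp: in_keys_iff lookup_minus)
  also have "\<dots> \<subseteq> L" using ladder_poly_lm[OF V_ladder_poly[OF qV(1)] qV(2)] by (simp add: ld_def)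
  finally have mL: "supp ?m \<subseteq> L" .
  have bound: "?n \<le> (\<Sum>x\<in>L - G. coef ?m x)" if "labelling G s" for G s
  proof -
    have "(\<Sum>x\<in>L - G. coef ?m x) = (\<Sum>x\<in>L - G. coef (snd (ld q)) x) - (\<Sum>x\<in>L - G. coef (snd (ld p)) x)"
      unfolding lookup_minus by (rule sum_subtractf_nat) (rule cle)
    then show ?thesis using dv that by (fastforce simp: ldvd_def ld_def)
  qed
  \<comment> \<open>The last condition in \<open>ldvd\<close> says that the quotient of the
    exponents again satisfies the inequalities of the cone, hence is a leading exponent.\<close>
  obtain g where g: "g \<in> V ?n" "g \<noteq> 0" "lm awt g = ?m" using ex_V_with_lm[OF mL, of ?n] bound by blast
  have pd: "p (dg p) \<noteq> 0" using dg_props(1)[OF p'] .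
  have gp: "g * p (dg p) \<noteq> 0" "lm awt (g * p (dg p)) = lm awt (q (dg q))"
  proof -
    show "g * p (dg p) \<noteq> 0" using g pd by simp
    have "?m + snd (ld p) = snd (ld q)"
      by (rule poly_mapping_eqI) (use cle in \<open>simp add: lookup_add lookup_minus\<close>)
    then show "lm awt (g * p (dg p)) = lm awt (q (dg q))"
      using lm_mult(1)[OF g(2) pd, of awt] g(3) by (simp add: ld_def)
  qed
  define a where "a = coef (q (dg q)) (lm awt (q (dg q))) / coef (g * p (dg p)) (lm awt (g * p (dg p)))"
  define h where "h n = (if n = ?n then sgl 0 a * g else 0)" for n
  have "{n. h n \<noteq> 0} \<subseteq> {?n}" by (auto simp: h_def)
  then have "finite {n. h n \<noteq> 0}" by (rule finite_subset) simp
  then have h: "h \<in> carrier RV" using V_mult_left[OF _ g(1)] by (auto simp: RV_carrier h_def)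
  let ?r = "q \<ominus>\<^bsub>RV\<^esub> h \<otimes>\<^bsub>RV\<^esub> p"
  have hp: "(h \<otimes>\<^bsub>RV\<^esub> p) n = (if ?n \<le> n then sgl 0 a * g * p (n - ?n) else 0)" for n
  proof -
    have "(h \<otimes>\<^bsub>RV\<^esub> p) n = (\<Sum>i\<le>n. if i = ?n then sgl 0 a * g * p (n - ?n) else 0)"
      unfolding RV_simps(4)[OF h p'(1)] by (rule sum.cong) (auto simp: h_def)
    then show ?thesis by simp
  qed
  have rc: "?r \<in> carrier RV" using q' h p' by simp
  have r: "?r n = q n - (h \<otimes>\<^bsub>RV\<^esub> p) n" for n
  proof -
    have "?r \<oplus>\<^bsub>RV\<^esub> (h \<otimes>\<^bsub>RV\<^esub> p) = q"
      using q' h p' by (simp add: a_minus_def RV.a_assoc RV.l_neg)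
    then have "(\<lambda>n. ?r n + (h \<otimes>\<^bsub>RV\<^esub> p) n) = q"
      using RV_simps(3)[OF rc, of "h \<otimes>\<^bsub>RV\<^esub> p"] h p' by simp
    from fun_cong[OF this, of n] show ?thesis by (simp add: eq_diff_eq)
  qed
  \<comment> \<open>The leading term of the top coefficient is cancelled: either the degree in
    \<open>T\<close> drops or the leading monomial of that coefficient does.\<close>
  have "?r = \<zero>\<^bsub>RV\<^esub> \<or> (ld ?r, ld q) \<in> lorder"
  proof (rule disjCI)
    assume notin: "(ld ?r, ld q) \<notin> lorder"
    show "?r = \<zero>\<^bsub>RV\<^esub>"
    proof (rule ccontr)
      assume "?r \<noteq> \<zero>\<^bsub>RV\<^esub>"
      then have r0: "?r \<noteq> (\<lambda>n. 0)" by (simp add: RV_simps)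
      have rd: "?r (dg ?r) \<noteq> 0" using dg_props(1)[OF rc r0] .
      have "?r n = 0" if "dg q < n" for n
      proof -
        have "dg p < n - ?n" using that pq by linarith
        then show ?thesis unfolding r hp using dg_props(2)[OF q' that] dg_props(2)[OF p'] by simp
      qed
      then have "dg ?r \<le> dg q" using rd by (meson not_le)
      then have eq: "dg ?r = dg q" using notin by (auto simp: lorder_def ld_def)
      have "?r (dg q) = q (dg q) - sgl 0 a * (g * p (dg p))"
        unfolding r hp using pq by (simp add: mult.assoc)
      moreover have "q (dg q) - sgl 0 a * (g * p (dg p)) = 0 \<or>
          mkey awt (lm awt (q (dg q) - sgl 0 a * (g * p (dg p)))) < mkey awt (lm awt (q (dg q)))"
        unfolding a_def by (rule lm_cancel[OF qV(2) gp(1)]) (simp add: gp(2))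
      ultimately show False using rd notin eq by (auto simp: lorder_def ld_def)
    qed
  qed
  then show ?thesis using h by blast
qed

theorem noetherian_RV: "noetherian_ring RV"
proof -
  interpret RV: cring RV by (rule cring_RV)
  show ?thesis
  proof (rule RV.noetherian_by_division)
    show "wf lorder" unfolding lorder_def by (intro wf_lex_prod wf_less_than wf_awt)
  qed (fact ldvd_wqo ldvd_division)+
qed

theorem noetherian_gr: "noetherian_ring (assoc_graded_ring R V)"
proof (rule noetherian_image[OF noetherian_RV])
  interpret R: cring R by (rule cring_R)
  let ?G = "assoc_graded_ring R V" and ?h = "\<lambda>p n. V (Suc n) +>\<^bsub>R\<^esub> p n"
  have id: "ideal (V n) R" for n by (rule ideal_V)
  have V0: "V n +>\<^bsub>R\<^esub> 0 = V n" for n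
  proof -
    interpret I: ideal "V n" R by (rule id)
    show ?thesis using R.a_coset_add_zero[OF I.a_subset] by simp
  qed
  show "?h ` carrier RV = carrier ?G"
  proof
    show "?h ` carrier RV \<subseteq> carrier ?G"
    proof
      fix f assume "f \<in> ?h ` carrier RV"
      then obtain p where p: "p \<in> carrier RV" "f = ?h p" by blast
      have "{n. f n \<noteq> V (Suc n)} \<subseteq> {n. p n \<noteq> 0}" using p(2) V0 by auto
      then have "finite {n. f n \<noteq> V (Suc n)}" using p(1) finite_subset by (auto simp: RV_carrier)
      then show "f \<in> carrier ?G" using p by (auto simp: assoc_graded_ring_def RV_carrier)
    qed
    show "carrier ?G \<subseteq> ?h ` carrier RV"
    proof
      fix f assume "f \<in> carrier ?G"
      then have f: "\<And>n. \<exists>x\<in>V n. f n = V (Suc n) +>\<^bsub>R\<^esub> x" "finite {n. f n \<noteq> V (Suc n)}"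
        by (auto simp: assoc_graded_ring_def)
      then obtain x where x: "\<And>n. x n \<in> V n" "\<And>n. f n = V (Suc n) +>\<^bsub>R\<^esub> x n" by metis
      \<comment> \<open>Zero cosets must be lifted to zero; other representatives could destroy
        finite support.\<close>
      define p where "p n = (if f n = V (Suc n) then 0 else x n)" for n
      have "{n. p n \<noteq> 0} \<subseteq> {n. f n \<noteq> V (Suc n)}" by (auto simp: p_def)
      then have "p \<in> carrier RV" using x(1) f(2) finite_subset by (auto simp: RV_carrier p_def)
      moreover have "f = ?h p" using x(2) V0 by (auto simp: p_def fun_eq_iff)
      ultimately show "f \<in> ?h ` carrier RV" by blast
    qed
  qed
  show "?h \<zero>\<^bsub>RV\<^esub> = \<zero>\<^bsub>?G\<^esub>" by (simp add: RV_simps V0 assoc_graded_ring_def)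
  show "?h \<one>\<^bsub>RV\<^esub> = \<one>\<^bsub>?G\<^esub>" by (rule ext) (simp add: RV_simps V0 assoc_graded_ring_def)
  fix p q assume p: "p \<in> carrier RV" and q: "q \<in> carrier RV"
  have pL: "p n \<in> carrier R" "q n \<in> carrier R" for n
    using p q V_ladder_poly[of "p n" n] V_ladder_poly[of "q n" n] by (auto simp: RV_carrier)
  show "?h (p \<oplus>\<^bsub>RV\<^esub> q) = ?h p \<oplus>\<^bsub>?G\<^esub> ?h q"
  proof
    fix n
    interpret I: ideal "V (Suc n)" R by (rule id)
    show "?h (p \<oplus>\<^bsub>RV\<^esub> q) n = (?h p \<oplus>\<^bsub>?G\<^esub> ?h q) n"
      using I.a_rcos_sum[OF pL(1) pL(2), of n n] unfolding RV_simps(3)[OF p q]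
      by (simp add: assoc_graded_ring_def)
  qed
  show "?h (p \<otimes>\<^bsub>RV\<^esub> q) = ?h p \<otimes>\<^bsub>?G\<^esub> ?h q"
  proof
    fix n
    interpret I: ideal "V (Suc n)" R by (rule id)
    interpret h: ring_hom_cring R "R Quot V (Suc n)" "(+>\<^bsub>R\<^esub>) (V (Suc n))"
      by (rule I.rcos_ring_hom_cring[OF cring_R])
    \<comment> \<open>The factors are cosets of \<open>V (Suc i)\<close> and
      \<open>V (Suc (n - i))\<close>, not of \<open>V (Suc n)\<close>, so their product is not one
      in the quotient ring and is computed directly; the filtration puts the mixed terms into
      \<open>V (Suc n)\<close>.\<close>
    have "rcoset_mult R (V (Suc n)) (?h p i) (?h q (n - i)) = V (Suc n) +>\<^bsub>R\<^esub> (p i * q (n - i))"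
      if i: "i \<in> {..n}" for i
    proof
      have coset: "z \<in> V m +>\<^bsub>R\<^esub> x \<longleftrightarrow> (\<exists>w\<in>V m. z = w + x)" for z m x
        by (auto simp: a_r_coset_def' )
      show "rcoset_mult R (V (Suc n)) (?h p i) (?h q (n - i)) \<subseteq> V (Suc n) +>\<^bsub>R\<^esub> (p i * q (n - i))"
      proof
        fix z assume "z \<in> rcoset_mult R (V (Suc n)) (?h p i) (?h q (n - i))"
        then obtain w w' w'' where w: "w \<in> V (Suc i)" "w' \<in> V (Suc (n - i))" "w'' \<in> V (Suc n)"
          "z = w'' + (w + p i) * (w' + q (n - i))"
          by (auto simp: rcoset_mult_def coset)
        have pi: "p i \<in> V i" "q (n - i) \<in> V (n - i)" using p q by (auto simp: RV_carrier)
        have "w * w' \<in> V (Suc n)" using V_mult[OF w(1,2)] V_antimono[of "Suc n" "Suc i + Suc (n - i)"] i by auto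
        moreover have "w * q (n - i) \<in> V (Suc n)" using V_mult[OF w(1) pi(2)] i by simp
        moreover have "p i * w' \<in> V (Suc n)" using V_mult[OF pi(1) w(2)] i by simp
        ultimately have "w'' + (w * w' + w * q (n - i) + p i * w') \<in> V (Suc n)" using w(3) by (intro V_add)
        moreover have "z = w'' + (w * w' + w * q (n - i) + p i * w') + p i * q (n - i)"
          unfolding w(4) by (simp add: algebra_simps)
        ultimately show "z \<in> V (Suc n) +>\<^bsub>R\<^esub> (p i * q (n - i))" unfolding coset by blast
      qed
      have "p i \<in> ?h p i" "q (n - i) \<in> ?h q (n - i)" unfolding coset by (auto intro!: bexI[of _ 0])
      then show "V (Suc n) +>\<^bsub>R\<^esub> (p i * q (n - i)) \<subseteq> rcoset_mult R (V (Suc n)) (?h p i) (?h q (n - i))"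
        unfolding rcoset_mult_def by force
    qed
    then have "(\<Oplus>\<^bsub>R Quot V (Suc n)\<^esub>i\<in>{..n}. rcoset_mult R (V (Suc n)) (?h p i) (?h q (n - i))) =
        (\<Oplus>\<^bsub>R Quot V (Suc n)\<^esub>i\<in>{..n}. V (Suc n) +>\<^bsub>R\<^esub> (p i * q (n - i)))"
      using pL by (intro h.S.finsum_cong') (auto simp: ladder_poly_mult intro!: h.hom_closed)
    also have "\<dots> = V (Suc n) +>\<^bsub>R\<^esub> finsum R (\<lambda>i. p i * q (n - i)) {..n}"
      using pL by (subst h.hom_finsum) (auto simp: ladder_poly_mult o_def)
    also have "finsum R (\<lambda>i. p i * q (n - i)) {..n} = (p \<otimes>\<^bsub>RV\<^esub> q) n"
      unfolding RV_simps(4)[OF p q] using pL by (intro finsum_R) (auto simp: ladder_poly_mult)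
    finally show "?h (p \<otimes>\<^bsub>RV\<^esub> q) n = (?h p \<otimes>\<^bsub>?G\<^esub> ?h q) n"
      by (simp add: assoc_graded_ring_def)
  qed
qed

end

theorem theorem3p5:
  fixes k l u v :: nat and L :: "(nat \<times> nat) set"
    and b a d c t :: "nat \<Rightarrow> nat"
    and I :: "'k::field mpoly set"
  assumes "ladder k l L"
    and "upper_outside_corners l L u b a"
    and "lower_outside_corners k L v d c"
    and "corners_distinct u b a v d c"
    and "\<forall>j\<in>{1..v}. 0 < t j"
    and "nondegenerate TYPE('k) k l L u b a v d c t"
    and "I = mixed_ladder_ideal l L v d c t"
  shows "noetherian_ring (symbolic_rees (ladder_ring L) I)
    \<and> noetherian_ring (symbolic_gr (ladder_ring L) I)"
proof -
  have L: "L \<subseteq> {1..k} \<times> {1..l}" using assms(1) by (simp add: ladder_def)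
  have "finite L" by (rule finite_subset[OF L]) simp
  have sub: "subladder l L d c h = {x \<in> L. fst x \<le> d h \<and> c h \<le> snd x}" for h
    using L by (auto simp: subladder_def)
  interpret capped_ladder L v d c t "TYPE('k)"
  proof unfold_locales
    show "finite L" by fact
    show "{i..i'} \<times> {j'..j} \<subseteq> L" if "(i, j) \<in> L" "(i', j') \<in> L" "i \<le> i'" "j' \<le> j" for i j i' j'
      using assms(1) that unfolding ladder_def by blast
    show "mono_on {1..v} d" "mono_on {1..v} c" using assms(3) by (auto simp: lower_outside_corners_def)
    show "0 < t h" if "h \<in> {1..v}" for h using assms(5) that by blast
    show "\<exists>h\<in>{1..v}. fst x \<le> d h \<and> c h \<le> snd x" if "x \<in> L" for x
    proof -
      obtain i j where x: "x = (i, j)" by (cases x)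
      \<comment> \<open>An entry involved in a generating minor lies in the corresponding
        subladder.\<close>
      have "\<forall>(i, j)\<in>L. \<exists>h\<in>{1..v}. \<exists>A B. rows_cols_in (t h) (subladder l L d c h) A B \<and> i \<in> A \<and> j \<in> B"
        using assms(6) unfolding nondegenerate_def by (rule conjunct1)
      with \<open>x \<in> L\<close> obtain h A B where "h \<in> {1..v}" "rows_cols_in (t h) (subladder l L d c h) A B" "i \<in> A" "j \<in> B"
        unfolding x by blast
      then show ?thesis by (auto simp: rows_cols_in_def sub x intro!: bexI[of _ h])
    qed
  qed
  have "I = IL"
    unfolding assms(7) mixed_ladder_ideal_def IL_def sub sub_def ..
  then have V: "symbolic_power R I = V" by (simp add: symbolic_power_IL fun_eq_iff)
  then show ?thesis
    unfolding symbolic_rees_def symbolic_gr_def V using noetherian_RV noetherian_gr by blast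
qed

end
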